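(* Let $q\in\mathbb N$, $d\in(0,1/2)$, and let $w:\mathbb T\to\mathbb C^{q\times q}$ be of the form $w(e^{i\theta})=|1-e^{i\theta}|^{-2d}g(e^{i\theta})g(e^{i\theta})^*$, where the entries of $g(z)$ are rational functions of $z$ with no poles in the closed unit disk and $\det g(z)$ has no zeros in the closed unit disk. For $n\in\mathbb N$ and $t\in\{1,\dots,n\}$ put $$C_{t,n}:=\sum_{s=1}^{n}\left\|(T_n(w)^{-1})^{s,t}-(T_\infty(w)^{-1})^{s,t}\right\|.$$ Let $\delta\in(0,1)$. Then there exists $M\in(0,\infty)$, depending only on $w$ and $\delta$, such that $$C_{t,n}\le M n^{-d}t^{-d},\qquad n\in\mathbb N,\ t\in\{1,\dots,[\delta n]\},$$ $$C_{t,n}\le M n^{(1/2)-d}(n+1-t)^{-(1/2)-d},\qquad n\in\mathbb N,\ t\in\{[\delta n]+1,\dots,n\}.$$ Moreover, $$\sup_{n\in\mathbb N}\max_{t\in\{1,\dots,n\}}C_{t,n}<\infty.$$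
   Context: $\mathbb N=\{1,2,\dots\}$; $\mathbb T$ is the unit circle and $\mathbb D$ the open unit disk in $\mathbb C$; $\|a\|$ is the spectral norm and $a^*$ the Hermitian conjugate of a matrix $a$; $[x]$ is the floor of $x\in\mathbb R$. Put $\gamma(k)=\int_{-\pi}^{\pi}e^{-ik\theta}w(e^{i\theta})\frac{d\theta}{2\pi}\in\mathbb C^{q\times q}$ for $k\in\mathbb Z$, $T_n(w)=(\gamma(s-t))_{1\le s,t\le n}\in\mathbb C^{qn\times qn}$ (which is invertible) and $T_\infty(w)=(\gamma(s-t))_{s,t\ge1}$. For a finite or semi-infinite block matrix $A$, $A^{s,t}\in\mathbb C^{q\times q}$ denotes its $(s,t)$ block. The inverse $T_\infty(w)^{-1}$ of the semi-infinite block Toeplitz matrix is the following semi-infinite block matrix. There is a rational $g_\sharp:\mathbb T\to\mathbb C^{q\times q}$ with the same two properties as $g$ (entries rational without poles in the closed unit disk, determinant without zeros there) such that $g(e^{i\theta})g(e^{i\theta})^*=g_\sharp(e^{i\theta})^*g_\sharp(e^{i\theta})$ for all $\theta$; fix one. Put $h_\sharp(z)=(1-z)^{-d}g_\sharp(z)$ (principal branch), $\tilde h(z)=\{h_\sharp(\overline z)\}^*$, and define $\{\tilde a_k\}_{k\ge0}\subset\mathbb C^{q\times q}$ by $-\tilde h(z)^{-1}=\sum_{k=0}^\infty z^k\tilde a_k$, $z\in\mathbb D$. Then $$(T_\infty(w)^{-1})^{s,t}=\sum_{\ell=1}^{\min(s,t)}\tilde a_{s-\ell}^*\,\tilde a_{t-\ell},\qquad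 s,t\in\mathbb N.$$ *)

theory Defs
  imports "HOL-Analysis.Analysis" "HOL-Computational_Algebra.Polynomial"
begin

text \<open>The size q of the blocks is the cardinality of the finite index type \<open>'q\<close>.\<close>

type_synonym 'q cmat = "complex ^ 'q ^ 'q"

definition herm :: "'q::finite cmat \<Rightarrow> 'q cmat" where
  "herm A = map_matrix cnj (transpose A)"

definition cscale :: "complex \<Rightarrow> 'q::finite cmat \<Rightarrow> 'q cmat" where
  "cscale c A = map_matrix (\<lambda>x. c * x) A"

definition spectral_norm :: "'q::finite cmat \<Rightarrow> real" where
  "spectral_norm A = onorm (\<lambda>x. A *v x)"

text \<open>Only the values on the closed unit disk matter. A rational function has no poles there iff it
  is a quotient of polynomials whose denominator has no zeros there (removable singularities are
  thus filled in).\<close>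

definition rational_invertible_on_disk :: "(complex \<Rightarrow> 'q::finite cmat) \<Rightarrow> bool" where
  "rational_invertible_on_disk g \<longleftrightarrow>
     (\<forall>i j. \<exists>p r. \<forall>z\<in>cball 0 1. poly r z \<noteq> 0 \<and> g z $ i $ j = poly p z / poly r z) \<and>
     (\<forall>z\<in>cball 0 1. det (g z) \<noteq> 0)"

text \<open>The point 1, where the weight is infinite, is excluded: the value \<open>w 1\<close> is irrelevant.\<close>

definition weight_factor :: "real \<Rightarrow> (complex \<Rightarrow> 'q::finite cmat) \<Rightarrow> (complex \<Rightarrow> 'q cmat) \<Rightarrow> bool" where
  "weight_factor d w g \<longleftrightarrow> rational_invertible_on_disk g \<and>
     (\<forall>z\<in>sphere 0 1 - {1}. w z = norm (1 - z) powr (- 2 * d) *\<^sub>R (g z ** herm (g z)))"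

definition sharp_factor :: "(complex \<Rightarrow> 'q::finite cmat) \<Rightarrow> (complex \<Rightarrow> 'q cmat) \<Rightarrow> bool" where
  "sharp_factor g gs \<longleftrightarrow> rational_invertible_on_disk gs \<and>
     (\<forall>z\<in>sphere 0 1. g z ** herm (g z) = herm (gs z) ** gs z)"

definition fourier_coeff :: "(complex \<Rightarrow> 'q::finite cmat) \<Rightarrow> int \<Rightarrow> 'q cmat" where
  "fourier_coeff w k =
     (\<chi> i j. (LBINT \<theta>:{-pi..pi}. cis (- (of_int k * \<theta>)) * w (cis \<theta>) $ i $ j) / (2 * pi))"

text \<open>A block matrix is a function of its two block indices, which start at 1. An \<open>n\<close> by \<open>n\<close>
  block matrix is given by the values at indices in \<open>{1..n}\<close>; other values are ignored.
  In particular \<open>toeplitz_block w\<close> gives both the finite matrices (for each \<open>n\<close>) and the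
  semi-infinite one.\<close>

definition toeplitz_block :: "(complex \<Rightarrow> 'q::finite cmat) \<Rightarrow> nat \<Rightarrow> nat \<Rightarrow> 'q cmat" where
  "toeplitz_block w s t = fourier_coeff w (int s - int t)"

definition block_mult ::
    "nat \<Rightarrow> (nat \<Rightarrow> nat \<Rightarrow> 'q::finite cmat) \<Rightarrow> (nat \<Rightarrow> nat \<Rightarrow> 'q cmat) \<Rightarrow> nat \<Rightarrow> nat \<Rightarrow> 'q cmat" where
  "block_mult n A B s t = (\<Sum>u=1..n. A s u ** B u t)"

text \<open>Analogous to \<^term>\<open>matrix_inv\<close>. For invertible \<open>A\<close> the blocks with indices in \<open>{1..n}\<close>
  are determined uniquely.\<close>

definition block_inv ::
    "nat \<Rightarrow> (nat \<Rightarrow> nat \<Rightarrow> 'q::finite cmat) \<Rightarrow> nat \<Rightarrow> nat \<Rightarrow> 'q cmat" where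
  "block_inv n A = (SOME B. \<forall>s\<in>{1..n}. \<forall>t\<in>{1..n}.
     block_mult n A B s t = (if s = t then mat 1 else 0) \<and>
     block_mult n B A s t = (if s = t then mat 1 else 0))"

definition h_sharp :: "real \<Rightarrow> (complex \<Rightarrow> 'q::finite cmat) \<Rightarrow> complex \<Rightarrow> 'q cmat" where
  "h_sharp d gs z = cscale ((1 - z) powr (- of_real d)) (gs z)"

definition h_tilde :: "real \<Rightarrow> (complex \<Rightarrow> 'q::finite cmat) \<Rightarrow> complex \<Rightarrow> 'q cmat" where
  "h_tilde d gs z = herm (h_sharp d gs (cnj z))"

definition a_tilde :: "real \<Rightarrow> (complex \<Rightarrow> 'q::finite cmat) \<Rightarrow> nat \<Rightarrow> 'q cmat" where
  "a_tilde d gs = (THE a. \<forall>z\<in>ball 0 1.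
     (\<lambda>k. cscale (z ^ k) (a k)) sums (- matrix_inv (h_tilde d gs z)))"

text \<open>The inverse of the semi-infinite block Toeplitz matrix of a weight with
  \<open>weight_factor d w g\<close> and \<open>sharp_factor g gs\<close>, given by its explicit formula.\<close>

definition toeplitz_inf_inv ::
    "real \<Rightarrow> (complex \<Rightarrow> 'q::finite cmat) \<Rightarrow> nat \<Rightarrow> nat \<Rightarrow> 'q cmat" where
  "toeplitz_inf_inv d gs s t =
     (\<Sum>l=1..min s t. herm (a_tilde d gs (s - l)) ** a_tilde d gs (t - l))"

definition C_sum ::
    "real \<Rightarrow> (complex \<Rightarrow> 'q::finite cmat) \<Rightarrow> (complex \<Rightarrow> 'q cmat) \<Rightarrow> nat \<Rightarrow> nat \<Rightarrow> real" where
  "C_sum d w gs t n =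
     (\<Sum>s=1..n. spectral_norm (block_inv n (toeplitz_block w) s t - toeplitz_inf_inv d gs s t))"

end

(* Write h = (1 - z)^(-d) gs with Taylor coefficients c_k, and let b_k be those of 1/h, so that the
   a_tilde are -b_k^*. Then T_n = C^* C + K, where C is the lower triangular Toeplitz matrix of c and
   K is the Gram matrix of the coordinates beyond n, and S = L L^* with L = C^(-1) is the n by n
   corner of the explicit inverse of T_infinity. The error E = S - T_n^(-1) satisfies
   S K S = E + E T_n E and 0 <= E, hence |E_st| <= y_s y_t with y_s^2 the diagonal entries of S K S.
   These are squared l^2 norms of  sum_(r<s) X_(i, n-s+r) b_r^*  in i >= 1, where
   X_ij = sum_(r<=j) c_(i+j-r) b_r. Summation by parts, together with c_k = O(k^(d-1)),
   b_k = O(k^(-d-1)) and the corresponding bounds for differences, gives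
   y_s = O(m^(-1/2) (s^(-d) + m^(-d))) with m = n + 1 - s, so that the y_s sum to O(n^(1/2-d)).
   This yields the two decay estimates. For t near n the uniform bound follows by applying the first
   estimate to the reversed matrix, which belongs to the weight w(cnj z). The constant does not
   depend on the factors because the explicit inverse is the entrywise limit of T_n^(-1). *)

theory Submission
  imports Defs "HOL-Complex_Analysis.Complex_Analysis" "HOL-Real_Asymp.Real_Asymp"
    "HOL-Library.Function_Algebras"
begin

section \<open>Power sums and coefficients of fractional powers\<close>

text \<open>The matrix step avoids any analysis of the finite inverse: 0 <= E <= S K S and
  Cauchy-Schwarz bound each entry of E by diagonal entries of S K S, which contain only explicit
  coefficients. For t near n this loses too much: the bound for y_t is then of order one while the
  y_s sum to n^(1/2-d). Hence the separate reversal argument there. The kernel X_ij has two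
  descriptions. The coefficients of h times its inverse vanish beyond index 0, so for i >= 1 the
  terms with r <= j of that Cauchy product are minus those with r > j. If i > j, the former are
  summed by parts: (1 - z)^d vanishes at 1, so the partial sums of b decay like k^(-d). If i <= j,
  the latter are small term by term. Both ways give i^d j^(-d) / max(i, j), up to a shift of j by
  one. The condition d < 1/2 enters as square summability of k^(d-1), and d > 0 as absolute
  summability of b. That T is the Gram matrix of the columns of C is Parseval for functions singular
  at 1, whose coefficients k^(d-1) need not be absolutely summable; it is reached from circles of
  radius r < 1.\<close>

lemma powr_pred_le_diff:
  fixes p x :: real
  assumes "p \<le> 1" "p \<noteq> 0" "0 < x"
  shows "(x + 1) powr (p - 1) \<le> (x + 1) powr p / p - x powr p / p"
proof -
  have "((\<lambda>y. y powr p / p) has_real_derivative y powr (p - 1)) (at y)" if "0 < y" for y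
    using that assms by (auto intro!: derivative_eq_intros simp: field_simps)
  then obtain z where z: "x < z" "z < x + 1"
    "(x + 1) powr p / p - x powr p / p = (x + 1 - x) * z powr (p - 1)"
    using MVT2[of x "x + 1" "\<lambda>y. y powr p / p" "\<lambda>y. y powr (p - 1)"] assms(3) by force
  have "(x + 1) powr (p - 1) \<le> z powr (p - 1)"
    using z assms by (intro powr_mono2') auto
  with z show ?thesis by simp
qed

text \<open>Comparison of the sum with an integral; \<open>powr_pred_le_diff\<close> is one step of
  it, and the steps telescope. Any nonzero p up to 1 is allowed, so that growing sums (p > 0) and
  tails (p < 0) both follow.\<close>

lemma sum_powr_diff_le:
  fixes p :: real
  assumes "p \<le> 1" "p \<noteq> 0" "1 \<le> m" "m \<le> n"
  shows "(\<Sum>k=Suc m..n. real k powr (p - 1)) \<le> real n powr p / p - real m powr p / p"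
  using assms(4)
proof (induction n rule: dec_induct)
  case (step n)
  have "(\<Sum>k=Suc m..Suc n. real k powr (p - 1))
      = (\<Sum>k=Suc m..n. real k powr (p - 1)) + (real n + 1) powr (p - 1)"
    using step by (simp add: add.commute)
  then show ?case
    using step.IH powr_pred_le_diff[OF assms(1,2), of "real n"] step assms(3)
    by (simp add: add.commute)
qed simp

lemma sum_powr_le:
  fixes p :: real
  assumes "0 < p" "p \<le> 1"
  shows "(\<Sum>k=1..n. real k powr (p - 1)) \<le> real n powr p / p"
proof (cases "n = 0")
  case False
  then have "(\<Sum>k=1..n. real k powr (p - 1)) = 1 + (\<Sum>k=Suc 1..n. real k powr (p - 1))"
    using sum.atLeast_Suc_atMost[of 1 n "\<lambda>k. real k powr (p - 1)"] by simp
  also have "\<dots> \<le> 1 + (real n powr p / p - 1 / p)"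
    using sum_powr_diff_le[of p 1 n] assms False by simp
  also have "\<dots> \<le> real n powr p / p"
    using assms by (simp add: field_simps)
  finally show ?thesis .
qed simp

lemma sum_powr_tail_le:
  fixes p :: real
  assumes "0 < p" "1 \<le> m"
  shows "(\<Sum>k=Suc m..n. real k powr (- p - 1)) \<le> real m powr (- p) / p"
proof (cases "m \<le> n")
  case True
  have "(\<Sum>k=Suc m..n. real k powr (- p - 1)) \<le> real n powr (- p) / (- p) - real m powr (- p) / (- p)"
    using sum_powr_diff_le[of "- p" m n] assms True by simp
  also have "\<dots> \<le> real m powr (- p) / p" using assms by (simp add: field_simps)
  finally show ?thesis .
qed (use assms in simp)

lemma summable_powr_mult_power:
  fixes q r :: real
  assumes "0 < r" "r < 1"
  shows "summable (\<lambda>k. (real k + 1) powr q * r ^ k)"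
proof -
  have "(\<lambda>k. (real k + 1) powr q * r ^ k) \<in> O(\<lambda>k. ((1 + r) / 2) ^ k)"
    using assms by real_asymp
  moreover have "summable (\<lambda>k. norm (((1 + r) / 2) ^ k))"
  proof -
    have "norm (((1 + r) / 2) ^ k) = ((1 + r) / 2) ^ k" for k using assms by simp
    moreover have "summable (\<lambda>k. ((1 + r) / 2) ^ k)" using assms by (simp add: summable_geometric)
    ultimately show ?thesis by (simp only:)
  qed
  ultimately show ?thesis by (rule summable_comparison_test_bigo[rotated])
qed

text \<open>The formal power series of (1 - z)^\<alpha>. Exponents add under multiplication, so
  differences of coefficients correspond to raising the exponent by one and partial sums to lowering
  it by one.\<close>

definition binom_fps :: "real \<Rightarrow> complex fps" where
  "binom_fps \<alpha> = Abs_fps (\<lambda>n. (-1) ^ n * (of_real \<alpha> gchoose n))"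

lemma binom_fps_add: "binom_fps (\<alpha> + \<beta>) = binom_fps \<alpha> * binom_fps \<beta>"
proof (rule fps_ext)
  fix n
  have "fps_nth (binom_fps \<alpha> * binom_fps \<beta>) n
      = (\<Sum>i=0..n. (-1) ^ n * ((of_real \<alpha> gchoose i) * (of_real \<beta> gchoose (n - i))))"
    unfolding fps_mult_nth binom_fps_def fps_nth_Abs_fps
  proof (rule sum.cong)
    fix i assume "i \<in> {0..n}"
    then have "(-1::complex) ^ i * (-1) ^ (n - i) = (-1) ^ n" by (simp flip: power_add)
    then show "(-1) ^ i * (complex_of_real \<alpha> gchoose i) * ((-1) ^ (n - i) * (complex_of_real \<beta> gchoose (n - i)))
       = (-1) ^ n * ((complex_of_real \<alpha> gchoose i) * (complex_of_real \<beta> gchoose (n - i)))"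
      by (metis (no_types, lifting) mult.assoc mult.left_commute)
  qed simp
  also have "\<dots> = (-1) ^ n * (\<Sum>i=0..n. (complex_of_real \<alpha> gchoose i) * (of_real \<beta> gchoose (n - i)))"
    by (simp add: sum_distrib_left)
  also have "\<dots> = fps_nth (binom_fps (\<alpha> + \<beta>)) n"
    using gbinomial_Vandermonde[of "complex_of_real \<alpha>" "complex_of_real \<beta>" n] by (simp add: atLeast0AtMost binom_fps_def)
  finally show "fps_nth (binom_fps (\<alpha> + \<beta>)) n = fps_nth (binom_fps \<alpha> * binom_fps \<beta>) n" by simp
qed

lemma binom_fps_0 [simp]: "binom_fps 0 = 1"
  by (rule fps_ext) (auto simp: binom_fps_def gbinomial_0_left)

lemma binom_fps_1: "binom_fps 1 = 1 - fps_X"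
proof (rule fps_ext)
  fix n show "fps_nth (binom_fps 1) n = fps_nth (1 - fps_X) n"
    using binomial_gbinomial[of 1 n, where 'a=complex, symmetric]
    by (cases n; cases "n - 1") (auto simp: binom_fps_def)
qed

lemma norm_binom_fps_nth_le:
  "\<exists>K. \<forall>n. norm (fps_nth (binom_fps \<alpha>) n) \<le> K * (real n + 1) powr (- \<alpha> - 1)"
proof -
  have "convergent (\<lambda>n. (\<alpha> gchoose n) / ((-1)^n / exp ((\<alpha>+1) * of_real (ln (real n)))))"
    using gbinomial_asymptotic[of \<alpha>] by (auto simp: convergent_def)
  then have "Bseq (\<lambda>n. (\<alpha> gchoose n) / ((-1)^n / exp ((\<alpha>+1) * of_real (ln (real n)))))"
    by (rule convergent_imp_Bseq)
  then obtain K where K: "K > 0"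
    "\<And>n. norm ((\<alpha> gchoose n) / ((-1)^n / exp ((\<alpha>+1) * of_real (ln (real n))))) \<le> K"
    by (auto simp: Bseq_def)
  \<comment> \<open>The power of 2 pays for replacing n by n + 1 when n >= 1; the maximum with 1
    covers n = 0, where the coefficient is 1.\<close>
  have le: "norm (fps_nth (binom_fps \<alpha>) n) \<le> max 1 (K * 2 powr \<bar>\<alpha> + 1\<bar>) * (real n + 1) powr (- \<alpha> - 1)" for n
  proof (cases "n = 0")
    case False
    have "complex_of_real \<alpha> gchoose n = of_real (\<alpha> gchoose n)"
      by (simp add: gbinomial_prod_rev)
    then have "norm (fps_nth (binom_fps \<alpha>) n) = \<bar>\<alpha> gchoose n\<bar>"
      by (simp add: binom_fps_def norm_mult norm_power)
    also have "\<dots> = norm ((\<alpha> gchoose n) / ((-1)^n / exp ((\<alpha>+1) * of_real (ln (real n))))) * real n powr (-\<alpha> - 1)"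
      using False by (simp add: abs_mult norm_mult norm_divide norm_power powr_def exp_minus exp_diff field_simps exp_add)
    also have "\<dots> \<le> K * real n powr (- \<alpha> - 1)"
      by (intro mult_right_mono K) auto
    also have "real n powr (- \<alpha> - 1) \<le> 2 powr \<bar>\<alpha> + 1\<bar> * (real n + 1) powr (- \<alpha> - 1)"
    proof (cases "\<alpha> + 1 \<ge> 0")
      case True
      have "(real n + 1) powr (\<alpha> + 1) \<le> (2 * real n) powr (\<alpha> + 1)"
        using False True by (intro powr_mono2) auto
      then have *: "(real n + 1) powr (\<alpha> + 1) \<le> 2 powr (\<alpha> + 1) * real n powr (\<alpha> + 1)"
        using False by (simp add: powr_mult)
      have "- \<alpha> - 1 = - (\<alpha> + 1)" by simp
      then have e: "y powr (-\<alpha> - 1) = inverse (y powr (\<alpha> + 1))" for y :: real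
        by (metis powr_minus)
      show ?thesis using * True False unfolding e by (simp add: field_simps)
    next
      case F: False
      have "real n powr (- \<alpha> - 1) \<le> 1 * (real n + 1) powr (- \<alpha> - 1)"
        using F False by (simp, intro powr_mono2) auto
      also have "\<dots> \<le> 2 powr \<bar>\<alpha> + 1\<bar> * (real n + 1) powr (- \<alpha> - 1)"
        by (intro mult_right_mono ge_one_powr_ge_zero) auto
      finally show ?thesis .
    qed
    finally have "norm (fps_nth (binom_fps \<alpha>) n) \<le> K * 2 powr \<bar>\<alpha> + 1\<bar> * (real n + 1) powr (- \<alpha> - 1)"
      using K(1) by (simp add: mult_left_mono mult.assoc)
    also have "\<dots> \<le> max 1 (K * 2 powr \<bar>\<alpha> + 1\<bar>) * (real n + 1) powr (- \<alpha> - 1)"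
      by (intro mult_right_mono) auto
    finally show ?thesis .
  qed (simp add: binom_fps_def)
  then show ?thesis by blast
qed

text \<open>A convergence radius above 1 forces geometric decay of the coefficients, which beats
  every power.\<close>

lemma summable_powr_mult_fps_nth:
  fixes A :: "complex fps"
  assumes "1 < fps_conv_radius A"
  shows "summable (\<lambda>k. (real k + 1) powr q * norm (fps_nth A k))"
proof -
  obtain R where R: "1 < ereal R" "ereal R < fps_conv_radius A"
    using ereal_dense2[OF assms] by auto
  obtain R' where R': "ereal R < ereal R'" "ereal R' < fps_conv_radius A"
    using ereal_dense2[OF R(2)] by auto
  have "summable (\<lambda>n. norm (fps_nth A n * of_real R ^ n))"
    using R by (intro norm_summable_fps) (auto simp: less_ereal.simps)
  then have "(\<lambda>n. norm (fps_nth A n * of_real R ^ n)) \<longlonglongrightarrow> 0"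
    by (rule summable_LIMSEQ_zero)
  then have "Bseq (\<lambda>n. norm (fps_nth A n * of_real R ^ n))"
    using convergent_imp_Bseq convergent_def by blast
  then obtain K where K: "K > 0" "\<And>n. norm (norm (fps_nth A n * of_real R ^ n)) \<le> K"
    by (auto simp: Bseq_def)
  have bd: "norm (fps_nth A n) \<le> K * (1/R) ^ n" for n
    using K(2)[of n] R(1) by (simp add: norm_mult norm_power field_simps)
  have "summable (\<lambda>k. K * ((real k + 1) powr q * (1/R) ^ k))"
    using R by (intro summable_mult summable_powr_mult_power) auto
  then show ?thesis
  proof (rule summable_comparison_test'[where N = 0])
    fix n
    show "norm ((real n + 1) powr q * norm (fps_nth A n)) \<le> K * ((real n + 1) powr q * (1 / R) ^ n)"
      using mult_left_mono[OF bd[of n], of "(real n + 1) powr q"] by (simp add: mult_ac)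
  qed
qed

text \<open>Since k + 1 <= (i + 1) (k - i + 1), a power weight can be moved from i to k at the price
  of a power of the distance.\<close>

lemma powr_shift_le:
  fixes p :: real
  assumes "i \<le> k"
  shows "(real i + 1) powr p \<le> (real k + 1) powr p * (real (k - i) + 1) powr \<bar>p\<bar>"
proof (cases "p \<ge> 0")
  case True
  have "(real i + 1) powr p \<le> (real k + 1) powr p * 1"
    using True assms by (simp, intro powr_mono2) auto
  also have "\<dots> \<le> (real k + 1) powr p * (real (k - i) + 1) powr \<bar>p\<bar>"
    by (intro mult_left_mono ge_one_powr_ge_zero) auto
  finally show ?thesis .
next
  case False
  have "real k + 1 \<le> (real i + 1) * (real (k - i) + 1)"
  proof -
    have "0 \<le> real i * real (k - i)" by simp
    then show ?thesis using assms by (simp add: algebra_simps of_nat_diff)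
  qed
  then have "(real k + 1) powr (- p) \<le> (real i + 1) powr (- p) * (real (k - i) + 1) powr (- p)"
    using False by (subst powr_mult [symmetric]) (auto intro!: powr_mono2)
  then show ?thesis using False by (simp add: powr_minus field_simps)
qed

text \<open>An analytic factor does not change a power rate: in the convolution the weight is moved
  by \<open>powr_shift_le\<close>, and its price is absorbed by the weighted sum of the coefficients
  of A. Thus the fractional power alone sets the rate.\<close>

lemma norm_fps_mult_nth_le:
  fixes F A :: "complex fps"
  assumes F: "\<And>k. norm (fps_nth F k) \<le> K * (real k + 1) powr p"
    and A: "1 < fps_conv_radius A"
  shows "\<exists>K'. \<forall>k. norm (fps_nth (F * A) k) \<le> K' * (real k + 1) powr p"
proof -
  have K: "0 \<le> K" using order.trans[OF norm_ge_zero F[of 0]] by simp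
  define S where "S = (\<Sum>k. (real k + 1) powr \<bar>p\<bar> * norm (fps_nth A k))"
  have "norm (fps_nth (F * A) k) \<le> (K * S) * (real k + 1) powr p" for k
  proof -
    have "norm (fps_nth (F * A) k) \<le> (\<Sum>i=0..k. norm (fps_nth F i) * norm (fps_nth A (k - i)))"
      unfolding fps_mult_nth by (rule order.trans[OF norm_sum]) (simp add: norm_mult)
    also have "\<dots> \<le> (\<Sum>i=0..k. (K * (real k + 1) powr p) * ((real (k - i) + 1) powr \<bar>p\<bar> * norm (fps_nth A (k - i))))"
    proof (rule sum_mono)
      fix i assume i: "i \<in> {0..k}"
      have "norm (fps_nth F i) \<le> K * ((real k + 1) powr p * (real (k - i) + 1) powr \<bar>p\<bar>)"
        using order.trans[OF F[of i] mult_left_mono[OF powr_shift_le[of i k p] K]] i by simp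
      then show "norm (fps_nth F i) * norm (fps_nth A (k - i)) \<le> (K * (real k + 1) powr p) * ((real (k - i) + 1) powr \<bar>p\<bar> * norm (fps_nth A (k - i)))"
        by (metis mult.assoc mult_right_mono norm_ge_zero)
    qed
    also have "\<dots> = (K * (real k + 1) powr p) * (\<Sum>i=0..k. (real (k - i) + 1) powr \<bar>p\<bar> * norm (fps_nth A (k - i)))"
      by (simp add: sum_distrib_left)
    also have "(\<Sum>i=0..k. (real (k - i) + 1) powr \<bar>p\<bar> * norm (fps_nth A (k - i))) = (\<Sum>i=0..k. (real i + 1) powr \<bar>p\<bar> * norm (fps_nth A i))"
      by (rule sum.reindex_bij_witness[of _ "\<lambda>i. k - i" "\<lambda>i. k - i"]) auto
    also have "(K * (real k + 1) powr p) * \<dots> \<le> (K * (real k + 1) powr p) * S"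
      unfolding S_def using K
      by (intro mult_left_mono sum_le_suminf summable_powr_mult_fps_nth A) auto
    finally show ?thesis by (simp add: mult_ac)
  qed
  then show ?thesis by blast
qed

lemma norm_binom_fps_mult_nth_le:
  assumes "1 < fps_conv_radius A"
  shows "\<exists>K. \<forall>k. norm (fps_nth (binom_fps \<alpha> * A) k) \<le> K * (real k + 1) powr (- \<alpha> - 1)"
  using norm_binom_fps_nth_le[of \<alpha>] norm_fps_mult_nth_le[OF _ assms] by blast

section \<open>Positive semidefinite matrices over a finite index set\<close>

definition mm :: "'a set \<Rightarrow> ('a \<Rightarrow> 'a \<Rightarrow> complex) \<Rightarrow> ('a \<Rightarrow> 'a \<Rightarrow> complex) \<Rightarrow> 'a \<Rightarrow> 'a \<Rightarrow> complex" where
  "mm I A B = (\<lambda>a b. \<Sum>c\<in>I. A a c * B c b)"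

definition idm :: "'a set \<Rightarrow> 'a \<Rightarrow> 'a \<Rightarrow> complex" where
  "idm I = (\<lambda>a b. if a \<in> I \<and> a = b then 1 else 0)"

definition adj :: "('a \<Rightarrow> 'a \<Rightarrow> complex) \<Rightarrow> 'a \<Rightarrow> 'a \<Rightarrow> complex" where
  "adj A = (\<lambda>a b. cnj (A b a))"

text \<open>For matrices that vanish outside I, \<open>idm\<close> is a true unit, and matrix
  identities are equations between functions that can be used for rewriting.\<close>

definition supp_mat :: "'a set \<Rightarrow> ('a \<Rightarrow> 'a \<Rightarrow> complex) \<Rightarrow> bool" where
  "supp_mat I A \<longleftrightarrow> (\<forall>a b. A a b \<noteq> 0 \<longrightarrow> a \<in> I \<and> b \<in> I)"

definition qform :: "'a set \<Rightarrow> ('a \<Rightarrow> 'a \<Rightarrow> complex) \<Rightarrow> ('a \<Rightarrow> complex) \<Rightarrow> complex" where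
  "qform I A v = (\<Sum>a\<in>I. \<Sum>b\<in>I. cnj (v a) * A a b * v b)"

definition psd :: "'a set \<Rightarrow> ('a \<Rightarrow> 'a \<Rightarrow> complex) \<Rightarrow> bool" where
  "psd I A \<longleftrightarrow> adj A = A \<and> (\<forall>v. 0 \<le> Re (qform I A v))"

lemma mm_assoc: "mm I (mm I A B) C = mm I A (mm I B C)"
proof (intro ext)
  fix a b
  have "mm I (mm I A B) C a b = (\<Sum>c\<in>I. \<Sum>e\<in>I. A a e * B e c * C c b)"
    by (simp add: mm_def sum_distrib_right)
  also have "\<dots> = (\<Sum>e\<in>I. \<Sum>c\<in>I. A a e * B e c * C c b)" by (rule sum.swap)
  also have "\<dots> = mm I A (mm I B C) a b"
    by (simp add: mm_def sum_distrib_left mult.assoc)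
  finally show "mm I (mm I A B) C a b = mm I A (mm I B C) a b" .
qed

lemma mm_add_left: "mm I (A + B) C = mm I A C + mm I B C"
  and mm_add_right: "mm I C (A + B) = mm I C A + mm I C B"
  by (auto simp: mm_def fun_eq_iff sum.distrib distrib_right distrib_left)

lemma adj_mm: "adj (mm I A B) = mm I (adj B) (adj A)"
  by (auto simp: mm_def adj_def fun_eq_iff mult.commute)

lemma adj_adj [simp]: "adj (adj A) = A"
  by (simp add: adj_def)

lemma adj_add: "adj (A + B) = adj A + adj B"
  by (auto simp: adj_def fun_eq_iff)

lemma adj_idm [simp]: "adj (idm I) = idm I"
  by (auto simp: adj_def idm_def fun_eq_iff)

lemma mm_idm_left:
  assumes "finite I" "supp_mat I A" shows "mm I (idm I) A = A"
proof (intro ext)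
  fix a b
  have "mm I (idm I) A a b = (\<Sum>c\<in>I. if a = c then A a b else 0)"
    unfolding mm_def idm_def by (intro sum.cong) auto
  also have "\<dots> = A a b" using assms by (auto simp: supp_mat_def)
  finally show "mm I (idm I) A a b = A a b" .
qed

lemma supp_mat_adj: "supp_mat I A \<Longrightarrow> supp_mat I (adj A)"
  by (auto simp: supp_mat_def adj_def)

lemma supp_mat_mm:
  assumes "supp_mat I A" "supp_mat I B" shows "supp_mat I (mm I A B)"
proof -
  have "mm I A B a b = 0" if "a \<notin> I \<or> b \<notin> I" for a b
  proof -
    have "A a c * B c b = 0" for c
      using that assms unfolding supp_mat_def mult_eq_0_iff by blast
    then show ?thesis unfolding mm_def by (intro sum.neutral) blast
  qed
  then show ?thesis unfolding supp_mat_def by blast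
qed

lemma mm_idm_right:
  assumes "finite I" "supp_mat I A" shows "mm I A (idm I) = A"
  using mm_idm_left[OF assms(1) supp_mat_adj[OF assms(2)]]
  by (metis adj_adj adj_idm adj_mm)

lemma qform_add: "qform I (A + B) v = qform I A v + qform I B v"
  by (simp add: qform_def sum.distrib algebra_simps)

lemma qform_congruence:
  "qform I (mm I (adj V) (mm I A V)) v = qform I A (\<lambda>a. \<Sum>b\<in>I. V a b * v b)"
proof -
  let ?t = "\<lambda>a b c e. cnj (v a) * cnj (V c a) * A c e * V e b * v b"
  have "qform I (mm I (adj V) (mm I A V)) v = (\<Sum>a\<in>I. \<Sum>b\<in>I. \<Sum>c\<in>I. \<Sum>e\<in>I. ?t a b c e)"
    by (simp add: qform_def mm_def adj_def sum_distrib_left sum_distrib_right mult.assoc)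
  also have "\<dots> = (\<Sum>a\<in>I. \<Sum>c\<in>I. \<Sum>b\<in>I. \<Sum>e\<in>I. ?t a b c e)"
    by (intro sum.cong refl sum.swap)
  also have "\<dots> = (\<Sum>c\<in>I. \<Sum>a\<in>I. \<Sum>b\<in>I. \<Sum>e\<in>I. ?t a b c e)"
    by (rule sum.swap)
  also have "\<dots> = (\<Sum>c\<in>I. \<Sum>a\<in>I. \<Sum>e\<in>I. \<Sum>b\<in>I. ?t a b c e)"
    by (intro sum.cong refl sum.swap)
  also have "\<dots> = (\<Sum>c\<in>I. \<Sum>e\<in>I. \<Sum>a\<in>I. \<Sum>b\<in>I. ?t a b c e)"
    by (intro sum.cong refl sum.swap)
  also have "\<dots> = qform I A (\<lambda>a. \<Sum>b\<in>I. V a b * v b)"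
    by (simp add: qform_def sum_distrib_left sum_distrib_right mult_ac)
  finally show ?thesis .
qed

lemma psd_congruence: "psd I A \<Longrightarrow> psd I (mm I (adj V) (mm I A V))"
  by (simp add: psd_def qform_congruence adj_mm mm_assoc)

lemma psd_add: "psd I A \<Longrightarrow> psd I B \<Longrightarrow> psd I (A + B)"
  by (simp add: psd_def adj_add qform_add)

lemma qform_idm:
  assumes "finite I" shows "qform I (idm I) v = (\<Sum>a\<in>I. of_real ((norm (v a))\<^sup>2))"
proof -
  have "qform I (idm I) v = (\<Sum>a\<in>I. \<Sum>b\<in>I. if a = b then cnj (v a) * v a else 0)"
    unfolding qform_def idm_def by (intro sum.cong) auto
  also have "\<dots> = (\<Sum>a\<in>I. of_real ((norm (v a))\<^sup>2))"
    using assms by (intro sum.cong) (auto simp: complex_norm_square mult.commute simp del: of_real_power)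
  finally show ?thesis .
qed

lemma psd_idm: "finite I \<Longrightarrow> psd I (idm I)"
  by (simp add: psd_def qform_idm sum_nonneg)

lemma qform_two_points:
  assumes "finite I" "a \<in> I" "b \<in> I" "a \<noteq> b"
  shows "qform I A (\<lambda>c. if c = a then x else if c = b then y else 0)
    = cnj x * A a a * x + cnj x * A a b * y + cnj y * A b a * x + cnj y * A b b * y"
proof -
  let ?v = "\<lambda>c. if c = a then x else if c = b then y else 0"
  have "(\<Sum>e\<in>I. cnj (?v c) * A c e * ?v e) = cnj (?v c) * A c a * x + cnj (?v c) * A c b * y" for c
  proof -
    have "(\<Sum>e\<in>I. cnj (?v c) * A c e * ?v e) = (\<Sum>e\<in>{a,b}. cnj (?v c) * A c e * ?v e)"
      using assms by (intro sum.mono_neutral_right) auto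
    then show ?thesis using assms(4) by (simp add: add.commute)
  qed
  then have "qform I A ?v = (\<Sum>c\<in>I. cnj (?v c) * A c a * x + cnj (?v c) * A c b * y)"
    by (simp add: qform_def)
  also have "\<dots> = (\<Sum>c\<in>{a,b}. cnj (?v c) * A c a * x + cnj (?v c) * A c b * y)"
    using assms by (intro sum.mono_neutral_right) auto
  finally show ?thesis using assms(4) by (simp add: algebra_simps)
qed

lemma psd_diag_nonneg:
  assumes "finite I" "psd I A" "a \<in> I" shows "0 \<le> Re (A a a)"
proof -
  have "qform I A (\<lambda>c. if c = a then 1 else 0) = (\<Sum>c\<in>I. if c = a then (\<Sum>e\<in>I. if e = a then A a a else 0) else 0)"
    unfolding qform_def by (intro sum.cong refl) (auto intro!: sum.cong)
  also have "\<dots> = A a a" using assms by simp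
  finally show ?thesis using assms(2) unfolding psd_def by (auto dest: spec[of _ "\<lambda>c. if c = a then 1 else 0"])
qed

lemma psd_cnj:
  assumes "psd I A" shows "A e f = cnj (A f e)"
proof -
  have "adj A = A" using assms by (simp add: psd_def)
  then have "adj A e f = A e f" by simp
  then show ?thesis by (simp add: adj_def)
qed

lemma psd_Im_diag: "psd I A \<Longrightarrow> Im (A e e) = 0"
  using arg_cong[OF psd_cnj[of I A e e], of Im] by simp

text \<open>Cauchy-Schwarz, read off from the form on vectors supported at a and b.\<close>

lemma psd_entry_le:
  assumes I: "finite I" and A: "psd I A" and ab: "a \<in> I" "b \<in> I"
  shows "(norm (A a b))\<^sup>2 \<le> Re (A a a) * Re (A b b)"
proof (cases "a = b")
  case True
  have "Im (A a a) = 0" using A by (rule psd_Im_diag)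
  then show ?thesis using True cmod_power2[of "A a a"] by (simp add: power2_eq_square)
next
  case False
  define z p r where "z = A a b" and "p = Re (A a a)" and "r = Re (A b b)"
  have diag: "A a a = of_real p" "A b b = of_real r"
    using psd_Im_diag[OF A] by (simp_all add: p_def r_def complex_eq_iff)
  have q: "0 \<le> Re (cnj x * of_real p * x + cnj x * z * y + cnj y * cnj z * x + cnj y * of_real r * y)" for x y
  proof -
    have "0 \<le> Re (qform I A (\<lambda>c. if c = a then x else if c = b then y else 0))"
      using A by (simp add: psd_def)
    then show ?thesis
      unfolding qform_two_points[OF I ab False] diag psd_cnj[OF A, of b a] z_def .
  qed
  have nz: "(norm z)\<^sup>2 = Re z * Re z + Im z * Im z"
    using cmod_power2[of z] by (simp only: power2_eq_square)
  \<comment> \<open>The first two test vectors give the claim multiplied by r and by p. The third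
    settles p = r = 0, where it says that -2 |z|^2 is nonnegative.\<close>
  have 1: "0 \<le> r * (p * r - (norm z)\<^sup>2)"
    using q[of "of_real r" "- cnj z"] by (simp add: nz algebra_simps)
  have 2: "0 \<le> p * (p * r - (norm z)\<^sup>2)"
    using q[of "- z" "of_real p"] by (simp add: nz algebra_simps)
  have 3: "0 \<le> p + r * (norm z)\<^sup>2 - 2 * (norm z)\<^sup>2"
    using q[of 1 "- cnj z"] by (simp add: nz algebra_simps)
  have "0 \<le> p" "0 \<le> r"
    using psd_diag_nonneg[OF I A] ab by (simp_all add: p_def r_def)
  then have "(norm z)\<^sup>2 \<le> p * r"
    using 1 2 3 by (cases "r = 0"; cases "p = 0") (auto simp: zero_le_mult_iff mult_le_0_iff)
  then show ?thesis by (simp add: z_def p_def r_def)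
qed

text \<open>With \<open>E = S - B\<close> the hypotheses give \<open>E = S K B = B K S\<close>, hence
  \<open>E = B K B + B K S K B\<close> and \<open>S K S = E + E T E\<close>, so that \<open>0 \<le> E \<le> S K S\<close> as forms.\<close>

lemma psd_inverse_diff_entry_le:
  assumes I: "finite I"
    and supp: "supp_mat I T" "supp_mat I B" "supp_mat I C" "supp_mat I L" "supp_mat I K"
    and TB: "mm I T B = idm I" and BT: "mm I B T = idm I"
    and CL: "mm I C L = idm I" and LC: "mm I L C = idm I"
    and S: "S = mm I L (adj L)" and T: "T = mm I (adj C) C + K" and K: "psd I K"
    and ab: "a \<in> I" "b \<in> I"
  shows "(norm (S a b - B a b))\<^sup>2 \<le> Re (mm I (mm I S K) S a a) * Re (mm I (mm I S K) S b b)"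
proof -
  note idl = mm_idm_left[OF I] and idr = mm_idm_right[OF I]
  have Kh: "adj K = K" using K by (simp add: psd_def)
  have Sh: "adj S = S" unfolding S by (simp add: adj_mm)
  have Th: "adj T = T" unfolding T by (simp add: adj_mm adj_add Kh)
  have suppS: "supp_mat I S"
    unfolding S by (intro supp_mat_mm supp_mat_adj supp)
  have "mm I S (mm I (adj C) C) = mm I L (mm I (adj (mm I C L)) C)"
    by (simp add: S adj_mm mm_assoc)
  also have "\<dots> = idm I" using LC CL supp by (simp add: idl)
  finally have ST: "mm I S T = idm I + mm I S K"
    by (simp add: T mm_add_right)
  have TS: "mm I T S = idm I + mm I K S"
    using arg_cong[OF ST, of adj] by (simp only: adj_mm adj_add adj_idm Kh Sh Th)
  have Bh: "adj B = B"
  proof -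
    have "mm I (adj B) T = idm I" using arg_cong[OF TB, of adj] by (simp add: adj_mm Th)
    then have "mm I (adj B) (mm I T B) = B" using supp(2) by (simp add: idl flip: mm_assoc)
    then show ?thesis using TB supp_mat_adj[OF supp(2)] by (simp add: idr)
  qed
  define E where "E = mm I (mm I S K) B"
  have SE: "S = B + E"
  proof -
    have "S = mm I S (mm I T B)" using TB suppS by (simp add: idr)
    also have "\<dots> = mm I (idm I + mm I S K) B" by (simp only: mm_assoc[symmetric] ST)
    finally show ?thesis using supp by (simp add: mm_add_left idl E_def)
  qed
  have Eh: "adj E = E"
  proof -
    have "S = B + adj E" using arg_cong[OF SE, of adj] by (simp only: Sh Bh adj_add)
    then have "B + adj E = B + E" by (rule trans[OF sym SE])
    then show ?thesis by simp
  qed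
  have E2: "E = mm I B (mm I K S)"
    using arg_cong[OF E_def, of adj] by (simp add: adj_mm Bh Kh Sh Eh)
  \<comment> \<open>S is replaced by B + E in E = S K B, and the new E by B K S. Both summands are
    then congruences, of K by B and of S by K B, hence semidefinite.\<close>
  have "E = mm I (mm I (B + E) K) B"
    unfolding SE[symmetric] by (rule E_def)
  also have "\<dots> = mm I (mm I B K) B + mm I (mm I E K) B"
    by (simp only: mm_add_left)
  also have "mm I (mm I B K) B = mm I (adj B) (mm I K B)"
    by (simp add: Bh mm_assoc)
  also have "mm I (mm I E K) B = mm I (adj (mm I K B)) (mm I S (mm I K B))"
    by (subst E2) (simp add: adj_mm Bh Kh mm_assoc)
  finally have E3: "E = mm I (adj B) (mm I K B) + mm I (adj (mm I K B)) (mm I S (mm I K B))" .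
  have "psd I S"
    using psd_congruence[OF psd_idm[OF I], of "adj L"] supp_mat_adj[OF supp(4)] by (simp add: S idl)
  then have psdE: "psd I E"
    by (subst E3) (intro psd_add psd_congruence K)
  have "psd I T"
    using psd_add[OF psd_congruence[OF psd_idm[OF I], of C] K] supp(3) by (simp add: T idl)
  then have psdD: "psd I (mm I (adj E) (mm I T E))" by (rule psd_congruence)
  have suppE: "supp_mat I E"
    unfolding E_def by (intro supp_mat_mm suppS supp)
  \<comment> \<open>From S K E = S K B K S = E K S follows S K S = E (1 + K S) = E T S, and T S = 1
    + T E turns this into E + E T E.\<close>
  have "mm I (mm I S K) E = mm I (mm I S K) (mm I B (mm I K S))"
    by (simp only: E2[symmetric])
  also have "\<dots> = mm I E (mm I K S)" by (simp only: mm_assoc[symmetric] E_def)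
  finally have "mm I (mm I S K) (B + E) = E + mm I E (mm I K S)"
    by (simp only: mm_add_right E_def[symmetric])
  then have "mm I (mm I S K) S = E + mm I E (mm I K S)"
    by (simp only: SE[symmetric])
  also have "\<dots> = mm I E (idm I + mm I K S)" using suppE by (simp add: mm_add_right idr)
  also have "\<dots> = mm I E (mm I T (B + E))" by (simp only: SE[symmetric] TS)
  also have "\<dots> = E + mm I (adj E) (mm I T E)"
    using suppE by (simp add: mm_add_right TB idr Eh)
  finally have G: "mm I (mm I S K) S = E + mm I (adj E) (mm I T E)" .
  have le: "Re (E e e) \<le> Re (mm I (mm I S K) S e e)" if "e \<in> I" for e
    unfolding G using psd_diag_nonneg[OF I psdD that] by simp
  have "(norm (E a b))\<^sup>2 \<le> Re (E a a) * Re (E b b)"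
    by (rule psd_entry_le[OF I psdE ab])
  also have "\<dots> \<le> Re (mm I (mm I S K) S a a) * Re (mm I (mm I S K) S b b)"
    using le ab psd_diag_nonneg[OF I psdE] by (intro mult_mono) (auto intro: order.trans)
  also have "E a b = S a b - B a b" using SE by simp
  finally show ?thesis .
qed

text \<open>Gaussian elimination, one index at a time. The nonvanishing of the form passes to
  principal submatrices and keeps every pivot nonzero.\<close>

lemma pos_def_solvable:
  assumes "finite I" "\<And>v. \<exists>a\<in>I. v a \<noteq> 0 \<Longrightarrow> qform I A v \<noteq> 0"
  shows "\<exists>x. \<forall>a\<in>I. (\<Sum>b\<in>I. A a b * x b) = y a"
  using assms
proof (induction I arbitrary: y rule: finite_induct)
  case (insert e J)
  have sumJ: "(\<Sum>b\<in>insert e J. A a b * (if b = e then t else v b)) = A a e * t + (\<Sum>b\<in>J. A a b * v b)" for a t v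
  proof -
    have "(\<Sum>b\<in>J. A a b * (if b = e then t else v b)) = (\<Sum>b\<in>J. A a b * v b)"
      using insert(2) by (intro sum.cong) auto
    then show ?thesis using insert(1,2) by simp
  qed
  have q: "qform (insert e J) A v = (\<Sum>a\<in>insert e J. cnj (v a) * (\<Sum>b\<in>insert e J. A a b * v b))" for v
    unfolding qform_def by (simp only: sum_distrib_left mult.assoc)
  have pd: "qform J A v \<noteq> 0" if "\<exists>a\<in>J. v a \<noteq> 0" for v
  proof -
    let ?v = "\<lambda>b. if b = e then 0 else v b"
    have "qform (insert e J) A ?v = cnj (?v e) * (\<Sum>b\<in>insert e J. A e b * ?v b) + (\<Sum>a\<in>J. cnj (?v a) * (\<Sum>b\<in>insert e J. A a b * ?v b))"
      unfolding q using insert(1,2) by simp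
    also have "\<dots> = (\<Sum>a\<in>J. cnj (v a) * (\<Sum>b\<in>J. A a b * v b))"
      unfolding sumJ using insert(2) by (auto intro!: sum.cong)
    also have "\<dots> = qform J A v" by (simp add: qform_def sum_distrib_left mult.assoc)
    finally have "qform (insert e J) A ?v = qform J A v" .
    moreover have "\<exists>a\<in>insert e J. ?v a \<noteq> 0" using that insert(2) by force
    ultimately show ?thesis using insert(4)[of ?v] by simp
  qed
  have IH: "\<exists>x. \<forall>a\<in>J. (\<Sum>b\<in>J. A a b * x b) = y a" for y
    by (rule insert.IH) (rule pd)
  obtain z where z: "\<forall>a\<in>J. (\<Sum>b\<in>J. A a b * z b) = - A a e"
    using IH[of "\<lambda>a. - A a e"] by blast
  obtain u where u: "\<forall>a\<in>J. (\<Sum>b\<in>J. A a b * u b) = y a"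
    using IH by blast
  \<comment> \<open>The Schur complement of the block J. It is the value of the form at z extended
    by 1 at e, because the rows in J annihilate that vector.\<close>
  define s where "s = A e e + (\<Sum>b\<in>J. A e b * z b)"
  have s0: "s \<noteq> 0"
  proof -
    let ?v = "\<lambda>b. if b = e then 1 else z b"
    have "qform (insert e J) A ?v = cnj (?v e) * (\<Sum>b\<in>insert e J. A e b * ?v b) + (\<Sum>a\<in>J. cnj (?v a) * (\<Sum>b\<in>insert e J. A a b * ?v b))"
      unfolding q using insert(1,2) by simp
    also have "\<dots> = s"
      unfolding sumJ s_def using z by simp
    finally show ?thesis using insert(4)[of ?v] by auto
  qed
  define t where "t = (y e - (\<Sum>b\<in>J. A e b * u b)) / s"
  have split: "(\<Sum>b\<in>J. A a b * (u b + t * z b)) = (\<Sum>b\<in>J. A a b * u b) + t * (\<Sum>b\<in>J. A a b * z b)" for a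
    by (simp add: sum.distrib sum_distrib_left algebra_simps)
  have "A e e * t + (\<Sum>b\<in>J. A e b * (u b + t * z b)) = (\<Sum>b\<in>J. A e b * u b) + t * s"
    unfolding split s_def by (simp add: algebra_simps)
  also have "\<dots> = y e" using s0 by (simp add: t_def)
  finally have "\<forall>a\<in>insert e J. (\<Sum>b\<in>insert e J. A a b * (if b = e then t else u b + t * z b)) = y a"
    unfolding sumJ split using z u by simp
  then show ?case by (intro exI[of _ "\<lambda>b. if b = e then t else u b + t * z b"])
qed simp

text \<open>Solving for the columns of the identity gives a right inverse. As A is Hermitian, its
  adjoint is a left inverse, and the two coincide.\<close>

lemma pos_def_inverse_exists:
  assumes I: "finite I" and A: "supp_mat I A" "adj A = A"
    and pd: "\<And>v. \<exists>a\<in>I. v a \<noteq> 0 \<Longrightarrow> qform I A v \<noteq> 0"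
  shows "\<exists>B. supp_mat I B \<and> mm I A B = idm I \<and> mm I B A = idm I"
proof -
  have "\<exists>x. \<forall>a\<in>I. (\<Sum>b\<in>I. A a b * x b) = idm I a c" for c
    by (rule pos_def_solvable[OF I pd])
  then obtain x where x: "\<And>c. \<forall>a\<in>I. (\<Sum>b\<in>I. A a b * x c b) = idm I a c"
    by metis
  define B where "B a c = (if a \<in> I \<and> c \<in> I then x c a else 0)" for a c
  have supp: "supp_mat I B" by (simp add: supp_mat_def B_def)
  have AB: "mm I A B = idm I"
  proof (intro ext)
    fix a c
    show "mm I A B a c = idm I a c"
    proof (cases "a \<in> I \<and> c \<in> I")
      case True
      then have "mm I A B a c = (\<Sum>b\<in>I. A a b * x c b)"
        unfolding mm_def B_def by (intro sum.cong) auto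
      then show ?thesis using x True by simp
    next
      case False
      then have "A a b * B b c = 0" for b
        using A(1) unfolding B_def supp_mat_def by (cases "a \<in> I") auto
      then have "mm I A B a c = 0" unfolding mm_def by (intro sum.neutral) blast
      then show ?thesis
        using False by (auto simp: idm_def)
    qed
  qed
  have BA: "mm I (adj B) A = idm I" using arg_cong[OF AB, of adj] by (simp add: adj_mm A)
  then have "mm I (adj B) (mm I A B) = B"
    using supp by (simp add: mm_idm_left I flip: mm_assoc)
  then have "adj B = B" using AB supp_mat_adj[OF supp] by (simp add: mm_idm_right I)
  then have "mm I B A = idm I" using BA by simp
  then show ?thesis using AB supp by blast
qed

section \<open>The prediction kernel\<close>

text \<open>The entry in row n + i and column n - j of the product C L when the inner index stops at
  n. It does not depend on n.\<close>

definition kern :: "(nat \<Rightarrow> complex) \<Rightarrow> (nat \<Rightarrow> complex) \<Rightarrow> nat \<Rightarrow> nat \<Rightarrow> complex" where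
  "kern c b i j = (\<Sum>r\<le>j. c (i + j - r) * b r)"

text \<open>The terms r > j that \<open>kern\<close> omits from coefficient i + j of the Cauchy
  product, indexed by k = i + j - r.\<close>

definition kern_rest :: "(nat \<Rightarrow> complex) \<Rightarrow> (nat \<Rightarrow> complex) \<Rightarrow> nat \<Rightarrow> nat \<Rightarrow> complex" where
  "kern_rest c b i j = (\<Sum>k<i. c k * b (i + j - k))"

lemma kern_add_kern_rest:
  "kern c b i j + kern_rest c b i j = (\<Sum>r\<le>i + j. c (i + j - r) * b r)"
proof -
  have "kern_rest c b i j = (\<Sum>r\<in>{j<..i + j}. c (i + j - r) * b r)"
    unfolding kern_rest_def
    by (rule sum.reindex_bij_witness[of _ "\<lambda>r. i + j - r" "\<lambda>k. i + j - k"]) auto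
  moreover have "{..i + j} = {..j} \<union> {j<..i + j}" by auto
  ultimately show ?thesis
    unfolding kern_def by (simp add: sum.union_disjoint ivl_disj_int)
qed

text \<open>The partial sums are taken of b, since it is there that the cancellation due to the zero
  of (1 - z)^d at 1 is visible.\<close>

lemma sum_mult_by_parts:
  fixes f b :: "nat \<Rightarrow> complex"
  shows "(\<Sum>r\<le>j. f (j - r) * b r)
    = f 0 * (\<Sum>r\<le>j. b r) + (\<Sum>r<j. (f (j - r) - f (j - Suc r)) * (\<Sum>k\<le>r. b k))"
proof (induction j arbitrary: f)
  case (Suc j)
  have "(\<Sum>r\<le>Suc j. f (Suc j - r) * b r) = (\<Sum>r\<le>j. f (Suc (j - r)) * b r) + f 0 * b (Suc j)"
    by (simp add: Suc_diff_le)
  also have "(\<Sum>r\<le>j. f (Suc (j - r)) * b r)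
      = f 1 * (\<Sum>r\<le>j. b r) + (\<Sum>r<j. (f (Suc (j - r)) - f (Suc (j - Suc r))) * (\<Sum>k\<le>r. b k))"
    using Suc[of "\<lambda>k. f (Suc k)"] by simp
  also have "(\<Sum>r<j. (f (Suc (j - r)) - f (Suc (j - Suc r))) * (\<Sum>k\<le>r. b k))
      = (\<Sum>r<j. (f (Suc j - r) - f (Suc j - Suc r)) * (\<Sum>k\<le>r. b k))"
    by (intro sum.cong refl) (auto simp: Suc_diff_le Suc_diff_Suc)
  finally show ?case by (simp add: algebra_simps)
qed simp

text \<open>The common size of the kernel on both sides of the diagonal. J stands for j + 1, which
  keeps the base of the negative power positive.\<close>

definition decay :: "real \<Rightarrow> nat \<Rightarrow> nat \<Rightarrow> real" where
  "decay d i J = real i powr d * real J powr (- d) / max (real i) (real J)"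

lemma decay_nonneg: "0 \<le> decay d i J"
  by (simp add: decay_def)

lemma decay_antimono:
  assumes "0 < d" "1 \<le> i" "1 \<le> J" "J \<le> J'"
  shows "decay d i J' \<le> decay d i J"
  unfolding decay_def using assms
  by (intro frac_le mult_left_mono powr_mono2') auto

lemma decay_le: "J \<le> i \<Longrightarrow> 1 \<le> i \<Longrightarrow> decay d i J = real i powr (d - 1) * real J powr (- d)"
  by (simp add: decay_def max_def powr_diff)

lemma decay_ge: "i \<le> J \<Longrightarrow> 1 \<le> J \<Longrightarrow> decay d i J = real i powr d * real J powr (- d - 1)"
  by (simp add: decay_def max_def powr_diff)

text \<open>The sum is split at i = m. Below, there are m terms of size at most 1 / m^2; above, the
  tail of i^(2d-2) converges because d < 1/2 and again contributes order 1 / m.\<close>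

lemma sum_decay_sq_le:
  assumes "0 < d" "d < 1/2" "1 \<le> m"
  shows "(\<Sum>i=1..N. (decay d i m)\<^sup>2) \<le> (1 + 1 / (1 - 2 * d)) / real m"
proof -
  have "(\<Sum>i=1..N. (decay d i m)\<^sup>2) \<le> (\<Sum>i\<in>{1..m} \<union> {Suc m..N}. (decay d i m)\<^sup>2)"
    by (intro sum_mono2) auto
  also have "\<dots> = (\<Sum>i=1..m. (decay d i m)\<^sup>2) + (\<Sum>i=Suc m..N. (decay d i m)\<^sup>2)"
    by (intro sum.union_disjoint) auto
  also have "(\<Sum>i=1..m. (decay d i m)\<^sup>2) \<le> (\<Sum>i=1..m. (1 / real m)\<^sup>2)"
  proof (intro sum_mono power_mono decay_nonneg)
    fix i assume i: "i \<in> {1..m}"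
    have "real i powr d * real m powr (- d) \<le> real m powr d * real m powr (- d)"
      using i assms by (intro mult_right_mono powr_mono2) auto
    also have "\<dots> = 1" using assms by (simp flip: powr_add)
    finally show "decay d i m \<le> 1 / real m"
      unfolding decay_def using i assms by (intro frac_le) (auto simp: max_def)
  qed
  also have "(\<Sum>i=1..m. (1 / real m)\<^sup>2) = 1 / real m"
    using assms by (simp add: power2_eq_square)
  also have "(\<Sum>i=Suc m..N. (decay d i m)\<^sup>2)
      = (\<Sum>i=Suc m..N. real m powr (- 2 * d) * real i powr (- (1 - 2 * d) - 1))"
  proof (intro sum.cong refl)
    fix i assume i: "i \<in> {Suc m..N}"
    have "(decay d i m)\<^sup>2 = (real i powr (d - 1) * real m powr (- d)) * (real i powr (d - 1) * real m powr (- d))"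
      using i decay_le[of m i d] by (simp add: power2_eq_square)
    also have "\<dots> = (real m powr (- d) * real m powr (- d)) * (real i powr (d - 1) * real i powr (d - 1))"
      by (simp add: mult_ac)
    also have "\<dots> = real m powr (- 2 * d) * real i powr (- (1 - 2 * d) - 1)"
      unfolding powr_add[symmetric] by (simp add: algebra_simps)
    finally show "(decay d i m)\<^sup>2 = real m powr (- 2 * d) * real i powr (- (1 - 2 * d) - 1)" .
  qed
  also have "\<dots> = real m powr (- 2 * d) * (\<Sum>i=Suc m..N. real i powr (- (1 - 2 * d) - 1))"
    by (simp add: sum_distrib_left)
  also have "\<dots> \<le> real m powr (- 2 * d) * (real m powr (- (1 - 2 * d)) / (1 - 2 * d))"
    using assms by (intro mult_left_mono sum_powr_tail_le) auto
  also have "\<dots> = 1 / (1 - 2 * d) / real m"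
    using assms by (simp add: powr_diff powr_minus field_simps)
  finally show ?thesis by (simp add: add_divide_distrib)
qed

lemma sum_powr_shift_le:
  fixes p :: real
  assumes p: "0 < p" "p \<le> 1"
  shows "(\<Sum>r<j. (real r + 1) powr (p - 1)) \<le> real j powr p / p"
proof -
  have "(\<Sum>r<j. (real r + 1) powr (p - 1)) = (\<Sum>k=1..j. real k powr (p - 1))"
    by (rule sum.reindex_bij_witness[of _ "\<lambda>k. k - 1" Suc]) (auto simp: add.commute)
  then show ?thesis using sum_powr_le[OF p] by simp
qed

text \<open>The coefficient behaviour of (1 - z)^(-d) and (1 - z)^d times analytic factors, with one
  constant for all bounds. The assumption \<open>B\<close> expresses the cancellation in b, whose
  series sums to 0.\<close>

locale fractional_pair =
  fixes d K :: real and c b :: "nat \<Rightarrow> complex"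
  assumes d: "0 < d" "d < 1"
    and c: "norm (c k) \<le> K * (real k + 1) powr (d - 1)"
    and c1: "norm (c (Suc k) - c k) \<le> K * (real k + 1) powr (d - 2)"
    and c2: "norm (c (Suc (Suc k)) - 2 * c (Suc k) + c k) \<le> K * (real k + 1) powr (d - 3)"
    and b: "norm (b k) \<le> K * (real k + 1) powr (- d - 1)"
    and b1: "norm (b (Suc k) - b k) \<le> K * (real k + 1) powr (- d - 2)"
    and B: "norm (\<Sum>r\<le>k. b r) \<le> K * (real k + 1) powr (- d)"
begin

lemma K_nonneg: "0 \<le> K"
  using order.trans[OF norm_ge_zero b[of 0]] by simp

lemma norm_sum_mult_le:
  assumes "norm (f 0) \<le> P" and f: "\<And>k. norm (f (Suc k) - f k) \<le> Q"
  shows "norm (\<Sum>r\<le>j. f (j - r) * b r)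
    \<le> K * (P * real (Suc j) powr (- d) + Q * real (Suc j) powr (1 - d) / (1 - d))"
proof -
  have Q: "0 \<le> Q" using order.trans[OF norm_ge_zero f[of 0]] .
  have "norm (f 0 * (\<Sum>r\<le>j. b r)) \<le> P * (K * (real j + 1) powr (- d))"
    unfolding norm_mult using assms B by (intro mult_mono) (auto intro: order.trans[OF norm_ge_zero])
  moreover have "norm (\<Sum>r<j. (f (j - r) - f (j - Suc r)) * (\<Sum>k\<le>r. b k))
      \<le> Q * K * (real (Suc j) powr (1 - d) / (1 - d))"
  proof -
    have "norm (\<Sum>r<j. (f (j - r) - f (j - Suc r)) * (\<Sum>k\<le>r. b k))
        \<le> (\<Sum>r<j. Q * (K * (real r + 1) powr (- d)))"
    proof (intro sum_norm_le)
      fix r assume "r \<in> {..<j}"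
      then have "norm (f (j - r) - f (j - Suc r)) \<le> Q"
        using f[of "j - Suc r"] by (simp add: Suc_diff_Suc)
      then show "norm ((f (j - r) - f (j - Suc r)) * (\<Sum>k\<le>r. b k)) \<le> Q * (K * (real r + 1) powr (- d))"
        unfolding norm_mult using B Q by (intro mult_mono) auto
    qed
    also have "\<dots> = Q * K * (\<Sum>r<j. (real r + 1) powr (1 - d - 1))"
      by (simp add: sum_distrib_left mult_ac)
    also have "\<dots> \<le> Q * K * (real j powr (1 - d) / (1 - d))"
      using d Q K_nonneg by (intro mult_left_mono sum_powr_shift_le) auto
    also have "\<dots> \<le> Q * K * (real (Suc j) powr (1 - d) / (1 - d))"
      using d Q K_nonneg by (intro mult_left_mono divide_right_mono powr_mono2) auto
    finally show ?thesis .
  qed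
  ultimately show ?thesis
    unfolding sum_mult_by_parts
    by (intro order.trans[OF norm_triangle_ineq]) (simp add: algebra_simps)
qed

text \<open>One constant for all kernel estimates: 1 / (1 - d) stems from summation by parts, 1 / d
  from summing k^(d-1), and 2 in place of 1 from the extra term in the difference of
  kernels.\<close>

definition "kern_const = K\<^sup>2 * (2 + 1 / (1 - d) + 1 / d)"

text \<open>If f can change over j + 1 steps by no more than the bound for its initial value, the
  boundary term of the summation by parts governs.\<close>

lemma norm_sum_mult_le':
  assumes "norm (f 0) \<le> P" and f: "\<And>k. norm (f (Suc k) - f k) \<le> Q"
    and QP: "Q * real (Suc j) \<le> P"
  shows "norm (\<Sum>r\<le>j. f (j - r) * b r) \<le> K * (P * real (Suc j) powr (- d)) * (1 + 1 / (1 - d))"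
proof -
  have "Q * real (Suc j) powr (1 - d) = Q * real (Suc j) * real (Suc j) powr (- d)"
    by (simp add: powr_diff powr_minus field_simps)
  also have "\<dots> \<le> P * real (Suc j) powr (- d)"
    using QP by (intro mult_right_mono) auto
  finally have "K * (P * real (Suc j) powr (- d) + Q * real (Suc j) powr (1 - d) / (1 - d))
      \<le> K * (P * real (Suc j) powr (- d) + P * real (Suc j) powr (- d) / (1 - d))"
    using K_nonneg d by (intro mult_left_mono add_left_mono divide_right_mono) auto
  also have "\<dots> = K * (P * real (Suc j) powr (- d)) * (1 + 1 / (1 - d))"
    by (simp add: algebra_simps)
  finally show ?thesis
    using order.trans[OF norm_sum_mult_le[OF assms(1,2)]] by blast
qed

lemma le_kern_const: "K * K * (1 + 1 / (1 - d)) \<le> kern_const" "K * K * (2 + 1 / (1 - d)) \<le> kern_const" "K * K / d \<le> kern_const"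
proof -
  have "K * K * x \<le> K * K * y" if "x \<le> y" for x y :: real
    using that by (intro mult_left_mono) auto
  from this[of "1 + 1 / (1 - d)" "2 + 1 / (1 - d) + 1 / d"] this[of "2 + 1 / (1 - d)" "2 + 1 / (1 - d) + 1 / d"]
    this[of "1 / d" "2 + 1 / (1 - d) + 1 / d"]
  show "K * K * (1 + 1 / (1 - d)) \<le> kern_const" "K * K * (2 + 1 / (1 - d)) \<le> kern_const" "K * K / d \<le> kern_const"
    using d by (auto simp: kern_const_def power2_eq_square)
qed

lemma kern_const_nonneg: "0 \<le> kern_const"
  using d by (simp add: kern_const_def)

text \<open>Here f k = c (i + k) has increments of relative size 1 / i, and at most i steps are
  taken.\<close>

lemma norm_kern_le:
  assumes "Suc j \<le> i"
  shows "norm (kern c b i j) \<le> kern_const * decay d i (Suc j)"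
proof -
  have "norm (\<Sum>r\<le>j. c (i + (j - r)) * b r)
    \<le> K * ((K * real i powr (d - 1)) * real (Suc j) powr (- d)) * (1 + 1 / (1 - d))"
  proof (rule norm_sum_mult_le'[of "\<lambda>k. c (i + k)"])
    show "norm (c (i + 0)) \<le> K * real i powr (d - 1)"
      using order.trans[OF c[of i] mult_left_mono[OF _ K_nonneg]] d assms by (simp add: powr_mono2')
    show "norm (c (i + Suc k) - c (i + k)) \<le> K * real i powr (d - 2)" for k
      using order.trans[OF c1[of "i + k"] mult_left_mono[OF _ K_nonneg]] d assms by (simp add: powr_mono2')
    have "real i powr (d - 2) * real (Suc j) \<le> real i powr (d - 2) * real i"
      using assms by (intro mult_left_mono) auto
    also have "\<dots> = real i powr (d - 1)"
      using assms by (simp add: powr_diff field_simps power2_eq_square)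
    finally show "K * real i powr (d - 2) * real (Suc j) \<le> K * real i powr (d - 1)"
      using K_nonneg by (simp add: mult_left_mono mult.assoc)
  qed
  also have "(\<Sum>r\<le>j. c (i + (j - r)) * b r) = kern c b i j"
    unfolding kern_def by (intro sum.cong) auto
  also have "K * ((K * real i powr (d - 1)) * real (Suc j) powr (- d)) * (1 + 1 / (1 - d))
      = K * K * (1 + 1 / (1 - d)) * decay d i (Suc j)"
    using assms by (simp add: decay_le)
  also have "\<dots> \<le> kern_const * decay d i (Suc j)"
    by (intro mult_right_mono le_kern_const decay_nonneg)
  finally show ?thesis .
qed

text \<open>Raising j by one replaces c by its first difference and adds the term with index j + 1
  of b. The second difference of c now supplies the increments.\<close>

lemma norm_kern_diff_le:
  assumes "Suc j \<le> i"
  shows "norm (kern c b i (Suc j) - kern c b i j) \<le> kern_const * (decay d i (Suc j) / real (Suc j))"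
proof -
  let ?D = "decay d i (Suc j) / real (Suc j)"
  let ?P = "K * real i powr (d - 2)"
  have D: "?D = real i powr (d - 1) * real (Suc j) powr (- d - 1)"
    using assms by (simp add: decay_le powr_diff)
  have "norm (\<Sum>r\<le>j. (c (i + Suc (j - r)) - c (i + (j - r))) * b r)
    \<le> K * (?P * real (Suc j) powr (- d)) * (1 + 1 / (1 - d))"
  proof (rule norm_sum_mult_le'[of "\<lambda>k. c (i + Suc k) - c (i + k)"])
    show "norm (c (i + Suc 0) - c (i + 0)) \<le> ?P"
      using order.trans[OF c1[of i] mult_left_mono[OF _ K_nonneg]] d assms by (simp add: powr_mono2')
    show "norm (c (i + Suc (Suc k)) - c (i + Suc k) - (c (i + Suc k) - c (i + k))) \<le> K * real i powr (d - 3)" for k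
    proof -
      have "(real (i + k) + 1) powr (d - 3) \<le> real i powr (d - 3)"
        using d assms by (intro powr_mono2') auto
      then have "norm (c (Suc (Suc (i + k))) - 2 * c (Suc (i + k)) + c (i + k)) \<le> K * real i powr (d - 3)"
        using c2[of "i + k"] K_nonneg by (meson mult_left_mono order.trans)
      then show ?thesis by (simp add: algebra_simps)
    qed
    have "real i powr (d - 3) * real (Suc j) \<le> real i powr (d - 3) * real i"
      using assms by (intro mult_left_mono) auto
    also have "\<dots> = real i powr (d - 2)"
      using assms by (simp add: powr_diff field_simps power2_eq_square power3_eq_cube)
    finally show "K * real i powr (d - 3) * real (Suc j) \<le> ?P"
      using K_nonneg by (simp add: mult_left_mono mult.assoc)
  qed
  also have "\<dots> \<le> K * (K * (real i powr (d - 1) * real (Suc j) powr (- d - 1))) * (1 + 1 / (1 - d))"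
  proof -
    \<comment> \<open>The factor 1 / i gained by differencing is weakened to 1 / (j + 1), the form
      common to both sides of the diagonal.\<close>
    have "real i powr (d - 2) * real (Suc j) powr (- d)
        = real i powr (d - 2) * real (Suc j) * real (Suc j) powr (- d - 1)"
      by (simp add: powr_diff)
    also have "\<dots> \<le> real i powr (d - 2) * real i * real (Suc j) powr (- d - 1)"
      using assms by (intro mult_right_mono mult_left_mono) auto
    also have "real i powr (d - 2) * real i = real i powr (d - 1)"
      using assms by (simp add: powr_diff field_simps power2_eq_square)
    finally show ?thesis
      using d K_nonneg by (intro mult_right_mono mult_left_mono) (auto simp: mult.assoc intro: mult_left_mono)
  qed
  finally have 1: "norm (\<Sum>r\<le>j. (c (i + Suc (j - r)) - c (i + (j - r))) * b r) \<le> K * K * (1 + 1 / (1 - d)) * ?D"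
    unfolding D by (simp add: mult_ac)
  have 2: "norm (c i * b (Suc j)) \<le> K * K * ?D"
  proof -
    have "norm (c i) \<le> K * real i powr (d - 1)"
      using order.trans[OF c[of i] mult_left_mono[OF _ K_nonneg]] d assms by (simp add: powr_mono2')
    moreover have "norm (b (Suc j)) \<le> K * real (Suc j) powr (- d - 1)"
      using order.trans[OF b[of "Suc j"] mult_left_mono[OF _ K_nonneg]] d by (simp add: powr_mono2')
    ultimately have "norm (c i * b (Suc j)) \<le> (K * real i powr (d - 1)) * (K * real (Suc j) powr (- d - 1))"
      unfolding norm_mult using K_nonneg by (intro mult_mono) auto
    then show ?thesis unfolding D by (simp add: mult_ac)
  qed
  have "kern c b i (Suc j) - kern c b i j
      = (\<Sum>r\<le>j. (c (i + Suc (j - r)) - c (i + (j - r))) * b r) + c i * b (Suc j)"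
  proof -
    have "(\<Sum>r\<le>j. (c (i + Suc (j - r)) - c (i + (j - r))) * b r)
       = (\<Sum>r\<le>j. c (i + Suc j - r) * b r) - (\<Sum>r\<le>j. c (i + j - r) * b r)"
      unfolding sum_subtractf[symmetric] by (intro sum.cong) (auto simp: left_diff_distrib Suc_diff_le)
    then show ?thesis by (simp add: kern_def)
  qed
  then have "norm (kern c b i (Suc j) - kern c b i j) \<le> K * K * (1 + 1 / (1 - d)) * ?D + K * K * ?D"
    using norm_triangle_mono[OF 1 2] by simp
  also have "\<dots> = K * K * (2 + 1 / (1 - d)) * ?D" by algebra
  also have "\<dots> \<le> kern_const * ?D"
    by (intro mult_right_mono le_kern_const) (simp add: decay_nonneg)
  finally show ?thesis .
qed

lemma norm_sum_mult_le_powr: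
  assumes "\<And>k. k < i \<Longrightarrow> norm (f k) \<le> Q"
  shows "norm (\<Sum>k<i. c k * f k) \<le> K * (real i powr d / d) * Q"
proof (cases "i = 0")
  case False
  have Q: "0 \<le> Q" using order.trans[OF norm_ge_zero assms[of 0]] False by simp
  have "norm (\<Sum>k<i. c k * f k) \<le> (\<Sum>k<i. (K * (real k + 1) powr (d - 1)) * Q)"
  proof (intro sum_norm_le)
    fix k assume "k \<in> {..<i}"
    then show "norm (c k * f k) \<le> (K * (real k + 1) powr (d - 1)) * Q"
      unfolding norm_mult using assms c Q by (intro mult_mono) (auto simp: K_nonneg)
  qed
  also have "\<dots> = K * (\<Sum>k<i. (real k + 1) powr (d - 1)) * Q"
    by (simp add: sum_distrib_left sum_distrib_right)
  also have "\<dots> \<le> K * (real i powr d / d) * Q"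
    using d K_nonneg Q by (intro mult_right_mono mult_left_mono sum_powr_shift_le) auto
  finally show ?thesis .
qed simp

lemma norm_kern_rest_le:
  assumes "1 \<le> i" "i \<le> Suc j"
  shows "norm (kern_rest c b i j) \<le> kern_const * decay d i (Suc j)"
proof -
  have "norm (kern_rest c b i j) \<le> K * (real i powr d / d) * (K * real (Suc j) powr (- d - 1))"
    unfolding kern_rest_def
  proof (intro norm_sum_mult_le_powr)
    fix k assume "k < i"
    then show "norm (b (i + j - k)) \<le> K * real (Suc j) powr (- d - 1)"
      using order.trans[OF b[of "i + j - k"] mult_left_mono[OF _ K_nonneg]] d by (simp add: powr_mono2')
  qed
  also have "\<dots> = K * K / d * decay d i (Suc j)"
    using assms by (simp add: decay_ge)
  also have "\<dots> \<le> kern_const * decay d i (Suc j)"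
    by (intro mult_right_mono le_kern_const decay_nonneg)
  finally show ?thesis .
qed

lemma norm_kern_rest_diff_le:
  assumes "1 \<le> i" "i \<le> Suc j"
  shows "norm (kern_rest c b i (Suc j) - kern_rest c b i j) \<le> kern_const * (decay d i (Suc j) / real (Suc j))"
proof -
  have "kern_rest c b i (Suc j) - kern_rest c b i j = (\<Sum>k<i. c k * (b (Suc (i + j - k)) - b (i + j - k)))"
    unfolding kern_rest_def sum_subtractf[symmetric]
    by (intro sum.cong) (auto simp: right_diff_distrib Suc_diff_le)
  also have "norm \<dots> \<le> K * (real i powr d / d) * (K * real (Suc j) powr (- d - 2))"
  proof (intro norm_sum_mult_le_powr)
    fix k assume "k < i"
    then show "norm (b (Suc (i + j - k)) - b (i + j - k)) \<le> K * real (Suc j) powr (- d - 2)"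
      using order.trans[OF b1[of "i + j - k"] mult_left_mono[OF _ K_nonneg]] d by (simp add: powr_mono2')
  qed
  also have "\<dots> = K * K / d * (decay d i (Suc j) / real (Suc j))"
    using assms by (simp add: decay_ge powr_diff field_simps power2_eq_square)
  also have "\<dots> \<le> kern_const * (decay d i (Suc j) / real (Suc j))"
    by (intro mult_right_mono le_kern_const) (simp add: decay_nonneg)
  finally show ?thesis .
qed

text \<open>Up to r of order m the factor r / m tames r^(-d-1); beyond that the constant 2 meets the
  tail of b. Both parts have order m^(-d).\<close>

lemma norm_sum_diff_le:
  fixes x :: "nat \<Rightarrow> complex"
  assumes m: "1 \<le> m" and x: "\<And>r. norm (x r - x 0) \<le> D * min 2 (real r / real m)"
  shows "norm (\<Sum>r<s. (x r - x 0) * b r) \<le> D * K * (1 / (1 - d) + 2 / d) * real m powr (- d)"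
proof -
  \<comment> \<open>Indexed by k = r + 1.\<close>
  let ?g = "\<lambda>k. if k \<le> m then real k powr (- d) / real m else 2 * real k powr (- d - 1)"
  have D: "0 \<le> D"
    using order.trans[OF norm_ge_zero x[of m]] m by simp
  have "(\<Sum>k=1..s. ?g k) \<le> (\<Sum>k\<in>{1..m} \<union> {Suc m..s}. ?g k)"
    by (intro sum_mono2) auto
  also have "\<dots> = (\<Sum>k=1..m. ?g k) + (\<Sum>k=Suc m..s. ?g k)"
    by (intro sum.union_disjoint) auto
  also have "(\<Sum>k=1..m. ?g k) = (\<Sum>k=1..m. real k powr (1 - d - 1)) / real m"
    unfolding sum_divide_distrib by (intro sum.cong) auto
  also have "\<dots> \<le> real m powr (1 - d) / (1 - d) / real m"
    using d by (intro divide_right_mono sum_powr_le) auto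
  also have "\<dots> = real m powr (- d) / (1 - d)"
  proof -
    have "real m powr (1 - d) = real m * real m powr (- d)"
      using m by (simp add: powr_diff powr_minus field_simps)
    then show ?thesis using m by simp
  qed
  also have "(\<Sum>k=Suc m..s. ?g k) = 2 * (\<Sum>k=Suc m..s. real k powr (- d - 1))"
    unfolding sum_distrib_left by (intro sum.cong) auto
  also have "\<dots> \<le> 2 * (real m powr (- d) / d)"
    using d m by (intro mult_left_mono sum_powr_tail_le) auto
  finally have g: "(\<Sum>k=1..s. ?g k) \<le> (1 / (1 - d) + 2 / d) * real m powr (- d)"
    by (simp add: algebra_simps)
  have "norm (\<Sum>r<s. (x r - x 0) * b r) \<le> (\<Sum>r<s. D * K * ?g (Suc r))"
  proof (intro sum_norm_le)
    fix r assume "r \<in> {..<s}"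
    have "norm ((x r - x 0) * b r) \<le> (D * min 2 (real r / real m)) * (K * real (Suc r) powr (- d - 1))"
      unfolding norm_mult using x b[of r] D by (intro mult_mono) (auto simp: add.commute)
    also have "\<dots> = D * K * (min 2 (real r / real m) * real (Suc r) powr (- d - 1))"
      by (simp add: mult_ac)
    also have "min 2 (real r / real m) * real (Suc r) powr (- d - 1) \<le> ?g (Suc r)"
    proof (cases "Suc r \<le> m")
      case True
      have "min 2 (real r / real m) * real (Suc r) powr (- d - 1)
          \<le> (real (Suc r) / real m) * real (Suc r) powr (- d - 1)"
        by (intro mult_right_mono min.coboundedI2 divide_right_mono) auto
      then show ?thesis using True by (simp add: powr_diff)
    qed (auto intro!: mult_right_mono)
    finally show "norm ((x r - x 0) * b r) \<le> D * K * ?g (Suc r)"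
      using D K_nonneg by (simp add: mult_left_mono)
  qed
  also have "\<dots> = D * K * (\<Sum>k=1..s. ?g k)"
    unfolding sum_distrib_left
    by (rule sum.reindex_bij_witness[of _ "\<lambda>k. k - 1" Suc]) auto
  finally show ?thesis
    using mult_left_mono[OF g, of "D * K"] D K_nonneg by (simp add: mult.assoc)
qed

end

text \<open>Matrix coefficients need not commute, so both products are prescribed; together they
  make the two triangular Toeplitz matrices inverse to each other. The four indices in
  \<open>pair\<close> are independent because the sums combine entries from different positions
  under one K.\<close>

locale fractional_matrix_pair =
  fixes d K :: real and c b :: "'q::finite \<Rightarrow> 'q \<Rightarrow> nat \<Rightarrow> complex"
  assumes d_pos: "0 < d" and d_less: "d < 1 / 2"
    and pair: "fractional_pair d K (c \<alpha> \<mu>) (b \<nu> \<beta>)"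
    and cb: "(\<Sum>\<mu>\<in>UNIV. \<Sum>r\<le>k. c \<alpha> \<mu> (k - r) * b \<mu> \<beta> r) = (if k = 0 \<and> \<alpha> = \<beta> then 1 else 0)"
    and bc: "(\<Sum>\<mu>\<in>UNIV. \<Sum>r\<le>k. b \<alpha> \<mu> (k - r) * c \<mu> \<beta> r) = (if k = 0 \<and> \<alpha> = \<beta> then 1 else 0)"
begin

lemma K_nonneg: "0 \<le> K"
  using fractional_pair.K_nonneg[OF pair] .

definition "X \<alpha> \<beta> i j = (\<Sum>\<mu>\<in>UNIV. kern (c \<alpha> \<mu>) (b \<mu> \<beta>) i j)"

definition "M = real CARD('q) * fractional_pair.kern_const d K"

lemma M_nonneg: "0 \<le> M"
  unfolding M_def using fractional_pair.kern_const_nonneg[OF pair] by simp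

text \<open>The coefficient with positive index i + j of the product of c and b vanishes by
  \<open>cb\<close>. This gives access to the second description of the kernel.\<close>

lemma X_eq_kern_rest:
  assumes "1 \<le> i"
  shows "X \<alpha> \<beta> i j = - (\<Sum>\<mu>\<in>UNIV. kern_rest (c \<alpha> \<mu>) (b \<mu> \<beta>) i j)"
proof -
  have "X \<alpha> \<beta> i j + (\<Sum>\<mu>\<in>UNIV. kern_rest (c \<alpha> \<mu>) (b \<mu> \<beta>) i j) = 0"
    using assms by (simp add: X_def sum.distrib[symmetric] kern_add_kern_rest cb)
  then show ?thesis by (simp add: eq_neg_iff_add_eq_0)
qed

lemma norm_sum_UNIV_le:
  assumes "\<And>\<mu>. norm (f \<mu>) \<le> fractional_pair.kern_const d K * D"
  shows "norm (\<Sum>\<mu>\<in>(UNIV :: 'q set). f \<mu>) \<le> M * D"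
proof -
  have "norm (\<Sum>\<mu>\<in>(UNIV :: 'q set). f \<mu>) \<le> (\<Sum>\<mu>\<in>(UNIV :: 'q set). fractional_pair.kern_const d K * D)"
    using assms by (intro sum_norm_le) auto
  then show ?thesis by (simp add: M_def mult.assoc)
qed

lemma norm_X_le:
  assumes "1 \<le> i"
  shows "norm (X \<alpha> \<beta> i j) \<le> M * decay d i (Suc j)"
proof (cases "Suc j \<le> i")
  case True
  then show ?thesis
    unfolding X_def by (intro norm_sum_UNIV_le fractional_pair.norm_kern_le[OF pair])
next
  case False
  then show ?thesis
    unfolding X_eq_kern_rest[OF assms] norm_minus_cancel
    using assms by (intro norm_sum_UNIV_le fractional_pair.norm_kern_rest_le[OF pair]) auto
qed

lemma norm_X_diff_le:
  assumes "1 \<le> i"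
  shows "norm (X \<alpha> \<beta> i (Suc j) - X \<alpha> \<beta> i j) \<le> M * (decay d i (Suc j) / real (Suc j))"
proof (cases "Suc j \<le> i")
  case True
  then show ?thesis
    unfolding X_def sum_subtractf[symmetric]
    by (intro norm_sum_UNIV_le fractional_pair.norm_kern_diff_le[OF pair])
next
  case False
  have "X \<alpha> \<beta> i (Suc j) - X \<alpha> \<beta> i j
      = - (\<Sum>\<mu>\<in>UNIV. kern_rest (c \<alpha> \<mu>) (b \<mu> \<beta>) i (Suc j) - kern_rest (c \<alpha> \<mu>) (b \<mu> \<beta>) i j)"
    by (simp add: X_eq_kern_rest[OF assms] sum_subtractf)
  then show ?thesis
    unfolding norm_minus_cancel using False assms
    by (simp only: norm_minus_cancel, intro norm_sum_UNIV_le fractional_pair.norm_kern_rest_diff_le[OF pair]) auto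
qed

text \<open>Telescoping one-step differences gives r / m, as \<open>decay\<close> only shrinks on
  the way; bounding the two values separately gives 2. The minimum is the form required by
  \<open>norm_sum_diff_le\<close>.\<close>

lemma norm_X_shift_le:
  assumes "1 \<le> i" "1 \<le> m"
  shows "norm (X \<alpha> \<beta> i (m - 1 + r) - X \<alpha> \<beta> i (m - 1)) \<le> M * decay d i m * min 2 (real r / real m)"
proof -
  have "norm (X \<alpha> \<beta> i (m - 1 + r) - X \<alpha> \<beta> i (m - 1)) \<le> M * decay d i m * (real r / real m)"
  proof (induction r)
    case (Suc r)
    have "norm (X \<alpha> \<beta> i (m - 1 + Suc r) - X \<alpha> \<beta> i (m - 1 + r)) \<le> M * (decay d i (m + r) / real (m + r))"
      using norm_X_diff_le[OF assms(1), of \<alpha> \<beta> "m - 1 + r"] assms by simp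
    also have "\<dots> \<le> M * (decay d i m / real m)"
      using assms d_pos by (intro mult_left_mono frac_le decay_antimono decay_nonneg M_nonneg) auto
    finally have "norm ((X \<alpha> \<beta> i (m - 1 + Suc r) - X \<alpha> \<beta> i (m - 1 + r)) + (X \<alpha> \<beta> i (m - 1 + r) - X \<alpha> \<beta> i (m - 1)))
        \<le> M * (decay d i m / real m) + M * decay d i m * (real r / real m)"
      using Suc by (intro norm_triangle_mono)
    then show ?case using assms by (simp add: field_simps)
  qed simp
  moreover have "norm (X \<alpha> \<beta> i (m - 1 + r) - X \<alpha> \<beta> i (m - 1)) \<le> M * decay d i m * 2"
  proof -
    have "norm (X \<alpha> \<beta> i (m - 1 + r)) \<le> M * decay d i (m + r)"
      using norm_X_le[OF assms(1), of \<alpha> \<beta> "m - 1 + r"] assms by simp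
    also have "\<dots> \<le> M * decay d i m"
      using assms d_pos by (intro mult_left_mono decay_antimono M_nonneg) auto
    finally show ?thesis
      using norm_X_le[OF assms(1), of \<alpha> \<beta> "m - 1"] assms(2)
        norm_triangle_ineq4[of "X \<alpha> \<beta> i (m - 1 + r)" "X \<alpha> \<beta> i (m - 1)"] by simp
  qed
  ultimately show ?thesis
    using M_nonneg decay_nonneg[of d i m] by (auto simp: min_def)
qed

text \<open>For m = n + 1 - s, the entry in row n + i and column s of the product C S with inner
  index up to n; see \<open>sum_lower_toeplitz_Smat\<close>.\<close>

definition "Y \<alpha> \<beta> i m s = (\<Sum>r<s. \<Sum>\<mu>\<in>UNIV. X \<alpha> \<mu> i (m - 1 + r) * cnj (b \<beta> \<mu> r))"

definition "N = real CARD('q) * (M * K * (1 + 1 / (1 - d) + 2 / d))"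

lemma norm_Y_le:
  assumes "1 \<le> i" "1 \<le> m" "1 \<le> s"
  shows "norm (Y \<alpha> \<beta> i m s) \<le> N * (real s powr (- d) + real m powr (- d)) * decay d i m"
proof -
  have bound: "norm (\<Sum>r<s. X \<alpha> \<mu> i (m - 1 + r) * cnj (b \<beta> \<mu> r))
      \<le> M * K * (1 + 1 / (1 - d) + 2 / d) * (real s powr (- d) + real m powr (- d)) * decay d i m" for \<mu>
  proof -
    interpret fractional_pair d K "c \<alpha> \<mu>" "b \<beta> \<mu>" by (rule pair)
    \<comment> \<open>Conjugating the whole sum removes the conjugation from b, so that its partial
      sums appear.\<close>
    let ?x = "\<lambda>r. cnj (X \<alpha> \<mu> i (m - 1 + r))" and ?b = "b \<beta> \<mu>"
    have "norm (?x 0) \<le> M * decay d i m"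
      using norm_X_le[OF assms(1), of \<alpha> \<mu> "m - 1"] assms(2) by simp
    moreover have "norm (\<Sum>r<s. ?b r) \<le> K * real s powr (- d)"
      using B[of "s - 1"] assms(3) by (cases s) (auto simp: lessThan_Suc_atMost add.commute)
    ultimately have 1: "norm (?x 0 * (\<Sum>r<s. ?b r)) \<le> (M * decay d i m) * (K * real s powr (- d))"
      unfolding norm_mult using M_nonneg decay_nonneg[of d i m] by (intro mult_mono) auto
    have 2: "norm (\<Sum>r<s. (?x r - ?x 0) * ?b r) \<le> M * decay d i m * K * (1 / (1 - d) + 2 / d) * real m powr (- d)"
    proof (rule norm_sum_diff_le[OF assms(2)])
      fix r
      have "?x r - ?x 0 = cnj (X \<alpha> \<mu> i (m - 1 + r) - X \<alpha> \<mu> i (m - 1))" by simp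
      then show "norm (?x r - ?x 0) \<le> M * decay d i m * min 2 (real r / real m)"
        using norm_X_shift_le[OF assms(1,2), of \<alpha> \<mu> r] by (simp only: complex_mod_cnj)
    qed
    have "norm (\<Sum>r<s. X \<alpha> \<mu> i (m - 1 + r) * cnj (?b r)) = norm (\<Sum>r<s. ?x r * ?b r)"
      by (subst complex_mod_cnj[symmetric]) simp
    also have "(\<Sum>r<s. ?x r * ?b r) = ?x 0 * (\<Sum>r<s. ?b r) + (\<Sum>r<s. (?x r - ?x 0) * ?b r)"
      by (simp add: left_diff_distrib sum_subtractf sum_distrib_left)
    also have "norm \<dots> \<le> (M * decay d i m) * (K * real s powr (- d)) + M * decay d i m * K * (1 / (1 - d) + 2 / d) * real m powr (- d)"
      by (rule norm_triangle_mono[OF 1 2])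
    also have "\<dots> = M * decay d i m * K * (1 * real s powr (- d) + (1 / (1 - d) + 2 / d) * real m powr (- d))"
      by (simp add: algebra_simps)
    also have "\<dots> \<le> M * decay d i m * K * ((1 + 1 / (1 - d) + 2 / d) * real s powr (- d) + (1 + 1 / (1 - d) + 2 / d) * real m powr (- d))"
      using d_pos d_less M_nonneg K_nonneg decay_nonneg[of d i m]
      by (intro mult_left_mono add_mono mult_right_mono) auto
    finally show ?thesis by (simp only: algebra_simps)
  qed
  have "norm (\<Sum>\<mu>\<in>UNIV. \<Sum>r<s. X \<alpha> \<mu> i (m - 1 + r) * cnj (b \<beta> \<mu> r))
      \<le> (\<Sum>\<mu>\<in>(UNIV :: 'q set). M * K * (1 + 1 / (1 - d) + 2 / d) * (real s powr (- d) + real m powr (- d)) * decay d i m)"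
    by (intro sum_norm_le bound)
  then show ?thesis
    unfolding Y_def by (subst sum.swap) (simp add: N_def mult.assoc)
qed

definition "Q = real CARD('q) * N\<^sup>2 * (1 + 1 / (1 - 2 * d))"

lemma Q_nonneg: "0 \<le> Q"
  using d_less by (simp add: Q_def)

lemma sum_norm_Y_sq_le:
  assumes "1 \<le> m" "1 \<le> s"
  shows "(\<Sum>i=1..P. \<Sum>\<alpha>\<in>UNIV. (norm (Y \<alpha> \<beta> i m s))\<^sup>2)
    \<le> Q * (real m powr (- 1 / 2) * (real s powr (- d) + real m powr (- d)))\<^sup>2"
proof -
  let ?z = "real s powr (- d) + real m powr (- d)"
  have "(\<Sum>i=1..P. \<Sum>\<alpha>\<in>UNIV. (norm (Y \<alpha> \<beta> i m s))\<^sup>2) \<le> (\<Sum>i=1..P. \<Sum>\<alpha>\<in>(UNIV :: 'q set). (N * ?z * decay d i m)\<^sup>2)"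
    using assms by (intro sum_mono power_mono norm_Y_le) auto
  also have "\<dots> = real CARD('q) * N\<^sup>2 * ?z\<^sup>2 * (\<Sum>i=1..P. (decay d i m)\<^sup>2)"
    unfolding sum_distrib_left by (intro sum.cong refl) (simp add: power_mult_distrib mult_ac)
  also have "\<dots> \<le> real CARD('q) * N\<^sup>2 * ?z\<^sup>2 * ((1 + 1 / (1 - 2 * d)) / real m)"
    using assms d_pos d_less by (intro mult_left_mono sum_decay_sq_le) auto
  also have "(1 + 1 / (1 - 2 * d)) / real m = (1 + 1 / (1 - 2 * d)) * (real m powr (- 1 / 2))\<^sup>2"
  proof -
    have "(real m powr (- 1 / 2))\<^sup>2 = real m powr (- 1)"
      unfolding power2_eq_square powr_add[symmetric] by simp
    then show ?thesis using assms by (simp add: powr_minus field_simps)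
  qed
  also have "real CARD('q) * N\<^sup>2 * ?z\<^sup>2 * \<dots> = Q * (real m powr (- 1 / 2) * ?z)\<^sup>2"
    by (simp only: Q_def power_mult_distrib mult_ac)
  finally show ?thesis .
qed

end

section \<open>Block Toeplitz matrices\<close>

definition restr :: "'a set \<Rightarrow> ('a \<Rightarrow> 'a \<Rightarrow> complex) \<Rightarrow> 'a \<Rightarrow> 'a \<Rightarrow> complex" where
  "restr I A = (\<lambda>a b. if a \<in> I \<and> b \<in> I then A a b else 0)"

lemma supp_mat_restr [simp]: "supp_mat I (restr I A)"
  by (simp add: supp_mat_def restr_def)

lemma restr_apply [simp]: "a \<in> I \<Longrightarrow> b \<in> I \<Longrightarrow> restr I A a b = A a b"
  by (simp add: restr_def)

lemma mm_restr: "mm I (restr I A) (restr I B) = restr I (mm I A B)"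
proof (intro ext)
  fix a b show "mm I (restr I A) (restr I B) a b = restr I (mm I A B) a b"
    by (cases "a \<in> I \<and> b \<in> I") (auto simp: mm_def restr_def intro!: sum.cong sum.neutral)
qed

lemma adj_restr: "adj (restr I A) = restr I (adj A)"
  by (auto simp: adj_def restr_def fun_eq_iff)

lemma restr_add: "restr I (A + B) = restr I A + restr I B"
  by (auto simp: restr_def fun_eq_iff)

lemma restr_cong: "(\<And>a b. a \<in> I \<Longrightarrow> b \<in> I \<Longrightarrow> A a b = B a b) \<Longrightarrow> restr I A = restr I B"
  by (auto simp: restr_def fun_eq_iff)

lemma restr_idm: "restr I (idm I) = idm I"
  by (auto simp: restr_def idm_def fun_eq_iff)

lemma qform_restr: "qform I (restr I A) v = qform I A v"
  unfolding qform_def by (intro sum.cong refl) auto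

text \<open>Turns the diagonal of S K S into the form of K on a column of S, which is a squared l^2
  norm once K is a Gram matrix.\<close>

lemma mm_mm_self_adj:
  assumes "adj S = S" shows "mm I (mm I S K) S a a = qform I K (\<lambda>c. S c a)"
proof -
  have S: "cnj (S x a) = S a x" for x
    using fun_cong[OF fun_cong[OF assms]] by (simp add: adj_def)
  have "mm I (mm I S K) S a a = (\<Sum>y\<in>I. \<Sum>x\<in>I. S a x * K x y * S y a)"
    by (simp add: mm_def sum_distrib_right)
  also have "\<dots> = (\<Sum>x\<in>I. \<Sum>y\<in>I. S a x * K x y * S y a)" by (rule sum.swap)
  finally show ?thesis by (simp add: qform_def S)
qed

text \<open>For u <= n this is the full convolution. For u > n the inner index stops at n before it
  reaches u, which leaves the truncated convolution of \<open>kern\<close>.\<close>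

lemma toeplitz_product_sum:
  fixes f g :: "nat \<Rightarrow> complex"
  assumes "1 \<le> l"
  shows "(\<Sum>k=1..n. (if k \<le> u then f (u - k) else 0) * (if l \<le> k then g (k - l) else 0))
    = (if l \<le> min n u then \<Sum>r\<le>min n u - l. f (u - l - r) * g r else 0)"
proof -
  have "(\<Sum>k=1..n. (if k \<le> u then f (u - k) else 0) * (if l \<le> k then g (k - l) else 0))
      = (\<Sum>k\<in>{l..min n u}. (if k \<le> u then f (u - k) else 0) * (if l \<le> k then g (k - l) else 0))"
    using assms by (intro sum.mono_neutral_right) auto
  also have "\<dots> = (\<Sum>k\<in>{l..min n u}. f (u - k) * g (k - l))"
    by (intro sum.cong) auto
  also have "\<dots> = (if l \<le> min n u then \<Sum>r\<le>min n u - l. f (u - l - r) * g r else 0)"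
  proof (cases "l \<le> min n u")
    case True
    have "(\<Sum>k\<in>{l..min n u}. f (u - k) * g (k - l)) = (\<Sum>r\<le>min n u - l. f (u - l - r) * g r)"
      using True by (intro sum.reindex_bij_witness[of _ "\<lambda>r. r + l" "\<lambda>k. k - l"]) auto
    then show ?thesis using True by simp
  qed auto
  finally show ?thesis .
qed

section \<open>Lower triangular block Toeplitz matrices\<close>

definition block_index :: "nat \<Rightarrow> (nat \<times> 'q::finite) set" where
  "block_index n = {1..n} \<times> UNIV"

lemma finite_block_index [simp]: "finite (block_index n)"
  by (simp add: block_index_def)

abbreviation corner ::
    "nat \<Rightarrow> (nat \<times> 'q::finite \<Rightarrow> nat \<times> 'q \<Rightarrow> complex) \<Rightarrow> nat \<times> 'q \<Rightarrow> nat \<times> 'q \<Rightarrow> complex" where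
  "corner n A \<equiv> restr (block_index n) A"

lemma sum_block_index: "(\<Sum>x\<in>block_index n. g x) = (\<Sum>k=1..n. \<Sum>\<kappa>\<in>UNIV. g (k, \<kappa>))"
  by (simp add: block_index_def sum.cartesian_product)

definition lower_toeplitz :: "('q \<Rightarrow> 'q \<Rightarrow> nat \<Rightarrow> complex) \<Rightarrow> nat \<times> 'q \<Rightarrow> nat \<times> 'q \<Rightarrow> complex" where
  "lower_toeplitz f = (\<lambda>(s, \<alpha>) (t, \<beta>). if t \<le> s then f \<alpha> \<beta> (s - t) else 0)"

lemma sum_lower_toeplitz:
  fixes f g :: "'q::finite \<Rightarrow> 'q \<Rightarrow> nat \<Rightarrow> complex"
  assumes "1 \<le> l"
  shows "(\<Sum>x\<in>block_index n. lower_toeplitz f (u, \<mu>) x * lower_toeplitz g x (l, \<nu>))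
    = (if l \<le> min n u then \<Sum>\<kappa>\<in>UNIV. \<Sum>r\<le>min n u - l. f \<mu> \<kappa> (u - l - r) * g \<kappa> \<nu> r else 0)"
proof -
  have "(\<Sum>x\<in>block_index n. lower_toeplitz f (u, \<mu>) x * lower_toeplitz g x (l, \<nu>))
      = (\<Sum>\<kappa>\<in>UNIV. \<Sum>k=1..n. (if k \<le> u then f \<mu> \<kappa> (u - k) else 0) * (if l \<le> k then g \<kappa> \<nu> (k - l) else 0))"
    unfolding sum_block_index lower_toeplitz_def by (subst sum.swap) simp
  then show ?thesis unfolding toeplitz_product_sum[OF assms] by (cases "l \<le> min n u") auto
qed

lemma mm_lower_toeplitz_inverse:
  fixes f g :: "'q::finite \<Rightarrow> 'q \<Rightarrow> nat \<Rightarrow> complex"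
  assumes "\<And>\<alpha> \<beta> k. (\<Sum>\<mu>\<in>UNIV. \<Sum>r\<le>k. f \<alpha> \<mu> (k - r) * g \<mu> \<beta> r) = (if k = 0 \<and> \<alpha> = \<beta> then 1 else 0)"
  shows "mm (block_index n) (corner n (lower_toeplitz f)) (corner n (lower_toeplitz g))
    = idm (block_index n)"
proof -
  have "corner n (mm (block_index n) (lower_toeplitz f) (lower_toeplitz g))
      = corner n (idm (block_index n))"
  proof (rule restr_cong)
    fix a b :: "nat \<times> 'q" assume ab: "a \<in> block_index n" "b \<in> block_index n"
    obtain s \<alpha> t \<beta> where [simp]: "a = (s, \<alpha>)" "b = (t, \<beta>)" by (metis surj_pair)
    have t: "1 \<le> t" "s \<le> n" using ab by (auto simp: block_index_def)
    show "mm (block_index n) (lower_toeplitz f) (lower_toeplitz g) a b = idm (block_index n) a b"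
      using ab sum_lower_toeplitz[OF t(1), where n = n and f = f and u = s and \<mu> = \<alpha> and g = g and \<nu> = \<beta>] assms[of \<alpha> "s - t" \<beta>] t(2)
      by (auto simp: mm_def idm_def min_def)
  qed
  then show ?thesis by (simp only: mm_restr restr_idm)
qed

text \<open>The bound for y_s up to a constant: its square bounds the diagonal entries of S K S in
  block s.\<close>

definition dist_bound :: "real \<Rightarrow> nat \<Rightarrow> nat \<Rightarrow> real" where
  "dist_bound d n s = real (n + 1 - s) powr (- 1 / 2) * (real s powr (- d) + real (n + 1 - s) powr (- d))"

lemma dist_bound_nonneg: "0 \<le> dist_bound d n s"
  by (simp add: dist_bound_def)

context fractional_matrix_pair
begin

text \<open>The Gram matrix of the columns of the infinite C. Row u = 0 contributes nothing to
  blocks whose indices start at 1.\<close>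

definition "Tmat a e = (\<Sum>u. \<Sum>\<mu>\<in>UNIV. cnj (lower_toeplitz c (u, \<mu>) a) * lower_toeplitz c (u, \<mu>) e)"

definition "Kmat n a e = (\<Sum>i. \<Sum>\<mu>\<in>UNIV. cnj (lower_toeplitz c (i + Suc n, \<mu>) a) * lower_toeplitz c (i + Suc n, \<mu>) e)"

definition "Smat a e = (\<Sum>l=1..min (fst a) (fst e). \<Sum>\<mu>\<in>UNIV. b (snd a) \<mu> (fst a - l) * cnj (b (snd e) \<mu> (fst e - l)))"

lemma summable_lower_toeplitz_sq: "summable (\<lambda>u. (norm (lower_toeplitz c (u, \<mu>) a))\<^sup>2)"
proof -
  obtain s \<alpha> where a: "a = (s, \<alpha>)" by fastforce
  interpret fractional_pair d K "c \<mu> \<alpha>" "b \<mu> \<alpha>" by (rule pair)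
  have "summable (\<lambda>u. (norm (lower_toeplitz c (u + s, \<mu>) a))\<^sup>2)"
  proof (rule summable_comparison_test'[where N = 0])
    show "summable (\<lambda>u. K\<^sup>2 * real (Suc u) powr (2 * d - 2))"
      using d_less by (intro summable_mult) (subst summable_Suc_iff, simp add: summable_real_powr_iff)
    fix u
    have "(norm (c \<mu> \<alpha> u))\<^sup>2 \<le> (K * (real u + 1) powr (d - 1))\<^sup>2"
      by (intro power_mono c) auto
    also have "\<dots> = K\<^sup>2 * real (Suc u) powr (2 * d - 2)"
      by (simp add: power_mult_distrib power2_eq_square powr_add[symmetric] add.commute)
    finally show "norm ((norm (lower_toeplitz c (u + s, \<mu>) a))\<^sup>2) \<le> K\<^sup>2 * real (Suc u) powr (2 * d - 2)"
      by (simp add: lower_toeplitz_def a)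
  qed
  then show ?thesis by (subst (asm) summable_iff_shift)
qed

lemma summable_gram_terms:
  "summable (\<lambda>u. \<Sum>\<mu>\<in>UNIV. cnj (lower_toeplitz c (u, \<mu>) a) * lower_toeplitz c (u, \<mu>) e)"
proof (intro summable_sum)
  fix \<mu>
  show "summable (\<lambda>u. cnj (lower_toeplitz c (u, \<mu>) a) * lower_toeplitz c (u, \<mu>) e)"
  proof (rule summable_comparison_test'[where N = 0])
    show "summable (\<lambda>u. (norm (lower_toeplitz c (u, \<mu>) a))\<^sup>2 + (norm (lower_toeplitz c (u, \<mu>) e))\<^sup>2)"
      by (intro summable_add summable_lower_toeplitz_sq)
    fix u
    have "x * y \<le> x\<^sup>2 + y\<^sup>2" if "0 \<le> x" "0 \<le> y" for x y :: real
      using sum_squares_bound[of x y] mult_nonneg_nonneg[OF that] by linarith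
    then show "norm (cnj (lower_toeplitz c (u, \<mu>) a) * lower_toeplitz c (u, \<mu>) e)
        \<le> (norm (lower_toeplitz c (u, \<mu>) a))\<^sup>2 + (norm (lower_toeplitz c (u, \<mu>) e))\<^sup>2"
      by (simp add: norm_mult)
  qed
qed

lemma Tmat_eq_Kmat:
  assumes "a \<in> block_index n"
  shows "Tmat a e = mm (block_index n) (adj (lower_toeplitz c)) (lower_toeplitz c) a e + Kmat n a e"
proof -
  have "Tmat a e = Kmat n a e + (\<Sum>u<Suc n. \<Sum>\<mu>\<in>UNIV. cnj (lower_toeplitz c (u, \<mu>) a) * lower_toeplitz c (u, \<mu>) e)"
    unfolding Tmat_def Kmat_def by (rule suminf_split_initial_segment[OF summable_gram_terms])
  also have "(\<Sum>u<Suc n. \<Sum>\<mu>\<in>UNIV. cnj (lower_toeplitz c (u, \<mu>) a) * lower_toeplitz c (u, \<mu>) e)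
     = (\<Sum>u=1..n. \<Sum>\<mu>\<in>UNIV. cnj (lower_toeplitz c (u, \<mu>) a) * lower_toeplitz c (u, \<mu>) e)"
    using assms by (intro sum.mono_neutral_right) (auto simp: lower_toeplitz_def block_index_def)
  finally show ?thesis by (simp add: mm_def adj_def sum_block_index add.commute)
qed

text \<open>The form of a Gram matrix is a series of squared norms. This yields both the
  semidefiniteness of K and, for columns of S, the link with \<open>Y\<close>.\<close>

lemma qform_Kmat_sums:
  "(\<lambda>i. \<Sum>\<mu>\<in>UNIV. (norm (\<Sum>x\<in>block_index n. lower_toeplitz c (i + Suc n, \<mu>) x * v x))\<^sup>2)
     sums Re (qform (block_index n) (Kmat n) v)"
proof -
  let ?C = "\<lambda>i \<mu> x. lower_toeplitz c (i + Suc n, \<mu>) x" and ?I = "block_index n"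
  have "(\<lambda>i. \<Sum>\<mu>\<in>UNIV. cnj (?C i \<mu> x) * ?C i \<mu> y) sums Kmat n x y" for x y
    unfolding Kmat_def
    using summable_ignore_initial_segment[OF summable_gram_terms, of "Suc n" x y] by (rule summable_sums)
  then have "(\<lambda>i. \<Sum>x\<in>?I. \<Sum>y\<in>?I. cnj (v x) * (\<Sum>\<mu>\<in>UNIV. cnj (?C i \<mu> x) * ?C i \<mu> y) * v y)
      sums qform ?I (Kmat n) v"
    unfolding qform_def by (intro sums_sum sums_mult sums_mult2)
  moreover have "(\<Sum>x\<in>?I. \<Sum>y\<in>?I. cnj (v x) * (\<Sum>\<mu>\<in>UNIV. cnj (?C i \<mu> x) * ?C i \<mu> y) * v y)
      = of_real (\<Sum>\<mu>\<in>UNIV. (norm (\<Sum>x\<in>?I. ?C i \<mu> x * v x))\<^sup>2)" for i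
  proof -
    let ?p = "\<lambda>\<mu> x y. cnj (?C i \<mu> x * v x) * (?C i \<mu> y * v y)"
    have "(\<Sum>x\<in>?I. \<Sum>y\<in>?I. cnj (v x) * (\<Sum>\<mu>\<in>UNIV. cnj (?C i \<mu> x) * ?C i \<mu> y) * v y)
        = (\<Sum>x\<in>?I. \<Sum>y\<in>?I. \<Sum>\<mu>\<in>UNIV. ?p \<mu> x y)"
      by (simp add: sum_distrib_left sum_distrib_right mult_ac)
    also have "\<dots> = (\<Sum>x\<in>?I. \<Sum>\<mu>\<in>UNIV. \<Sum>y\<in>?I. ?p \<mu> x y)"
      by (intro sum.cong refl sum.swap)
    also have "\<dots> = (\<Sum>\<mu>\<in>UNIV. \<Sum>x\<in>?I. \<Sum>y\<in>?I. ?p \<mu> x y)"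
      by (rule sum.swap)
    also have "\<dots> = (\<Sum>\<mu>\<in>UNIV. cnj (\<Sum>x\<in>?I. ?C i \<mu> x * v x) * (\<Sum>y\<in>?I. ?C i \<mu> y * v y))"
      by (simp only: cnj_sum sum_product)
    also have "\<dots> = (\<Sum>\<mu>\<in>UNIV. of_real ((norm (\<Sum>x\<in>?I. ?C i \<mu> x * v x))\<^sup>2))"
      by (intro sum.cong refl) (simp only: complex_norm_square mult.commute)
    finally show ?thesis by simp
  qed
  ultimately show ?thesis using sums_Re by fastforce
qed

lemma adj_Kmat: "adj (Kmat n) = Kmat n"
proof (intro ext)
  fix a e
  have "cnj (Kmat n e a) = (\<Sum>i. cnj (\<Sum>\<mu>\<in>UNIV. cnj (lower_toeplitz c (i + Suc n, \<mu>) e) * lower_toeplitz c (i + Suc n, \<mu>) a))"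
    unfolding Kmat_def
    by (rule sums_unique, subst sums_cnj, rule summable_sums,
        rule summable_ignore_initial_segment[OF summable_gram_terms, of "Suc n" e a])
  then show "adj (Kmat n) a e = Kmat n a e"
    by (simp add: adj_def Kmat_def mult.commute)
qed

lemma psd_Kmat: "psd (block_index n) (corner n (Kmat n))"
  unfolding psd_def qform_restr adj_restr adj_Kmat
proof (intro conjI allI refl)
  fix v show "0 \<le> Re (qform (block_index n) (Kmat n) v)"
    by (rule sums_le[OF _ sums_zero qform_Kmat_sums]) (intro sum_nonneg zero_le_power2)
qed

lemma Smat_eq_mm:
  assumes "a \<in> block_index n" "e \<in> block_index n"
  shows "Smat a e = mm (block_index n) (lower_toeplitz b) (adj (lower_toeplitz b)) a e"
proof -
  obtain s \<alpha> t \<beta> where [simp]: "a = (s, \<alpha>)" "e = (t, \<beta>)" by (metis surj_pair)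
  have "mm (block_index n) (lower_toeplitz b) (adj (lower_toeplitz b)) a e
      = (\<Sum>l=1..n. \<Sum>\<mu>\<in>UNIV. lower_toeplitz b a (l, \<mu>) * cnj (lower_toeplitz b e (l, \<mu>)))"
    by (simp add: mm_def adj_def sum_block_index)
  also have "\<dots> = (\<Sum>l=1..min s t. \<Sum>\<mu>\<in>UNIV. lower_toeplitz b a (l, \<mu>) * cnj (lower_toeplitz b e (l, \<mu>)))"
    using assms by (intro sum.mono_neutral_right) (auto simp: lower_toeplitz_def block_index_def)
  also have "\<dots> = Smat a e"
    unfolding Smat_def by (intro sum.cong) (auto simp: lower_toeplitz_def)
  finally show ?thesis ..
qed

text \<open>Writing S as L times its adjoint and summing C L first produces X at (i, n - l). The
  substitution l = s - r then turns n - l into m - 1 + r with m = n + 1 - s.\<close>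

lemma sum_lower_toeplitz_Smat:
  assumes "s \<in> {1..n}" "1 \<le> i"
  shows "(\<Sum>x\<in>block_index n. lower_toeplitz c (n + i, \<mu>) x * Smat x (s, \<beta>)) = Y \<mu> \<beta> i (n + 1 - s) s"
proof -
  let ?I = "block_index n"
  have "(\<Sum>x\<in>?I. lower_toeplitz c (n + i, \<mu>) x * Smat x (s, \<beta>))
     = (\<Sum>x\<in>?I. \<Sum>y\<in>?I. lower_toeplitz c (n + i, \<mu>) x * lower_toeplitz b x y * cnj (lower_toeplitz b (s, \<beta>) y))"
    using assms(1) by (intro sum.cong refl) (simp add: Smat_eq_mm[of _ n] block_index_def mm_def adj_def sum_distrib_left mult.assoc)
  also have "\<dots> = (\<Sum>y\<in>?I. (\<Sum>x\<in>?I. lower_toeplitz c (n + i, \<mu>) x * lower_toeplitz b x y) * cnj (lower_toeplitz b (s, \<beta>) y))"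
    by (subst sum.swap) (simp add: sum_distrib_right)
  also have "\<dots> = (\<Sum>l=1..n. \<Sum>\<nu>\<in>UNIV. X \<mu> \<nu> i (n - l) * cnj (lower_toeplitz b (s, \<beta>) (l, \<nu>)))"
  proof -
    have "(\<Sum>x\<in>?I. lower_toeplitz c (n + i, \<mu>) x * lower_toeplitz b x (l, \<nu>)) = X \<mu> \<nu> i (n - l)"
      if "l \<in> {1..n}" for l \<nu>
      using that by (subst sum_lower_toeplitz) (auto simp: X_def kern_def add.commute[of i n] intro!: sum.cong)
    then show ?thesis unfolding sum_block_index[of "\<lambda>y. (\<Sum>x\<in>?I. lower_toeplitz c (n + i, \<mu>) x * lower_toeplitz b x y) * cnj (lower_toeplitz b (s, \<beta>) y)"]
      by (intro sum.cong refl) simp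
  qed
  also have "\<dots> = (\<Sum>l=1..s. \<Sum>\<nu>\<in>UNIV. X \<mu> \<nu> i (n - l) * cnj (lower_toeplitz b (s, \<beta>) (l, \<nu>)))"
    using assms(1) by (intro sum.mono_neutral_right) (auto simp: lower_toeplitz_def)
  also have "\<dots> = (\<Sum>r<s. \<Sum>\<nu>\<in>UNIV. X \<mu> \<nu> i (n + 1 - s - 1 + r) * cnj (b \<beta> \<nu> r))"
    using assms(1)
    by (intro sum.reindex_bij_witness[of _ "\<lambda>r. s - r" "\<lambda>l. s - l"]) (auto simp: lower_toeplitz_def)
  finally show ?thesis by (simp add: Y_def)
qed

lemma diag_bound:
  assumes "s \<in> {1..n}"
  shows "Re (qform (block_index n) (Kmat n) (\<lambda>x. Smat x (s, \<beta>))) \<le> Q * (dist_bound d n s)\<^sup>2"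
proof -
  let ?f = "\<lambda>i. \<Sum>\<mu>\<in>UNIV. (norm (Y \<mu> \<beta> (Suc i) (n + 1 - s) s))\<^sup>2"
  have "(\<Sum>x\<in>block_index n. lower_toeplitz c (i + Suc n, \<mu>) x * Smat x (s, \<beta>)) = Y \<mu> \<beta> (Suc i) (n + 1 - s) s" for i \<mu>
    using sum_lower_toeplitz_Smat[OF assms, of "Suc i" \<mu> \<beta>] by (simp add: add.commute)
  then have sums: "?f sums Re (qform (block_index n) (Kmat n) (\<lambda>x. Smat x (s, \<beta>)))"
    using qform_Kmat_sums[of n "\<lambda>x. Smat x (s, \<beta>)"] by simp
  have "(\<Sum>i<P. ?f i) \<le> Q * (dist_bound d n s)\<^sup>2" for P
  proof -
    have "(\<Sum>i<P. ?f i) = (\<Sum>i=1..P. \<Sum>\<mu>\<in>UNIV. (norm (Y \<mu> \<beta> i (n + 1 - s) s))\<^sup>2)"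
      by (rule sum.reindex_bij_witness[of _ "\<lambda>i. i - 1" Suc]) auto
    also have "\<dots> \<le> Q * (dist_bound d n s)\<^sup>2"
      unfolding dist_bound_def using assms by (intro sum_norm_Y_sq_le) auto
    finally show ?thesis .
  qed
  then have "suminf ?f \<le> Q * (dist_bound d n s)\<^sup>2"
    using sums by (intro suminf_le_const) (auto simp: sums_iff)
  then show ?thesis using sums by (simp add: sums_iff)
qed

lemma restr_Tmat:
  "corner n Tmat = mm (block_index n) (adj (corner n (lower_toeplitz c))) (corner n (lower_toeplitz c))
     + corner n (Kmat n)"
  unfolding adj_restr mm_restr restr_add[symmetric]
  by (rule restr_cong) (simp add: Tmat_eq_Kmat)

lemma restr_Smat:
  "corner n Smat = mm (block_index n) (corner n (lower_toeplitz b)) (adj (corner n (lower_toeplitz b)))"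
  unfolding adj_restr mm_restr
  by (rule restr_cong) (simp add: Smat_eq_mm)

text \<open>The corner is positive definite: both summands of \<open>restr_Tmat\<close> are
  semidefinite, and the first vanishes only if C v = 0, which forces v = 0 because L C is the
  identity.\<close>

lemma Tmat_inverse_exists:
  "\<exists>B. mm (block_index n) (corner n Tmat) B = idm (block_index n)
     \<and> mm (block_index n) B (corner n Tmat) = idm (block_index n)"
proof -
  let ?I = "block_index n" and ?C = "corner n (lower_toeplitz c)" and ?L = "corner n (lower_toeplitz b)"
  let ?K = "corner n (Kmat n)"
  have LC: "mm ?I ?L ?C = idm ?I" by (rule mm_lower_toeplitz_inverse[OF bc])
  have C: "qform ?I (mm ?I (adj ?C) ?C) v = (\<Sum>a\<in>?I. of_real ((norm (\<Sum>x\<in>?I. ?C a x * v x))\<^sup>2))" for v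
    using qform_congruence[of ?I ?C "idm ?I" v] by (simp add: mm_idm_left qform_idm)
  have "qform ?I (corner n Tmat) v \<noteq> 0" if v: "\<exists>a\<in>?I. v a \<noteq> 0" for v
  proof
    assume "qform ?I (corner n Tmat) v = 0"
    then have "Re (qform ?I (mm ?I (adj ?C) ?C) v) + Re (qform ?I ?K v) = 0"
      unfolding restr_Tmat qform_add by (metis plus_complex.sel(1) zero_complex.sel(1))
    moreover have "0 \<le> Re (qform ?I ?K v)"
      using psd_Kmat[of n] by (simp add: psd_def)
    ultimately have "(\<Sum>a\<in>?I. (norm (\<Sum>x\<in>?I. ?C a x * v x))\<^sup>2) \<le> 0"
      unfolding C by simp
    then have "(\<Sum>a\<in>?I. (norm (\<Sum>x\<in>?I. ?C a x * v x))\<^sup>2) = 0"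
      by (intro antisym sum_nonneg) auto
    then have Cv: "(\<Sum>x\<in>?I. ?C a x * v x) = 0" if "a \<in> ?I" for a
      using that by (subst (asm) sum_nonneg_eq_0_iff) auto
    have "v e = 0" if e: "e \<in> ?I" for e
    proof -
      have "v e = (\<Sum>x\<in>?I. if x = e then v e else 0)"
        using e by simp
      also have "\<dots> = (\<Sum>x\<in>?I. idm ?I e x * v x)"
        using e by (intro sum.cong) (auto simp: idm_def)
      also have "\<dots> = (\<Sum>x\<in>?I. \<Sum>a\<in>?I. ?L e a * ?C a x * v x)"
        unfolding LC[symmetric] by (simp add: mm_def sum_distrib_right)
      also have "\<dots> = (\<Sum>a\<in>?I. ?L e a * (\<Sum>x\<in>?I. ?C a x * v x))"
        by (subst sum.swap) (simp add: sum_distrib_left mult.assoc)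
      also have "\<dots> = 0" using Cv by simp
      finally show ?thesis .
    qed
    with v show False by blast
  qed
  moreover have "adj (corner n Tmat) = corner n Tmat"
    unfolding restr_Tmat by (simp add: adj_add adj_mm adj_restr adj_Kmat)
  ultimately show ?thesis
    using pos_def_inverse_exists[of ?I "corner n Tmat"] by auto
qed

lemma inverse_entry_bound:
  assumes B: "mm (block_index n) (corner n Tmat) (corner n B) = idm (block_index n)"
     "mm (block_index n) (corner n B) (corner n Tmat) = idm (block_index n)"
    and st: "s \<in> {1..n}" "t \<in> {1..n}"
  shows "norm (B (s, \<alpha>) (t, \<beta>) - Smat (s, \<alpha>) (t, \<beta>)) \<le> Q * dist_bound d n s * dist_bound d n t"
proof -
  let ?I = "block_index n :: (nat \<times> 'q) set"
  have ab: "(s, \<alpha>) \<in> ?I" "(t, \<beta>) \<in> ?I" using st by (auto simp: block_index_def)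
  have Sh: "adj (corner n Smat) = corner n Smat"
    unfolding restr_Smat by (simp add: adj_mm)
  have diag: "Re (mm ?I (mm ?I (corner n Smat) (corner n (Kmat n))) (corner n Smat) (r, \<gamma>) (r, \<gamma>)) \<le> Q * (dist_bound d n r)\<^sup>2"
    if "r \<in> {1..n}" for r \<gamma>
  proof -
    have "qform ?I (Kmat n) (\<lambda>x. corner n Smat x (r, \<gamma>)) = qform ?I (Kmat n) (\<lambda>x. Smat x (r, \<gamma>))"
      unfolding qform_def using that by (intro sum.cong refl) (auto simp: block_index_def)
    then show ?thesis using diag_bound[OF that, of \<gamma>] by (simp add: mm_mm_self_adj[OF Sh] qform_restr)
  qed
  have "(norm (corner n Smat (s, \<alpha>) (t, \<beta>) - corner n B (s, \<alpha>) (t, \<beta>)))\<^sup>2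
      \<le> Re (mm ?I (mm ?I (corner n Smat) (corner n (Kmat n))) (corner n Smat) (s, \<alpha>) (s, \<alpha>))
        * Re (mm ?I (mm ?I (corner n Smat) (corner n (Kmat n))) (corner n Smat) (t, \<beta>) (t, \<beta>))"
  proof (rule psd_inverse_diff_entry_le[where I = ?I and T = "corner n Tmat" and B = "corner n B"
        and C = "corner n (lower_toeplitz c)" and L = "corner n (lower_toeplitz b)"
        and S = "corner n Smat" and K = "corner n (Kmat n)"])
    show "mm ?I (corner n (lower_toeplitz c)) (corner n (lower_toeplitz b)) = idm ?I"
      by (rule mm_lower_toeplitz_inverse) (rule cb)
    show "mm ?I (corner n (lower_toeplitz b)) (corner n (lower_toeplitz c)) = idm ?I"
      by (rule mm_lower_toeplitz_inverse) (rule bc)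
    show "mm ?I (corner n Tmat) (corner n B) = idm ?I" "mm ?I (corner n B) (corner n Tmat) = idm ?I"
      by (rule B)+
    show "corner n Smat = mm ?I (corner n (lower_toeplitz b)) (adj (corner n (lower_toeplitz b)))"
      by (rule restr_Smat)
    show "corner n Tmat = mm ?I (adj (corner n (lower_toeplitz c))) (corner n (lower_toeplitz c)) + corner n (Kmat n)"
      by (rule restr_Tmat)
    show "psd ?I (corner n (Kmat n))" by (rule psd_Kmat)
    show "(s, \<alpha>) \<in> ?I" "(t, \<beta>) \<in> ?I" by (rule ab)+
  qed simp_all
  also have "\<dots> \<le> (Q * (dist_bound d n s)\<^sup>2) * (Q * (dist_bound d n t)\<^sup>2)"
  proof (intro mult_mono diag st)
    show "0 \<le> Re (mm ?I (mm ?I (corner n Smat) (corner n (Kmat n))) (corner n Smat) (t, \<beta>) (t, \<beta>))"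
      using psd_Kmat[of n] by (simp add: mm_mm_self_adj[OF Sh] psd_def)
  qed (simp add: Q_nonneg)
  also have "\<dots> = (Q * dist_bound d n s * dist_bound d n t)\<^sup>2"
    by (simp add: power2_eq_square mult_ac)
  finally have "norm (corner n Smat (s, \<alpha>) (t, \<beta>) - corner n B (s, \<alpha>) (t, \<beta>)) \<le> Q * dist_bound d n s * dist_bound d n t"
    by (rule power2_le_imp_le) (simp add: Q_nonneg dist_bound_nonneg)
  then have "norm (Smat (s, \<alpha>) (t, \<beta>) - B (s, \<alpha>) (t, \<beta>)) \<le> Q * dist_bound d n s * dist_bound d n t"
    using ab by simp
  then show ?thesis by (simp add: norm_minus_commute)
qed

end

section \<open>Parseval identity on the unit circle\<close>

lemma binom_fps_sums:
  assumes "norm z < 1"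
  shows "(\<lambda>n. fps_nth (binom_fps \<alpha>) n * z ^ n) sums ((1 - z) powr of_real \<alpha>)"
  using gen_binomial_complex[of "- z" "of_real \<alpha>"] assms
  by (simp add: binom_fps_def power_minus[of z] mult_ac)

lemma conv_radius_binom_fps: "1 \<le> fps_conv_radius (binom_fps \<alpha>)"
  unfolding fps_conv_radius_def
proof (rule conv_radius_geI_ex)
  fix r :: real assume "0 < r" "ereal r < 1"
  then show "\<exists>z. norm z = r \<and> summable (\<lambda>n. fps_nth (binom_fps \<alpha>) n * z ^ n)"
    using binom_fps_sums[of "of_real r" \<alpha>] by (intro exI[of _ "of_real r"]) (auto simp: sums_iff)
qed

lemma eval_fps_binom: "norm z < 1 \<Longrightarrow> eval_fps (binom_fps \<alpha>) z = (1 - z) powr of_real \<alpha>"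
  using binom_fps_sums[of z \<alpha>] by (simp add: eval_fps_def sums_iff)

lemma conv_radius_binom_fps_mult:
  assumes "1 < fps_conv_radius A" shows "1 \<le> fps_conv_radius (binom_fps \<alpha> * A)"
  using conv_radius_binom_fps[of \<alpha>] assms fps_conv_radius_mult[of "binom_fps \<alpha>" A]
  by (meson less_imp_le min.boundedI order.trans)

lemma eval_fps_binom_mult:
  assumes "norm z < 1" "1 < fps_conv_radius A"
  shows "eval_fps (binom_fps \<alpha> * A) z = (1 - z) powr of_real \<alpha> * eval_fps A z"
proof -
  have z: "ereal (norm z) < 1" using assms by simp
  have "ereal (norm z) < fps_conv_radius A" "ereal (norm z) < fps_conv_radius (binom_fps \<alpha>)"
    by (rule less_trans[OF z assms(2)], rule less_le_trans[OF z conv_radius_binom_fps])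
  then show ?thesis
    using assms(1) by (simp add: eval_fps_mult eval_fps_binom)
qed

text \<open>Removing the point 0 does not change integrals, and the weight is continuous on the rest.\<close>

abbreviation circ :: "real measure" where
  "circ \<equiv> restrict_space lborel ({-pi..pi} - {0})"

lemma space_circ: "space circ = {-pi..pi} - {0}"
  by (simp add: space_restrict_space)

lemma set_integral_eq_circ:
  fixes f :: "real \<Rightarrow> complex"
  shows "(LBINT \<theta>:{-pi..pi}. f \<theta>) = integral\<^sup>L circ f"
proof -
  have "(LBINT \<theta>:{-pi..pi}. f \<theta>) = (LBINT \<theta>:{-pi..pi} - {0}. f \<theta>)"
    by (rule set_integral_discrete_difference[where X = "{0}"]) auto
  then show ?thesis
    by (simp add: integral_restrict_space set_lebesgue_integral_def)
qed

lemma finite_measure_circ: "finite_measure circ"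
proof
  have "emeasure lborel ({-pi..pi} - {0}) \<le> emeasure lborel {-pi..pi}"
    by (rule emeasure_mono) auto
  also have "\<dots> < \<infinity>" by simp
  finally show "emeasure circ (space circ) \<noteq> \<infinity>"
    by (simp add: space_circ emeasure_restrict_space)
qed

lemma measurable_circ: "f \<in> borel_measurable borel \<Longrightarrow> f \<in> borel_measurable circ"
  by (intro measurable_restrict_space1) simp

lemma integrable_circ_bounded:
  fixes f :: "real \<Rightarrow> complex"
  assumes "f \<in> borel_measurable circ" "\<And>\<theta>. norm (f \<theta>) \<le> C"
  shows "integrable circ f"
  using finite_measure.integrable_const_bound[OF finite_measure_circ _ assms(1), of C] assms(2) by simp

lemma integral_cis: "(\<integral>\<theta>. cis (of_int k * \<theta>) \<partial>circ) = (if k = 0 then 2 * pi else 0)"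
proof -
  have "(\<integral>\<theta>. cis (of_int k * \<theta>) \<partial>circ) = integral\<^sup>L lborel (\<lambda>\<theta>. indicator {-pi..pi} \<theta> *\<^sub>R cis (of_int k * \<theta>))"
    unfolding set_integral_eq_circ[symmetric] set_lebesgue_integral_def ..
  also have "\<dots> = (if k = 0 then 2 * pi else 0)"
  proof (cases "k = 0")
    case False
    let ?F = "\<lambda>\<theta>. cis (of_int k * \<theta>) / (\<i> * of_int k)"
    have "integral\<^sup>L lborel (\<lambda>\<theta>. indicator {-pi..pi} \<theta> *\<^sub>R cis (of_int k * \<theta>)) = ?F pi - ?F (-pi)"
    proof (rule integral_FTC_atLeastAtMost)
      fix x :: real
      have "((\<lambda>\<theta>. exp (\<i> * of_int k * of_real \<theta>) / (\<i> * of_int k)) has_vector_derivative exp (\<i> * of_int k * of_real x)) (at x within {-pi..pi})"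
        using False
        by (intro has_vector_derivative_real_field) (auto intro!: derivative_eq_intros)
      then show "(?F has_vector_derivative cis (of_int k * x)) (at x within {-pi..pi})"
        by (simp add: cis_conv_exp mult_ac)
    qed (auto intro!: continuous_intros)
    also have "cis (of_int k * pi) = cis (of_int k * (- pi))"
    proof -
      have "cis (of_int k * pi) = cis (of_int k * (- pi) + 2 * pi * of_int k)" by (simp add: algebra_simps)
      also have "\<dots> = cis (of_int k * (- pi))" by (simp only: cis_mult[symmetric] cis_multiple_2pi[OF Ints_of_int] mult_1_right)
      finally show ?thesis .
    qed
    finally show ?thesis using False by simp
  qed (simp add: scaleR_conv_of_real)
  finally show ?thesis .
qed

section \<open>Parseval for absolutely convergent Fourier series\<close>

lemma norm_suminf_mult_cis_le:
  assumes "summable (\<lambda>v. norm (e v))"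
  shows "norm (\<Sum>v. e v * cis (real v * \<theta>)) \<le> (\<Sum>v. norm (e v))"
  using summable_norm[of "\<lambda>v. e v * cis (real v * \<theta>)"] assms by (simp add: norm_mult)

lemma measurable_suminf_cis:
  "(\<lambda>\<theta>. \<Sum>v. e v * cis (real v * \<theta>)) \<in> borel_measurable circ"
  by (intro borel_measurable_suminf measurable_circ borel_measurable_continuous_onI continuous_intros)

lemma integral_mult_fourier_series:
  assumes meas: "\<phi> \<in> borel_measurable circ" and bd: "\<And>\<theta>. norm (\<phi> \<theta>) \<le> C"
    and e: "summable (\<lambda>v. norm (e v))"
  shows "(\<lambda>v. e v * (\<integral>\<theta>. \<phi> \<theta> * cis (real v * \<theta>) \<partial>circ))
    sums (\<integral>\<theta>. \<phi> \<theta> * (\<Sum>v. e v * cis (real v * \<theta>)) \<partial>circ)"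
proof -
  let ?f = "\<lambda>v \<theta>. e v * (\<phi> \<theta> * cis (real v * \<theta>))"
  have m: "(\<lambda>\<theta>. \<phi> \<theta> * cis (real v * \<theta>)) \<in> borel_measurable circ" for v
    by (intro borel_measurable_times meas measurable_circ borel_measurable_continuous_onI continuous_intros)
  have int: "integrable circ (?f v)" for v
    using bd by (intro integrable_mult_right integrable_circ_bounded[OF m, of _ C]) (simp add: norm_mult)
  have sm: "summable (\<lambda>v. norm (?f v \<theta>))" for \<theta>
    using summable_mult2[OF e, of "norm (\<phi> \<theta>)"] by (simp add: norm_mult)
  have "summable (\<lambda>v. \<integral>\<theta>. norm (?f v \<theta>) \<partial>circ)"
  proof (rule summable_comparison_test'[where N = 0])
    show "summable (\<lambda>v. norm (e v) * (C * measure circ (space circ)))"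
      by (rule summable_mult2[OF e])
    fix v
    have "(\<integral>\<theta>. norm (?f v \<theta>) \<partial>circ) \<le> (\<integral>\<theta>. norm (e v) * C \<partial>circ)"
      using bd finite_measure.integrable_const[OF finite_measure_circ]
      by (intro integral_mono integrable_norm int) (auto simp: norm_mult intro!: mult_left_mono)
    then show "norm (\<integral>\<theta>. norm (?f v \<theta>) \<partial>circ) \<le> norm (e v) * (C * measure circ (space circ))"
      by (simp add: mult_ac)
  qed
  from sums_integral[OF int _ this] sm
  have "(\<lambda>v. \<integral>\<theta>. ?f v \<theta> \<partial>circ) sums (\<integral>\<theta>. (\<Sum>v. ?f v \<theta>) \<partial>circ)" by auto
  moreover have "(\<Sum>v. ?f v \<theta>) = \<phi> \<theta> * (\<Sum>v. e v * cis (real v * \<theta>))" for \<theta>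
  proof -
    have "summable (\<lambda>v. e v * cis (real v * \<theta>))"
      using e by (intro summable_norm_cancel[of "\<lambda>v. e v * cis (real v * \<theta>)"]) (simp add: norm_mult)
    then show ?thesis by (simp add: suminf_mult[symmetric] mult_ac)
  qed
  ultimately show ?thesis by simp
qed

text \<open>Two termwise integrations: against an exponential, to find the Fourier coefficients of
  the first series, and then of the second series against the conjugate of the first.\<close>

lemma parseval_summable:
  assumes a: "summable (\<lambda>v. norm (a v))" and e: "summable (\<lambda>v. norm (e v))"
  shows "(\<lambda>v. cnj (a v) * e v)
    sums ((\<integral>\<theta>. cnj (\<Sum>v. a v * cis (real v * \<theta>)) * (\<Sum>v. e v * cis (real v * \<theta>)) \<partial>circ) / (2 * pi))"
proof -
  let ?A = "\<lambda>\<theta>. \<Sum>v. a v * cis (real v * \<theta>)"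
  have "(\<integral>\<theta>. cnj (?A \<theta>) * cis (real v * \<theta>) \<partial>circ) = 2 * pi * cnj (a v)" for v
  proof -
    have "(\<lambda>u. a u * (\<integral>\<theta>. cis (- real v * \<theta>) * cis (real u * \<theta>) \<partial>circ))
        sums (\<integral>\<theta>. cis (- real v * \<theta>) * ?A \<theta> \<partial>circ)"
      by (rule integral_mult_fourier_series[where C = 1, OF _ _ a])
        (auto intro!: measurable_circ borel_measurable_continuous_onI continuous_intros)
    moreover have "(\<integral>\<theta>. cis (- real v * \<theta>) * cis (real u * \<theta>) \<partial>circ) = (if u = v then 2 * pi else 0)" for u
    proof -
      have "cis (- real v * \<theta>) * cis (real u * \<theta>) = cis (of_int (int u - int v) * \<theta>)" for \<theta>
        by (simp add: cis_mult algebra_simps)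
      then show ?thesis using integral_cis[of "int u - int v"] by simp
    qed
    ultimately have "(\<lambda>u. a u * (if u = v then 2 * pi else 0)) sums (\<integral>\<theta>. cis (- real v * \<theta>) * ?A \<theta> \<partial>circ)"
      by (simp only:)
    moreover have "(\<lambda>u. a u * (if u = v then 2 * pi else 0)) = (\<lambda>u. if u = v then a v * (2 * pi) else 0)"
      by auto
    ultimately have "(\<lambda>u. if u = v then a v * (2 * pi) else 0) sums (\<integral>\<theta>. cis (- real v * \<theta>) * ?A \<theta> \<partial>circ)"
      by (simp only:)
    then have "(\<integral>\<theta>. cis (- real v * \<theta>) * ?A \<theta> \<partial>circ) = a v * (2 * pi)"
      using sums_single[of v "\<lambda>_. a v * (2 * pi)"] sums_unique2 by blast
    then have "cnj (\<integral>\<theta>. cis (- real v * \<theta>) * ?A \<theta> \<partial>circ) = cnj (a v * (2 * pi))" by simp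
    moreover have "(\<integral>\<theta>. cnj (?A \<theta>) * cis (real v * \<theta>) \<partial>circ) = (\<integral>\<theta>. cnj (cis (- real v * \<theta>) * ?A \<theta>) \<partial>circ)"
      by (simp add: cis_cnj mult.commute del: Bochner_Integration.integral_cnj)
    moreover have "(\<integral>\<theta>. cnj (cis (- real v * \<theta>) * ?A \<theta>) \<partial>circ) = cnj (\<integral>\<theta>. cis (- real v * \<theta>) * ?A \<theta> \<partial>circ)"
      by (rule Bochner_Integration.integral_cnj)
    ultimately have "(\<integral>\<theta>. cnj (?A \<theta>) * cis (real v * \<theta>) \<partial>circ) = cnj (a v * (2 * pi))"
      by (simp only:)
    then show ?thesis by simp
  qed
  moreover have "(\<lambda>v. e v * (\<integral>\<theta>. cnj (?A \<theta>) * cis (real v * \<theta>) \<partial>circ)) sums (\<integral>\<theta>. cnj (?A \<theta>) * (\<Sum>v. e v * cis (real v * \<theta>)) \<partial>circ)"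
    by (rule integral_mult_fourier_series[where C = "\<Sum>v. norm (a v)", OF _ _ e])
      (auto intro!: norm_suminf_mult_cis_le a borel_measurable_continuous_on[of cnj] measurable_suminf_cis continuous_intros)
  ultimately have "(\<lambda>v. 2 * pi * (cnj (a v) * e v)) sums (\<integral>\<theta>. cnj (?A \<theta>) * (\<Sum>v. e v * cis (real v * \<theta>)) \<partial>circ)"
    by (simp add: mult_ac)
  from sums_divide[OF this, of "2 * pi"] show ?thesis by simp
qed

text \<open>The factor r^u makes the coefficients absolutely summable; without it they need not
  be.\<close>

lemma parseval_interior:
  assumes r: "0 \<le> r" "r < 1" and "1 \<le> fps_conv_radius F" "1 \<le> fps_conv_radius G"
  shows "(\<lambda>u. cnj (fps_nth F u) * fps_nth G u * of_real r ^ (2 * u))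
    sums ((\<integral>\<theta>. cnj (eval_fps F (of_real r * cis \<theta>)) * eval_fps G (of_real r * cis \<theta>) \<partial>circ) / (2 * pi))"
proof -
  have ev: "eval_fps F (of_real r * cis \<theta>) = (\<Sum>v. fps_nth F v * of_real r ^ v * cis (real v * \<theta>))" for F \<theta>
    by (simp add: eval_fps_def power_mult_distrib Complex.DeMoivre mult_ac)
  have sm: "summable (\<lambda>v. norm (fps_nth F v * of_real r ^ v))" if "1 \<le> fps_conv_radius F" for F
    using r that by (intro norm_summable_fps) (auto intro: less_le_trans[of _ 1])
  show ?thesis
    using parseval_summable[OF sm[OF assms(3)] sm[OF assms(4)]]
    unfolding ev by (simp add: power_mult power2_eq_square power_mult_distrib mult_ac)
qed


definition radius_seq :: "nat \<Rightarrow> real" where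
  "radius_seq n = 1 - inverse (real (Suc n))"

abbreviation radial :: "nat \<Rightarrow> real \<Rightarrow> complex" where
  "radial n \<theta> \<equiv> of_real (radius_seq n) * cis \<theta>"

section \<open>Radial limits at the unit circle\<close>

lemma radius_seq: "0 \<le> radius_seq n" "radius_seq n < 1"
  by (auto simp: radius_seq_def inverse_le_1_iff)

lemma LIMSEQ_radius_seq: "radius_seq \<longlonglongrightarrow> 1"
  using LIMSEQ_inverse_real_of_nat_add_minus[of 1] by (simp add: radius_seq_def[abs_def])

lemma cis_neq_1:
  assumes "\<theta> \<in> space circ" shows "cis \<theta> \<noteq> 1"
proof
  assume 1: "cis \<theta> = 1"
  show False
  proof (cases "\<theta> = - pi")
    case False
    then have "Arg (cis \<theta>) = \<theta>" using assms by (intro Arg_cis) (auto simp: space_circ)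
    then show False using 1 assms by (auto simp: space_circ)
  next
    case True
    then show False using arg_cong[OF 1, of Re] by simp
  qed
qed

text \<open>Away from the branch cut the principal power is continuous, so its radial limits
  exist.\<close>

lemma one_minus_cis_not_nonpos:
  assumes "\<theta> \<in> space circ" shows "1 - cis \<theta> \<notin> \<real>\<^sub>\<le>\<^sub>0"
proof
  assume *: "1 - cis \<theta> \<in> \<real>\<^sub>\<le>\<^sub>0"
  then have "cos \<theta> = 1"
    using cos_le_one[of \<theta>] by (auto simp: complex_nonpos_Reals_iff)
  moreover have "sin \<theta> = 0" using * by (auto simp: complex_nonpos_Reals_iff)
  ultimately show False using cis_neq_1[OF assms] by (simp add: complex_eq_iff)
qed

text \<open>Since 1 - r is at most the distance from 1 to the point of radius r, moving that point
  to the circle at most doubles the distance to 1. This gives one integrable majorant for all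
  radii.\<close>

lemma norm_one_minus_cis_le:
  assumes "0 \<le> r" "r \<le> 1" shows "norm (1 - cis \<theta>) \<le> 2 * norm (1 - of_real r * cis \<theta>)"
proof -
  have "norm (1 - cis \<theta>) = norm ((1 - of_real r * cis \<theta>) - (1 - of_real r) * cis \<theta>)"
    by (simp add: algebra_simps)
  also have "\<dots> \<le> norm (1 - of_real r * cis \<theta>) + norm ((1 - of_real r) * cis \<theta>)"
    by (rule norm_triangle_ineq4)
  also have "norm ((1 - of_real r) * cis \<theta>) = 1 - r"
  proof -
    have "1 - complex_of_real r = of_real (1 - r)" by simp
    then have "norm ((1 - of_real r) * cis \<theta>) = \<bar>1 - r\<bar>" by (simp only: norm_mult norm_of_real norm_cis mult_1_right)
    then show ?thesis using assms by simp
  qed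
  also have "1 - r \<le> norm (1 - of_real r * cis \<theta>)"
    using norm_triangle_ineq2[of 1 "of_real r * cis \<theta>"] assms by (simp add: norm_mult)
  finally show ?thesis by simp
qed

lemma continuous_on_eval_fps_circle:
  assumes "ereal \<bar>r\<bar> < fps_conv_radius F"
  shows "continuous_on UNIV (\<lambda>\<theta>. eval_fps F (of_real r * cis \<theta>))"
  by (rule continuous_on_compose2[OF continuous_on_eval_fps[of F]])
    (use assms in \<open>auto intro!: continuous_intros simp: norm_mult\<close>)

lemma measurable_eval_fps_circle:
  assumes "0 \<le> r" "r < 1" "1 \<le> fps_conv_radius F"
  shows "(\<lambda>\<theta>. eval_fps F (of_real r * cis \<theta>)) \<in> borel_measurable circ"
  using assms by (intro measurable_circ borel_measurable_continuous_onI continuous_on_eval_fps_circle)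
    (auto intro: less_le_trans[of _ 1])

lemma eval_fps_circle_bounded:
  fixes A :: "complex fps"
  assumes "1 < fps_conv_radius A"
  shows "\<exists>C. \<forall>z\<in>cball 0 1. norm (eval_fps A z) \<le> C"
proof -
  have sub: "cball (0::complex) 1 \<subseteq> eball 0 (fps_conv_radius A)"
  proof
    fix z :: complex assume "z \<in> cball 0 1"
    then have "ereal (norm z) \<le> 1" by simp
    from le_less_trans[OF this assms] show "z \<in> eball 0 (fps_conv_radius A)" by simp
  qed
  have "continuous_on (cball 0 1) (eval_fps A)"
    using continuous_on_eval_fps sub by (rule continuous_on_subset)
  then have "compact (eval_fps A ` cball 0 1)"
    by (rule compact_continuous_image) (rule compact_cball)
  then have "bounded (eval_fps A ` cball 0 1)" by (rule compact_imp_bounded)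
  then show ?thesis by (auto simp: bounded_iff)
qed

lemma LIMSEQ_eval_fps_circle:
  assumes "1 < fps_conv_radius A" "\<theta> \<in> space circ"
  shows "(\<lambda>n. eval_fps (binom_fps \<alpha> * A) (radial n \<theta>))
    \<longlonglongrightarrow> (1 - cis \<theta>) powr of_real \<alpha> * eval_fps A (cis \<theta>)"
proof -
  have r: "(\<lambda>n. radial n \<theta>) \<longlonglongrightarrow> cis \<theta>"
  proof -
    have "(\<lambda>n. radial n \<theta>) \<longlonglongrightarrow> of_real 1 * cis \<theta>"
      by (intro tendsto_intros LIMSEQ_radius_seq)
    then show ?thesis by simp
  qed
  have "isCont (eval_fps A) (cis \<theta>)"
    using assms(1) by (intro continuous_eval_fps) (simp add: one_ereal_def)
  then have "(\<lambda>n. eval_fps A (radial n \<theta>)) \<longlonglongrightarrow> eval_fps A (cis \<theta>)"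
    by (rule isCont_tendsto_compose) (rule r)
  moreover have "(\<lambda>n. (1 - radial n \<theta>) powr of_real \<alpha>) \<longlonglongrightarrow> (1 - cis \<theta>) powr of_real \<alpha>"
    by (intro tendsto_powr_complex tendsto_diff tendsto_const r one_minus_cis_not_nonpos assms)
  ultimately have "(\<lambda>n. (1 - radial n \<theta>) powr of_real \<alpha> * eval_fps A (radial n \<theta>))
    \<longlonglongrightarrow> (1 - cis \<theta>) powr of_real \<alpha> * eval_fps A (cis \<theta>)"
    by (intro tendsto_mult)
  moreover have "norm (radial n \<theta>) < 1" for n
    using radius_seq[of n] by (simp add: norm_mult)
  ultimately show ?thesis
    by (simp add: eval_fps_binom_mult[OF _ assms(1)])
qed

lemma norm_powr_of_real: "norm (z powr complex_of_real \<alpha>) = norm z powr \<alpha>"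
  using norm_powr_real_powr'[of "of_real \<alpha>" z] by simp

lemma summable_binom_fps_products:
  assumes "d < 1 / 2" "1 < fps_conv_radius A" "1 < fps_conv_radius B"
  shows "summable (\<lambda>u. norm (cnj (fps_nth (binom_fps (- d) * A) u) * fps_nth (binom_fps (- d) * B) u))"
proof -
  obtain K L where K: "\<And>k. norm (fps_nth (binom_fps (- d) * A) k) \<le> K * (real k + 1) powr (d - 1)"
    and L: "\<And>k. norm (fps_nth (binom_fps (- d) * B) k) \<le> L * (real k + 1) powr (d - 1)"
    using norm_binom_fps_mult_nth_le[OF assms(2), of "- d"] norm_binom_fps_mult_nth_le[OF assms(3), of "- d"] by auto
  show ?thesis
  proof (rule summable_comparison_test'[where N = 0])
    show "summable (\<lambda>u. (K * L) * real (Suc u) powr (2 * d - 2))"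
      using assms(1) by (intro summable_mult) (subst summable_Suc_iff, simp add: summable_real_powr_iff)
    fix u
    have "norm (cnj (fps_nth (binom_fps (- d) * A) u) * fps_nth (binom_fps (- d) * B) u)
        \<le> (K * (real u + 1) powr (d - 1)) * (L * (real u + 1) powr (d - 1))"
      unfolding norm_mult complex_mod_cnj
      using order.trans[OF norm_ge_zero K] by (intro mult_mono K L) auto
    also have "\<dots> = (K * L) * real (Suc u) powr (2 * d - 2)"
      by (simp add: powr_add[symmetric] add.commute mult_ac)
    finally show "norm (norm (cnj (fps_nth (binom_fps (- d) * A) u) * fps_nth (binom_fps (- d) * B) u))
        \<le> (K * L) * real (Suc u) powr (2 * d - 2)" by simp
  qed
qed

text \<open>Integrability of the weight is read off from the interior Parseval identity by Fatou's lemma.\<close>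

lemma integrable_weight:
  assumes "d < 1 / 2"
  shows "integrable circ (\<lambda>\<theta>. norm (1 - cis \<theta>) powr (- 2 * d))"
proof -
  let ?F = "binom_fps (- d)"
  let ?u = "\<lambda>n \<theta>. norm (eval_fps ?F (radial n \<theta>)) ^ 2"
  let ?h = "\<lambda>u. norm (cnj (fps_nth ?F u) * fps_nth ?F u)"
  have r1: "1 < fps_conv_radius (1 :: complex fps)" by simp
  have sh: "summable ?h" using summable_binom_fps_products[OF assms r1 r1] by simp
  have meas: "?u n \<in> borel_measurable circ" for n
  proof -
    have [measurable]: "(\<lambda>\<theta>. eval_fps ?F (radial n \<theta>)) \<in> borel_measurable circ"
      by (intro measurable_eval_fps_circle radius_seq conv_radius_binom_fps)
    show ?thesis by measurable
  qed
  have lim: "(\<lambda>n. ?u n \<theta>) \<longlonglongrightarrow> norm (1 - cis \<theta>) powr (- 2 * d)" if "\<theta> \<in> space circ" for \<theta>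
  proof -
    have "(\<lambda>n. ?u n \<theta>) \<longlonglongrightarrow> (norm ((1 - cis \<theta>) powr of_real (- d)))\<^sup>2"
      using LIMSEQ_eval_fps_circle[OF r1 that, of "- d"] by (intro tendsto_power tendsto_norm) simp
    also have "(norm ((1 - cis \<theta>) powr of_real (- d)))\<^sup>2 = norm (1 - cis \<theta>) powr (- 2 * d)"
      unfolding norm_powr_of_real power2_eq_square powr_add[symmetric] by simp
    finally show ?thesis .
  qed
  have bound: "(\<integral>\<^sup>+\<theta>. ennreal (?u n \<theta>) \<partial>circ) \<le> ennreal (2 * pi * suminf ?h)" for n
  proof -
    let ?r = "radius_seq n"
    have "1 \<le> fps_conv_radius ?F" by (rule conv_radius_binom_fps)
    note pars = parseval_interior[OF radius_seq(1,2)[of n] this this]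
    have eq: "cnj z * z = of_real ((norm z)\<^sup>2)" for z :: complex
      by (simp only: complex_norm_square mult.commute)
    have int_of_real: "(\<integral>\<theta>. of_real (?u n \<theta>) \<partial>circ) = complex_of_real (integral\<^sup>L circ (?u n))"
      by (rule integral_complex_of_real)
    have "continuous_on UNIV (?u n)"
      using radius_seq[of n] conv_radius_binom_fps[of "- d"]
      by (intro continuous_intros continuous_on_eval_fps_circle) (auto intro: less_le_trans[of _ 1])
    then have "set_integrable lborel {-pi..pi} (?u n)"
      by (rule borel_integrable_atLeastAtMost'[OF continuous_on_subset]) simp
    then have "set_integrable lborel ({-pi..pi} - {0}) (?u n)"
      by (rule set_integrable_subset) auto
    then have int: "integrable circ (?u n)"
      by (simp add: set_integrable_def integrable_restrict_space)
    have "(\<lambda>u. of_real (?h u * ?r ^ (2 * u))) sums (of_real (integral\<^sup>L circ (?u n) / (2 * pi)) :: complex)"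
      using pars unfolding eq int_of_real by (simp add: norm_power)
    then have s: "(\<lambda>u. ?h u * ?r ^ (2 * u)) sums (integral\<^sup>L circ (?u n) / (2 * pi))"
      by (simp only: sums_of_real_iff)
    have "integral\<^sup>L circ (?u n) / (2 * pi) \<le> suminf ?h"
    proof (rule sums_le[OF _ s summable_sums[OF sh]])
      fix u show "?h u * ?r ^ (2 * u) \<le> ?h u"
        using radius_seq[of n] by (intro mult_right_le_one_le power_le_one) auto
    qed
    then have "integral\<^sup>L circ (?u n) \<le> 2 * pi * suminf ?h"
      by (simp add: field_simps)
    then show ?thesis
      by (subst nn_integral_eq_integral[OF int]) (auto intro: ennreal_leI)
  qed
  have "(\<integral>\<^sup>+\<theta>. ennreal (norm (1 - cis \<theta>) powr (- 2 * d)) \<partial>circ) = (\<integral>\<^sup>+\<theta>. liminf (\<lambda>n. ennreal (?u n \<theta>)) \<partial>circ)"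
  proof (rule nn_integral_cong)
    fix \<theta> assume "\<theta> \<in> space circ"
    then have "(\<lambda>n. ennreal (?u n \<theta>)) \<longlonglongrightarrow> ennreal (norm (1 - cis \<theta>) powr (- 2 * d))"
      by (intro tendsto_ennrealI lim)
    then show "ennreal (norm (1 - cis \<theta>) powr (- 2 * d)) = liminf (\<lambda>n. ennreal (?u n \<theta>))"
      by (intro lim_imp_Liminf[symmetric]) auto
  qed
  also have "\<dots> \<le> liminf (\<lambda>n. \<integral>\<^sup>+\<theta>. ennreal (?u n \<theta>) \<partial>circ)"
    by (intro nn_integral_liminf measurable_compose[OF meas measurable_ennreal])
  also have "\<dots> \<le> ennreal (2 * pi * suminf ?h)"
    by (rule order.trans[OF Liminf_le_Limsup[OF sequentially_bot]])
      (rule Limsup_bounded, rule always_eventually, rule allI, rule bound)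
  also have "\<dots> < \<infinity>" by simp
  finally show ?thesis
    using borel_measurable_LIMSEQ_metric[OF meas lim] by (intro integrableI_nonneg) auto
qed

text \<open>The radius tends to 1 in \<open>parseval_interior\<close>. The integrals converge by
  domination with a multiple of the singular weight, the series by Tannery's theorem.\<close>

lemma
  assumes d: "0 < d" "d < 1 / 2" and A: "1 < fps_conv_radius A" and B: "1 < fps_conv_radius B"
  shows integrable_boundary: "integrable circ (\<lambda>\<theta>. of_real (norm (1 - cis \<theta>) powr (- 2 * d)) * cnj (eval_fps A (cis \<theta>)) * eval_fps B (cis \<theta>))"
    and parseval_boundary: "(\<lambda>u. cnj (fps_nth (binom_fps (- d) * A) u) * fps_nth (binom_fps (- d) * B) u) sums
    ((\<integral>\<theta>. of_real (norm (1 - cis \<theta>) powr (- 2 * d)) * cnj (eval_fps A (cis \<theta>)) * eval_fps B (cis \<theta>) \<partial>circ) / (2 * pi))"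
proof -
  let ?F = "binom_fps (- d) * A" and ?G = "binom_fps (- d) * B"
  let ?h = "\<lambda>u. cnj (fps_nth ?F u) * fps_nth ?G u"
  let ?s = "\<lambda>n \<theta>. cnj (eval_fps ?F (radial n \<theta>)) * eval_fps ?G (radial n \<theta>)"
  let ?f = "\<lambda>\<theta>. of_real (norm (1 - cis \<theta>) powr (- 2 * d)) * cnj (eval_fps A (cis \<theta>)) * eval_fps B (cis \<theta>)"
  have sh: "summable (\<lambda>u. norm (?h u))" by (rule summable_binom_fps_products[OF d(2) A B])
  obtain CA CB where CA: "\<And>z. norm z \<le> 1 \<Longrightarrow> norm (eval_fps A z) \<le> CA" and CB: "\<And>z. norm z \<le> 1 \<Longrightarrow> norm (eval_fps B z) \<le> CB"
    using eval_fps_circle_bounded[OF A] eval_fps_circle_bounded[OF B] by (metis mem_cball_0)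
  have C0: "0 \<le> CA" using order.trans[OF norm_ge_zero CA[of 0]] by simp
  have lim: "(\<lambda>n. ?s n \<theta>) \<longlonglongrightarrow> ?f \<theta>" if "\<theta> \<in> space circ" for \<theta>
  proof -
    let ?p = "(1 - cis \<theta>) powr of_real (- d)" and ?a = "eval_fps A (cis \<theta>)" and ?b = "eval_fps B (cis \<theta>)"
    have "(\<lambda>n. ?s n \<theta>) \<longlonglongrightarrow> cnj (?p * ?a) * (?p * ?b)"
      by (intro tendsto_mult tendsto_cnj LIMSEQ_eval_fps_circle A B that)
    also have "cnj (?p * ?a) * (?p * ?b) = (?p * cnj ?p) * cnj ?a * ?b"
      by (simp only: complex_cnj_mult mult_ac)
    also have "?p * cnj ?p = of_real (norm (1 - cis \<theta>) powr (- 2 * d))"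
      unfolding complex_norm_square[symmetric] norm_powr_of_real power2_eq_square of_real_mult[symmetric] powr_add[symmetric] by simp
    finally show ?thesis .
  qed
  have meas: "?s n \<in> borel_measurable circ" for n
  proof -
    have "continuous_on UNIV cnj" by (intro continuous_intros)
    then show ?thesis
      by (intro borel_measurable_times borel_measurable_continuous_on[of cnj] measurable_eval_fps_circle
          radius_seq conv_radius_binom_fps_mult A B)
  qed
  have meas_f: "?f \<in> borel_measurable circ" by (rule borel_measurable_LIMSEQ_metric[OF meas lim])
  have dom: "integrable circ (\<lambda>\<theta>. (2 powr (2 * d) * CA * CB) * norm (1 - cis \<theta>) powr (- 2 * d))"
    by (intro integrable_mult_right integrable_weight d)
  have AE_lim: "AE \<theta> in circ. (\<lambda>n. ?s n \<theta>) \<longlonglongrightarrow> ?f \<theta>" using lim by (intro AE_I2)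
  have AE_bound: "AE \<theta> in circ. norm (?s n \<theta>) \<le> (2 powr (2 * d) * CA * CB) * norm (1 - cis \<theta>) powr (- 2 * d)" for n
    proof (rule AE_I2)
      fix \<theta> assume th: "\<theta> \<in> space circ"
      let ?z = "radial n \<theta>"
      have z: "norm ?z < 1" using radius_seq[of n] by (simp add: norm_mult)
      have "norm (?s n \<theta>) = norm (1 - ?z) powr (- 2 * d) * (norm (eval_fps A ?z) * norm (eval_fps B ?z))"
        unfolding eval_fps_binom_mult[OF z A] eval_fps_binom_mult[OF z B] norm_mult complex_mod_cnj norm_powr_of_real
        by (simp add: powr_add[symmetric])
      also have "\<dots> \<le> (2 powr (2 * d) * norm (1 - cis \<theta>) powr (- 2 * d)) * (CA * CB)"
      proof (intro mult_mono CA CB)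
        have "0 < norm (1 - cis \<theta>)" using cis_neq_1[OF th] by simp
        \<comment> \<open>The exponent is negative, so the doubling in
          \<open>norm_one_minus_cis_le\<close> costs the factor 2^(2d).\<close>
        then have "norm (1 - ?z) powr (- 2 * d) \<le> (norm (1 - cis \<theta>) / 2) powr (- 2 * d)"
          using norm_one_minus_cis_le[of "radius_seq n" \<theta>] radius_seq[of n] d by (intro powr_mono2') auto
        also have "\<dots> = 2 powr (2 * d) * norm (1 - cis \<theta>) powr (- 2 * d)"
          by (simp add: powr_divide powr_minus field_simps)
        finally show "norm (1 - ?z) powr (- 2 * d) \<le> 2 powr (2 * d) * norm (1 - cis \<theta>) powr (- 2 * d)" .
      qed (use z C0 in auto)
      finally show "norm (?s n \<theta>) \<le> (2 powr (2 * d) * CA * CB) * norm (1 - cis \<theta>) powr (- 2 * d)"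
        by (simp only: mult_ac)
    qed
  show "integrable circ ?f"
    by (rule integrable_dominated_convergence[OF meas_f meas dom AE_lim AE_bound])
  have "(\<lambda>n. integral\<^sup>L circ (?s n)) \<longlonglongrightarrow> integral\<^sup>L circ ?f"
    by (rule integral_dominated_convergence[OF meas_f meas dom AE_lim AE_bound])
  then have 1: "(\<lambda>n. integral\<^sup>L circ (?s n) / (2 * pi)) \<longlonglongrightarrow> integral\<^sup>L circ ?f / (2 * pi)"
    by (intro tendsto_divide) auto
  have eq: "integral\<^sup>L circ (?s n) / (2 * pi) = (\<Sum>u. ?h u * of_real (radius_seq n) ^ (2 * u))" for n
    by (rule sums_unique[OF parseval_interior[OF radius_seq(1,2)]]) (intro conv_radius_binom_fps_mult A B)+
  have "(\<lambda>n. \<Sum>u. ?h u * of_real (radius_seq n) ^ (2 * u)) \<longlonglongrightarrow> suminf ?h"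
  proof -
    have "(\<lambda>n. ?h u * of_real (radius_seq n) ^ (2 * u)) \<longlonglongrightarrow> ?h u * of_real 1 ^ (2 * u)" for u
      by (intro tendsto_mult tendsto_power tendsto_const tendsto_of_real LIMSEQ_radius_seq)
    then have lim: "(\<lambda>n. ?h u * of_real (radius_seq n) ^ (2 * u)) \<longlonglongrightarrow> ?h u" for u by simp
    have "norm (?h u * of_real (radius_seq n) ^ (2 * u)) \<le> norm (?h u)" for u n
      unfolding norm_mult norm_power norm_of_real using radius_seq[of n]
      by (intro mult_right_le_one_le power_le_one) auto
    then have bd: "\<forall>\<^sub>F (u, n) in at_top \<times>\<^sub>F at_top. norm (?h u * of_real (radius_seq n) ^ (2 * u)) \<le> norm (?h u)"
      by (intro always_eventually) auto
    show ?thesis using tannerys_theorem[OF lim bd sh] by simp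
  qed
  then have "suminf ?h = integral\<^sup>L circ ?f / (2 * pi)"
    using 1 unfolding eq by (rule LIMSEQ_unique)
  then show "?h sums (integral\<^sup>L circ ?f / (2 * pi))"
    using summable_sums[OF summable_norm_cancel[OF sh]] by simp
qed

section \<open>Rational matrix functions\<close>

text \<open>By compactness a neighbourhood of the closed disk contains a larger concentric disk, on
  which the Taylor series at 0 converges.\<close>

lemma analytic_fps:
  assumes "open S" "cball 0 1 \<subseteq> S" "f holomorphic_on S"
  shows "\<exists>A. 1 < fps_conv_radius A \<and> (\<forall>z\<in>cball 0 1. eval_fps A z = f z)"
proof -
  obtain e where e: "e > 0" "(\<Union>x\<in>cball 0 1. ball x e) \<subseteq> S"
    using compact_subset_open_imp_ball_epsilon_subset[OF compact_cball assms(1,2)] by blast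
  have "ball 0 (1 + e) \<subseteq> S"
  proof
    fix z :: complex assume z: "z \<in> ball 0 (1 + e)"
    show "z \<in> S"
    proof (cases "norm z \<le> 1")
      case False
      have "z \<noteq> 0"
      proof
        assume "z = 0" with False show False by simp
      qed
      \<comment> \<open>A point outside the closed disk is compared with its radial projection to
        the circle.\<close>
      have "norm (z / of_real (norm z) - z) = norm (z * of_real (1 / norm z - 1))"
        by (simp add: algebra_simps)
      also have "\<dots> = norm z - 1"
        unfolding norm_mult norm_of_real using False \<open>z \<noteq> 0\<close> by (simp add: abs_if field_simps)
      finally have "norm (z / of_real (norm z) - z) < e" using z by simp
      moreover have "norm (z / of_real (norm z)) \<le> 1" using \<open>z \<noteq> 0\<close> by (simp add: norm_divide)
      ultimately have "z \<in> (\<Union>x\<in>cball 0 1. ball x e)"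
        by (intro UN_I[of "z / of_real (norm z)"]) (auto simp: dist_norm)
      then show ?thesis by (rule subsetD[OF e(2)])
    qed (use assms(2) in auto)
  qed
  then have "f holomorphic_on eball 0 (ereal (1 + e))"
    using assms(3) by (simp add: holomorphic_on_subset)
  note * = conv_radius_fps_expansion[OF this] eval_fps_expansion'[OF this]
  have "1 < ereal (1 + e)" using e by simp
  then have "1 < fps_conv_radius (fps_expansion f 0)" using *(1) by (rule less_le_trans)
  moreover have "eval_fps (fps_expansion f 0) z = f z" if "z \<in> cball 0 1" for z
    using *(2)[of z] e that by simp
  ultimately show ?thesis by blast
qed

lemma matrix_inv_right_left:
  fixes M :: "complex ^ 'q ^ 'q"
  assumes "det M \<noteq> 0"
  shows "M ** matrix_inv M = mat 1" "matrix_inv M ** M = mat 1"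
proof -
  have "\<exists>B. M ** B = mat 1 \<and> B ** M = mat 1"
    using assms by (simp add: invertible_det_nz[symmetric] invertible_def)
  from someI_ex[OF this] show "M ** matrix_inv M = mat 1" "matrix_inv M ** M = mat 1"
    unfolding matrix_inv_def by auto
qed

lemma matrix_inv_eqI:
  fixes M N :: "complex ^ 'q ^ 'q"
  assumes "M ** N = mat 1" "N ** M = mat 1"
  shows "matrix_inv M = N"
proof -
  have "\<exists>B. M ** B = mat 1 \<and> B ** M = mat 1" using assms by blast
  from someI_ex[OF this] have "matrix_inv M ** M = mat 1"
    unfolding matrix_inv_def by auto
  then have "matrix_inv M ** (M ** N) = N" by (simp add: matrix_mul_assoc)
  then show ?thesis using assms by simp
qed

text \<open>Cramer's rule, which exhibits the entries of the inverse as quotients of determinants,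
  hence as holomorphic functions where the determinant is nonzero.\<close>

lemma matrix_inv_entry:
  fixes M :: "complex ^ 'q ^ 'q"
  assumes "det M \<noteq> 0"
  shows "matrix_inv M $ i $ j = det (\<chi> k l. if l = i then (if k = j then 1 else 0) else M $ k $ l) / det M"
proof -
  have "M *v column j (matrix_inv M) = (\<chi> k. if k = j then 1 else 0)"
    using arg_cong[OF matrix_inv_right_left(1)[OF assms], of "column j"]
    by (simp add: vec_eq_iff column_def matrix_vector_mult_def matrix_matrix_mult_def mat_def)
  then have "column j (matrix_inv M) = (\<chi> k. det (\<chi> a l. if l = k then (\<chi> k. if k = j then 1 else 0) $ a else M $ a $ l) / det M)"
    using cramer[OF assms] by simp
  then have "column j (matrix_inv M) $ i = (\<chi> k. det (\<chi> a l. if l = k then (\<chi> k. if k = j then 1 else 0) $ a else M $ a $ l) / det M) $ i"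
    by simp
  moreover have "(\<chi> a l. if l = i then (\<chi> k. if k = j then 1 else 0) $ a else M $ a $ l)
      = (\<chi> k l. if l = i then (if k = j then 1 else 0) else M $ k $ l)"
    by (simp add: vec_eq_iff)
  ultimately show ?thesis by (simp add: column_def)
qed

lemma holomorphic_on_det:
  fixes f :: "'q::finite \<Rightarrow> 'q \<Rightarrow> complex \<Rightarrow> complex"
  assumes "\<And>k l. f k l holomorphic_on S"
  shows "(\<lambda>z. det (\<chi> k l. f k l z)) holomorphic_on S"
  unfolding det_def using assms by (auto intro!: holomorphic_intros)

lemma rational_invertible_on_disk_fps:
  fixes g :: "complex \<Rightarrow> complex ^ 'q ^ 'q"
  assumes "rational_invertible_on_disk g"
  shows "\<exists>A B. (\<forall>i j. 1 < fps_conv_radius (A i j) \<and> 1 < fps_conv_radius (B i j)) \<and>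
    (\<forall>z\<in>cball 0 1. \<forall>i j. g z $ i $ j = eval_fps (A i j) z \<and> matrix_inv (g z) $ i $ j = eval_fps (B i j) z)"
proof -
  have "\<exists>A. 1 < fps_conv_radius A \<and> (\<forall>z\<in>cball 0 1. eval_fps A z = g z $ i $ j)" for i j
  proof -
    obtain p r where pr: "\<forall>z\<in>cball 0 1. poly r z \<noteq> 0 \<and> g z $ i $ j = poly p z / poly r z"
      using assms unfolding rational_invertible_on_disk_def by meson
    have "open {z. poly r z \<noteq> 0}"
      by (intro open_Collect_neq continuous_intros)
    moreover have "(\<lambda>z. poly p z / poly r z) holomorphic_on {z. poly r z \<noteq> 0}"
      by (intro holomorphic_intros) auto
    ultimately show ?thesis
      using analytic_fps[of "{z. poly r z \<noteq> 0}" "\<lambda>z. poly p z / poly r z"] pr by auto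
  qed
  then obtain A where A: "\<And>i j. 1 < fps_conv_radius (A i j)"
    "\<And>i j z. z \<in> cball 0 1 \<Longrightarrow> eval_fps (A i j) z = g z $ i $ j"
    by metis
  define G where "G z = (\<chi> i j. eval_fps (A i j) z)" for z
  have gG: "g z = G z" if "z \<in> cball 0 1" for z
    using A(2)[OF that] by (simp add: G_def vec_eq_iff)
  define U where "U = (\<Inter>i. \<Inter>j. eball (0::complex) (fps_conv_radius (A i j)))"
  have U: "open U" unfolding U_def by (intro open_INT ballI) auto
  have holA: "eval_fps (A i j) holomorphic_on U" for i j
    by (rule holomorphic_on_subset[OF holomorphic_on_eval_fps]) (auto simp: U_def)
  have holG: "(\<lambda>z. det (G z)) holomorphic_on U"
    unfolding G_def by (rule holomorphic_on_det[OF holA])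
  \<comment> \<open>A neighbourhood of the closed disk on which the power series of all entries
    converge and the determinant does not vanish.\<close>
  define S where "S = U \<inter> (\<lambda>z. det (G z)) -` (- {0})"
  have S: "open S" unfolding S_def
    by (rule continuous_open_preimage[OF holomorphic_on_imp_continuous_on[OF holG] U]) auto
  have sub: "cball 0 1 \<subseteq> S"
  proof
    fix z :: complex assume z: "z \<in> cball 0 1"
    then have "ereal (norm z) \<le> 1" by simp
    then have "ereal (norm z) < fps_conv_radius (A i j)" for i j using A(1) by (rule le_less_trans)
    then have "z \<in> U" by (simp add: U_def)
    moreover have "det (g z) \<noteq> 0"
      using assms z unfolding rational_invertible_on_disk_def by blast
    then have "det (G z) \<noteq> 0" by (simp add: gG[OF z])
    ultimately show "z \<in> S" by (simp add: S_def)
  qed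
  have "\<exists>B. 1 < fps_conv_radius B \<and> (\<forall>z\<in>cball 0 1. eval_fps B z = matrix_inv (g z) $ i $ j)" for i j
  proof -
    let ?f = "\<lambda>z. det (\<chi> k l. if l = i then (if k = j then 1 else 0) else eval_fps (A k l) z) / det (G z)"
    have "(\<lambda>z. if l = i then (if k = j then 1 else 0) else eval_fps (A k l) z) holomorphic_on S" for k l
      using holomorphic_on_subset[OF holA[of k l], of S] by (cases "l = i"; cases "k = j") (auto simp: S_def)
    then have "(\<lambda>z. det (\<chi> k l. if l = i then (if k = j then 1 else 0) else eval_fps (A k l) z)) holomorphic_on S"
      by (rule holomorphic_on_det)
    moreover have "(\<lambda>z. det (G z)) holomorphic_on S"
      using holG by (rule holomorphic_on_subset) (auto simp: S_def)
    ultimately have "?f holomorphic_on S"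
      by (rule holomorphic_on_divide) (auto simp: S_def)
    from analytic_fps[OF S sub this] obtain B where B: "1 < fps_conv_radius B" "\<And>z. z \<in> cball 0 1 \<Longrightarrow> eval_fps B z = ?f z"
      by blast
    have "?f z = matrix_inv (g z) $ i $ j" if z: "z \<in> cball 0 1" for z
    proof -
      have "det (G z) \<noteq> 0" using z sub by (auto simp: S_def)
      then have "matrix_inv (G z) $ i $ j = det (\<chi> k l. if l = i then (if k = j then 1 else 0) else G z $ k $ l) / det (G z)"
        by (rule matrix_inv_entry)
      moreover have "G z $ k $ l = eval_fps (A k l) z" for k l by (simp add: G_def)
      ultimately show ?thesis by (simp add: gG[OF z] cong: if_cong)
    qed
    with B show ?thesis by auto
  qed
  then obtain B where B: "\<And>i j. 1 < fps_conv_radius (B i j)"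
    "\<And>i j z. z \<in> cball 0 1 \<Longrightarrow> eval_fps (B i j) z = matrix_inv (g z) $ i $ j"
    by metis
  show ?thesis using A B by (intro exI[of _ A] exI[of _ B]) auto
qed

text \<open>A power series is determined by its sum near 0. The formal version of the inverse
  relation is the one that yields convolution identities.\<close>

lemma fps_matrix_inverse:
  fixes A B :: "'q::finite \<Rightarrow> 'q \<Rightarrow> complex fps"
  assumes A: "\<And>i j. 1 < fps_conv_radius (A i j)" and B: "\<And>i j. 1 < fps_conv_radius (B i j)"
    and inv: "\<And>z. z \<in> cball 0 1 \<Longrightarrow> (\<Sum>\<mu>\<in>UNIV. eval_fps (A \<alpha> \<mu>) z * eval_fps (B \<mu> \<beta>) z) = (if \<alpha> = \<beta> then 1 else 0)"
  shows "(\<Sum>\<mu>\<in>UNIV. A \<alpha> \<mu> * B \<mu> \<beta>) = (if \<alpha> = \<beta> then 1 else 0)"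
proof -
  have pos: "0 < fps_conv_radius (A i j)" "0 < fps_conv_radius (B i j)" for i j
    using less_trans[OF _ A[of i j], of 0] less_trans[OF _ B[of i j], of 0] by simp_all
  have prod: "(\<lambda>z. \<Sum>\<mu>\<in>UNIV. eval_fps (A \<alpha> \<mu>) z * eval_fps (B \<mu> \<beta>) z) has_fps_expansion (\<Sum>\<mu>\<in>UNIV. A \<alpha> \<mu> * B \<mu> \<beta>)"
    by (intro fps_expansion_intros eval_fps_has_fps_expansion pos)
  have delta: "(\<lambda>z::complex. if \<alpha> = \<beta> then 1 else 0) has_fps_expansion (if \<alpha> = \<beta> then 1 else 0)"
    by simp
  have "eventually (\<lambda>z::complex. z \<in> ball 0 1) (nhds 0)"
    by (intro eventually_nhds_in_open) auto
  then have "eventually (\<lambda>z. (\<Sum>\<mu>\<in>UNIV. eval_fps (A \<alpha> \<mu>) z * eval_fps (B \<mu> \<beta>) z) = (if \<alpha> = \<beta> then 1 else 0)) (nhds 0)"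
    by eventually_elim (rule inv, auto)
  then have "(\<lambda>z::complex. if \<alpha> = \<beta> then 1 else 0) has_fps_expansion (\<Sum>\<mu>\<in>UNIV. A \<alpha> \<mu> * B \<mu> \<beta>)"
    using prod by (subst (asm) has_fps_expansion_cong[OF _ refl])
  then show ?thesis
    using fps_expansion_unique_complex[OF _ delta] by blast
qed

section \<open>Coefficient bounds for the fractional factors\<close>

lemma fps_mult_nth_rev: "fps_nth (f * g) k = (\<Sum>r\<le>k. fps_nth f (k - r) * fps_nth g r)"
  for f g :: "complex fps"
  unfolding mult.commute[of f g] fps_mult_nth atLeast0AtMost by (intro sum.cong refl mult.commute)

lemma uniform_bound:
  fixes f :: "'q::finite \<Rightarrow> 'q \<Rightarrow> nat \<Rightarrow> complex"
  assumes ex: "\<And>\<alpha> \<beta>. \<exists>K. \<forall>k. norm (f \<alpha> \<beta> k) \<le> K * h k" and h: "\<And>k. 0 \<le> h k"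
  shows "\<exists>K\<ge>0. \<forall>\<alpha> \<beta> k. norm (f \<alpha> \<beta> k) \<le> K * h k"
proof -
  obtain L where L: "\<And>\<alpha> \<beta> k. norm (f \<alpha> \<beta> k) \<le> L \<alpha> \<beta> * h k" using ex by metis
  define K where "K = (\<Sum>\<alpha>\<in>UNIV. \<Sum>\<beta>\<in>UNIV. \<bar>L \<alpha> \<beta>\<bar>)"
  have "norm (f \<alpha> \<beta> k) \<le> K * h k" for \<alpha> \<beta> k
  proof -
    have "\<bar>L \<alpha> \<beta>\<bar> \<le> (\<Sum>\<beta>\<in>UNIV. \<bar>L \<alpha> \<beta>\<bar>)" by (rule member_le_sum) auto
    also have "\<dots> \<le> K" unfolding K_def by (rule member_le_sum) (auto intro: sum_nonneg)
    finally have "L \<alpha> \<beta> \<le> K" by simp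
    then show ?thesis using order.trans[OF L[of \<alpha> \<beta> k] mult_right_mono[OF _ h]] by blast
  qed
  moreover have "K \<ge> 0" unfolding K_def by (intro sum_nonneg) auto
  ultimately show ?thesis by blast
qed

lemma fps_nth_one_minus_X_mult:
  "fps_nth ((1 - fps_X) * F) (Suc k) = fps_nth F (Suc k) - fps_nth F k"
  for F :: "complex fps"
  by (simp add: algebra_simps)

lemma binom_fps_Suc: "binom_fps (\<alpha> + 1) * A = (1 - fps_X) * (binom_fps \<alpha> * A)"
  by (simp add: binom_fps_add[of \<alpha> 1] binom_fps_1 mult_ac)

lemma sum_binom_fps_mult: "(\<Sum>r\<le>k. fps_nth (binom_fps (\<alpha> + 1) * A) r) = fps_nth (binom_fps \<alpha> * A) k"
proof (induction k)
  case (Suc k)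
  then show ?case by (simp add: binom_fps_Suc fps_nth_one_minus_X_mult del: fps_mult_nth_0)
qed (simp add: binom_fps_Suc)

lemma uniform_binom_fps_bound:
  fixes A :: "'q::finite \<Rightarrow> 'q \<Rightarrow> complex fps"
  assumes "\<And>i j. 1 < fps_conv_radius (A i j)"
  shows "\<exists>K\<ge>0. \<forall>i j k. norm (fps_nth (binom_fps \<alpha> * A i j) k) \<le> K * (real k + 1) powr (- \<alpha> - 1)"
  by (rule uniform_bound[OF norm_binom_fps_mult_nth_le[OF assms]]) simp

text \<open>All six bounds of the locale are instances of \<open>uniform_binom_fps_bound\<close>.
  For c and its first two differences the exponents are -d, 1 - d and 2 - d; for b, its difference
  and its partial sums they are d, d + 1 and d - 1.\<close>

lemma fractional_matrix_pair_binom: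
  fixes A B :: "'q::finite \<Rightarrow> 'q \<Rightarrow> complex fps"
  assumes d: "0 < d" "d < 1 / 2"
    and A: "\<And>i j. 1 < fps_conv_radius (A i j)" and B: "\<And>i j. 1 < fps_conv_radius (B i j)"
    and AB: "\<And>\<alpha> \<beta>. (\<Sum>\<mu>\<in>UNIV. A \<alpha> \<mu> * B \<mu> \<beta>) = (if \<alpha> = \<beta> then 1 else 0)"
    and BA: "\<And>\<alpha> \<beta>. (\<Sum>\<mu>\<in>UNIV. B \<alpha> \<mu> * A \<mu> \<beta>) = (if \<alpha> = \<beta> then 1 else 0)"
  shows "\<exists>K. fractional_matrix_pair d K (\<lambda>i j. fps_nth (binom_fps (- d) * A i j)) (\<lambda>i j. fps_nth (binom_fps d * B i j))"
proof -
  obtain K0 where K0: "K0 \<ge> 0" "\<And>i j k. norm (fps_nth (binom_fps (- d) * A i j) k) \<le> K0 * (real k + 1) powr (- (- d) - 1)"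
    using uniform_binom_fps_bound[of A, OF A] by blast
  obtain K1 where K1: "K1 \<ge> 0" "\<And>i j k. norm (fps_nth (binom_fps (- d + 1) * A i j) k) \<le> K1 * (real k + 1) powr (- (- d + 1) - 1)"
    using uniform_binom_fps_bound[of A, OF A] by blast
  obtain K2 where K2: "K2 \<ge> 0" "\<And>i j k. norm (fps_nth (binom_fps (- d + 1 + 1) * A i j) k) \<le> K2 * (real k + 1) powr (- (- d + 1 + 1) - 1)"
    using uniform_binom_fps_bound[of A, OF A] by blast
  obtain L0 where L0: "L0 \<ge> 0" "\<And>i j k. norm (fps_nth (binom_fps d * B i j) k) \<le> L0 * (real k + 1) powr (- d - 1)"
    using uniform_binom_fps_bound[of B, OF B] by blast
  obtain L1 where L1: "L1 \<ge> 0" "\<And>i j k. norm (fps_nth (binom_fps (d + 1) * B i j) k) \<le> L1 * (real k + 1) powr (- (d + 1) - 1)"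
    using uniform_binom_fps_bound[of B, OF B] by blast
  obtain L2 where L2: "L2 \<ge> 0" "\<And>i j k. norm (fps_nth (binom_fps (d - 1) * B i j) k) \<le> L2 * (real k + 1) powr (- (d - 1) - 1)"
    using uniform_binom_fps_bound[of B, OF B] by blast
  define K where "K = K0 + K1 + K2 + L0 + L1 + L2"
  have le: "K0 \<le> K" "K1 \<le> K" "K2 \<le> K" "L0 \<le> K" "L1 \<le> K" "L2 \<le> K"
    using K0(1) K1(1) K2(1) L0(1) L1(1) L2(1) by (auto simp: K_def)
  \<comment> \<open>Differences sit at index k + 1 or k + 2, and their negative powers are weakened
    to powers of k + 1.\<close>
  have mono: "norm x \<le> K * (real k + 1) powr p"
    if "norm x \<le> L * (real k' + 1) powr p'" "L \<le> K" "0 \<le> L" "k' = k \<or> k' = Suc k \<and> p' \<le> 0 \<or> k' = Suc (Suc k) \<and> p' \<le> 0" "p = p'"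
    for x :: complex and L k k' p p'
  proof -
    have "(real k' + 1) powr p' \<le> (real k + 1) powr p" using that(4,5) by (auto intro!: powr_mono2')
    then have "L * (real k' + 1) powr p' \<le> K * (real k + 1) powr p"
      using that(2,3) by (intro mult_mono) auto
    then show ?thesis using that(1) by simp
  qed
  have pair: "fractional_pair d K (fps_nth (binom_fps (- d) * A \<alpha> \<mu>)) (fps_nth (binom_fps d * B \<nu> \<beta>))" for \<alpha> \<mu> \<nu> \<beta>
  proof
    let ?c = "fps_nth (binom_fps (- d) * A \<alpha> \<mu>)" and ?b = "fps_nth (binom_fps d * B \<nu> \<beta>)"
    show "0 < d" "d < 1" using d by auto
    fix k
    show "norm (?c k) \<le> K * (real k + 1) powr (d - 1)"
      by (rule mono[OF K0(2) le(1) K0(1)]) auto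
    show "norm (?c (Suc k) - ?c k) \<le> K * (real k + 1) powr (d - 2)"
      unfolding fps_nth_one_minus_X_mult[symmetric] binom_fps_Suc[symmetric]
      by (rule mono[OF K1(2) le(2) K1(1)]) (use d in auto)
    have "?c (Suc (Suc k)) - 2 * ?c (Suc k) + ?c k
        = fps_nth (binom_fps (- d + 1 + 1) * A \<alpha> \<mu>) (Suc (Suc k))"
      by (simp only: binom_fps_Suc fps_nth_one_minus_X_mult) simp
    then show "norm (?c (Suc (Suc k)) - 2 * ?c (Suc k) + ?c k) \<le> K * (real k + 1) powr (d - 3)"
      by (simp only:) (rule mono[OF K2(2) le(3) K2(1)], use d in auto)
    show "norm (?b k) \<le> K * (real k + 1) powr (- d - 1)"
      by (rule mono[OF L0(2) le(4) L0(1)]) auto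
    show "norm (?b (Suc k) - ?b k) \<le> K * (real k + 1) powr (- d - 2)"
      unfolding fps_nth_one_minus_X_mult[symmetric] binom_fps_Suc[symmetric]
      by (rule mono[OF L1(2) le(5) L1(1)]) (use d in auto)
    have "(\<Sum>r\<le>k. ?b r) = fps_nth (binom_fps (d - 1) * B \<nu> \<beta>) k"
      using sum_binom_fps_mult[of "d - 1" "B \<nu> \<beta>" k] by simp
    then show "norm (\<Sum>r\<le>k. ?b r) \<le> K * (real k + 1) powr (- d)"
      by (simp only:) (rule mono[OF L2(2) le(6) L2(1)], auto)
  qed
  \<comment> \<open>The two fractional powers cancel, which leaves the inverse relation of the
    analytic factors.\<close>
  have conv: "(\<Sum>\<mu>\<in>UNIV. \<Sum>r\<le>k. fps_nth (binom_fps x * F \<alpha> \<mu>) (k - r) * fps_nth (binom_fps y * G \<mu> \<beta>) r)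
      = (if k = 0 \<and> \<alpha> = \<beta> then 1 else 0)"
    if "x + y = 0" "(\<Sum>\<mu>\<in>UNIV. F \<alpha> \<mu> * G \<mu> \<beta>) = (if \<alpha> = \<beta> then 1 else 0)"
    for x y and F G :: "'q \<Rightarrow> 'q \<Rightarrow> complex fps" and \<alpha> \<beta> k
  proof -
    have xy: "binom_fps x * binom_fps y = 1" using that(1) by (simp flip: binom_fps_add)
    have "(\<Sum>\<mu>\<in>UNIV. (binom_fps x * F \<alpha> \<mu>) * (binom_fps y * G \<mu> \<beta>)) = (binom_fps x * binom_fps y) * (\<Sum>\<mu>\<in>UNIV. F \<alpha> \<mu> * G \<mu> \<beta>)"
      by (simp add: sum_distrib_left mult_ac)
    also have "\<dots> = (if \<alpha> = \<beta> then 1 else 0)" using that(2) by (simp add: xy)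
    finally have "fps_nth (\<Sum>\<mu>\<in>UNIV. (binom_fps x * F \<alpha> \<mu>) * (binom_fps y * G \<mu> \<beta>)) k = fps_nth (if \<alpha> = \<beta> then 1 else 0) k"
      by simp
    then show ?thesis by (simp add: fps_sum_nth fps_mult_nth_rev[of "binom_fps x * _"])
  qed
  have "fractional_matrix_pair d K (\<lambda>i j. fps_nth (binom_fps (- d) * A i j)) (\<lambda>i j. fps_nth (binom_fps d * B i j))"
    by (intro fractional_matrix_pair.intro d pair conv AB BA) auto
  then show ?thesis ..
qed

section \<open>Toeplitz blocks and the explicit inverse\<close>

lemma herm_nth [simp]: "herm M $ i $ j = cnj (M $ j $ i)"
  by (simp add: herm_def map_matrix_def transpose_def)

lemma cscale_nth [simp]: "cscale c M $ i $ j = c * M $ i $ j"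
  by (simp add: cscale_def map_matrix_def)

lemma herm_mult: "herm (M ** N) = herm N ** herm M"
  by (simp add: vec_eq_iff matrix_matrix_mult_def mult.commute)

lemma herm_mat_1 [simp]: "herm (mat 1) = mat 1"
  by (auto simp: vec_eq_iff mat_def)

lemma herm_herm [simp]: "herm (herm M) = M"
  by (simp add: vec_eq_iff)

lemma cscale_mult: "cscale a M ** cscale b N = cscale (a * b) (M ** N)"
  by (simp add: vec_eq_iff matrix_matrix_mult_def sum_distrib_left mult_ac)

lemma cscale_1 [simp]: "cscale 1 M = M"
  by (simp add: vec_eq_iff)

lemma sums_matrix_iff:
  fixes f :: "nat \<Rightarrow> complex ^ 'n::finite ^ 'm::finite"
  shows "f sums S \<longleftrightarrow> (\<forall>i j. (\<lambda>k. f k $ i $ j) sums (S $ i $ j))"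
proof
  assume "f sums S"
  then have "(\<lambda>k. f k $ i) sums (S $ i)" for i
    by (rule bounded_linear.sums[OF bounded_linear_vec_nth])
  then have "(\<lambda>k. f k $ i $ j) sums (S $ i $ j)" for i j
    by (rule bounded_linear.sums[OF bounded_linear_vec_nth])
  then show "\<forall>i j. (\<lambda>k. f k $ i $ j) sums (S $ i $ j)" by blast
next
  assume "\<forall>i j. (\<lambda>k. f k $ i $ j) sums (S $ i $ j)"
  then show "f sums S"
    unfolding sums_def by (intro vec_tendstoI) simp
qed

lemma power_series_coeffs_unique:
  fixes a b :: "nat \<Rightarrow> complex"
  assumes "\<And>z. z \<in> ball 0 1 \<Longrightarrow> (\<lambda>k. z ^ k * a k) sums f z" "\<And>z. z \<in> ball 0 1 \<Longrightarrow> (\<lambda>k. z ^ k * b k) sums f z"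
  shows "a = b"
proof -
  have rad: "0 < fps_conv_radius (Abs_fps c)" if "\<And>z. z \<in> ball 0 1 \<Longrightarrow> (\<lambda>k. z ^ k * c k) sums f z" for c
  proof -
    have "1 \<le> fps_conv_radius (Abs_fps c)"
      unfolding fps_conv_radius_def
    proof (rule conv_radius_geI_ex)
      fix r :: real assume "0 < r" "ereal r < 1"
      then show "\<exists>z. norm z = r \<and> summable (\<lambda>n. fps_nth (Abs_fps c) n * z ^ n)"
        using that[of "of_real r"] by (intro exI[of _ "of_real r"]) (auto simp: sums_iff mult.commute)
    qed
    then show ?thesis by (rule less_le_trans[rotated]) simp
  qed
  have ev: "eventually (\<lambda>z::complex. z \<in> ball 0 1) (nhds 0)"
    by (intro eventually_nhds_in_open) auto
  have "Abs_fps a = Abs_fps b"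
  proof (rule eval_fps_eqD[OF rad[OF assms(1)] rad[OF assms(2)]])
    show "eventually (\<lambda>z. eval_fps (Abs_fps a) z = eval_fps (Abs_fps b) z) (nhds 0)"
      using ev
    proof eventually_elim
      case (elim z)
      then show ?case
        using assms(1,2)[of z] by (simp add: eval_fps_def sums_iff mult.commute)
    qed
  qed
  then have "fps_nth (Abs_fps a) k = fps_nth (Abs_fps b) k" for k by (simp only:)
  then show ?thesis by auto
qed

text \<open>The inverse of \<open>h_tilde\<close> at z is the adjoint of (1 - z)^d times the inverse
  of \<open>gs\<close>, evaluated at the conjugate of z. The two conjugations make it a power series
  in z again; uniqueness of its coefficients resolves the definite description.\<close>

lemma a_tilde_eq:
  fixes gs :: "complex \<Rightarrow> 'q::finite cmat"
  assumes d: "0 < d" and B: "\<And>i j. 1 < fps_conv_radius (B i j)"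
    and inv: "\<And>z i j. z \<in> cball 0 1 \<Longrightarrow> matrix_inv (gs z) $ i $ j = eval_fps (B i j) z"
    and det: "\<And>z. z \<in> cball 0 1 \<Longrightarrow> det (gs z) \<noteq> 0"
  shows "a_tilde d gs k = (\<chi> i j. - cnj (fps_nth (binom_fps d * B j i) k))"
proof -
  let ?a = "\<lambda>k. \<chi> i j. - cnj (fps_nth (binom_fps d * B j i) k)"
  have sums: "(\<lambda>k. cscale (z ^ k) (?a k)) sums (- matrix_inv (h_tilde d gs z))" if z: "z \<in> ball 0 1" for z
  proof -
    have zc: "cnj z \<in> cball 0 1" "norm (cnj z) < 1" using z by auto
    let ?M = "gs (cnj z)" and ?p = "(1 - cnj z) powr (- of_real d)" and ?m = "(1 - cnj z) powr (of_real d)"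
    have "1 - cnj z \<noteq> 0" using zc by auto
    then have pm: "?p * ?m = 1" by (simp flip: powr_add)
    note M = matrix_inv_right_left[OF det[OF zc(1)]]
    have "matrix_inv (h_tilde d gs z) = herm (cscale ?m (matrix_inv ?M))"
      unfolding h_tilde_def h_sharp_def
    proof (rule matrix_inv_eqI)
      show "herm (cscale ?p ?M) ** herm (cscale ?m (matrix_inv ?M)) = mat 1"
        "herm (cscale ?m (matrix_inv ?M)) ** herm (cscale ?p ?M) = mat 1"
        unfolding herm_mult[symmetric] cscale_mult M using pm by (simp_all add: mult.commute)
    qed
    then have ent: "(- matrix_inv (h_tilde d gs z)) $ i $ j = - cnj (eval_fps (binom_fps d * B j i) (cnj z))" for i j
      using eval_fps_binom_mult[OF zc(2) B] inv[OF zc(1)] by simp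
    have "(\<lambda>k. - cnj (fps_nth (binom_fps d * B j i) k * cnj z ^ k)) sums (- cnj (eval_fps (binom_fps d * B j i) (cnj z)))" for i j
    proof -
      have "ereal (norm (cnj z)) < fps_conv_radius (binom_fps d * B j i)"
        using zc(2) by (intro less_le_trans[OF _ conv_radius_binom_fps_mult[OF B]]) simp
      then show ?thesis by (intro sums_minus) (subst sums_cnj, rule sums_eval_fps)
    qed
    then show ?thesis unfolding sums_matrix_iff ent by (simp add: mult.commute)
  qed
  have "a_tilde d gs = ?a"
    unfolding a_tilde_def
  proof (rule the_equality)
    show "\<forall>z\<in>ball 0 1. (\<lambda>k. cscale (z ^ k) (?a k)) sums (- matrix_inv (h_tilde d gs z))"
      using sums by blast
    fix a assume a: "\<forall>z\<in>ball 0 1. (\<lambda>k. cscale (z ^ k) (a k)) sums (- matrix_inv (h_tilde d gs z))"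
    have "(\<lambda>k. a k $ i $ j) = (\<lambda>k. ?a k $ i $ j)" for i j
      using a sums unfolding sums_matrix_iff
      by (intro power_series_coeffs_unique[where f = "\<lambda>z. (- matrix_inv (h_tilde d gs z)) $ i $ j"]) auto
    then show "a = ?a" by (simp add: vec_eq_iff fun_eq_iff)
  qed
  then show ?thesis by simp
qed

lemma fps_nth_binom_shift:
  "fps_nth (binom_fps \<alpha> * (fps_X ^ s * A)) u = (if s \<le> u then fps_nth (binom_fps \<alpha> * A) (u - s) else 0)"
proof -
  have e: "binom_fps \<alpha> * (fps_X ^ s * A) = fps_X ^ s * (binom_fps \<alpha> * A)" by (simp add: mult_ac)
  show ?thesis unfolding e fps_X_power_mult_nth by auto
qed

lemma fps_conv_radius_X_power_mult:
  fixes A :: "complex fps"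
  assumes "1 < fps_conv_radius A" shows "1 < fps_conv_radius (fps_X ^ s * A)"
  using fps_conv_radius_mult[of "fps_X ^ s" A] assms by (simp add: less_le_trans)

text \<open>On the circle the exponential of the Fourier coefficient is cnj (z^s) z^t. It is
  absorbed by shifting the two power series, and boundary Parseval then gives the inner product of
  two columns of C. The weight enters through \<open>gs\<close>, which puts the adjoint on the left
  as in a Gram matrix.\<close>

lemma toeplitz_block_entry:
  fixes g gs w :: "complex \<Rightarrow> 'q::finite cmat"
  assumes d: "0 < d" "d < 1 / 2" and w: "weight_factor d w g" and gs: "sharp_factor g gs"
    and A: "\<And>i j. 1 < fps_conv_radius (A i j)"
    and ev: "\<And>z i j. z \<in> cball 0 1 \<Longrightarrow> gs z $ i $ j = eval_fps (A i j) z"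
  shows "toeplitz_block w s t $ \<alpha> $ \<beta> = (\<Sum>u. \<Sum>\<mu>\<in>UNIV.
     cnj (lower_toeplitz (\<lambda>i j. fps_nth (binom_fps (- d) * A i j)) (u, \<mu>) (s, \<alpha>))
       * lower_toeplitz (\<lambda>i j. fps_nth (binom_fps (- d) * A i j)) (u, \<mu>) (t, \<beta>))"
proof -
  let ?A = "\<lambda>\<mu>. fps_X ^ s * A \<mu> \<alpha>" and ?B = "\<lambda>\<mu>. fps_X ^ t * A \<mu> \<beta>"
  let ?f = "\<lambda>\<mu> \<theta>. of_real (norm (1 - cis \<theta>) powr (- 2 * d)) * cnj (eval_fps (?A \<mu>) (cis \<theta>)) * eval_fps (?B \<mu>) (cis \<theta>)"
  have rad: "1 < fps_conv_radius (?A \<mu>)" "1 < fps_conv_radius (?B \<mu>)" for \<mu>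
    by (intro fps_conv_radius_X_power_mult A)+
  have eq: "cis (- (of_int (int s - int t) * \<theta>)) * w (cis \<theta>) $ \<alpha> $ \<beta> = (\<Sum>\<mu>\<in>UNIV. ?f \<mu> \<theta>)" if th: "\<theta> \<in> space circ" for \<theta>
  proof -
    have z: "cis \<theta> \<in> cball 0 1" "cis \<theta> \<in> sphere 0 1 - {1}" "cis \<theta> \<in> sphere 0 1" using cis_neq_1[OF th] by auto
    have "w (cis \<theta>) = norm (1 - cis \<theta>) powr (- 2 * d) *\<^sub>R (g (cis \<theta>) ** herm (g (cis \<theta>)))"
      using w z(2) unfolding weight_factor_def by blast
    also have "g (cis \<theta>) ** herm (g (cis \<theta>)) = herm (gs (cis \<theta>)) ** gs (cis \<theta>)"
      using gs z(3) unfolding sharp_factor_def by blast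
    finally have "w (cis \<theta>) $ \<alpha> $ \<beta> = of_real (norm (1 - cis \<theta>) powr (- 2 * d))
        * (\<Sum>\<mu>\<in>UNIV. cnj (eval_fps (A \<mu> \<alpha>) (cis \<theta>)) * eval_fps (A \<mu> \<beta>) (cis \<theta>))"
      by (simp add: matrix_matrix_mult_def ev[OF z(1)] scaleR_conv_of_real[symmetric])
    moreover have "cis (- (of_int (int s - int t) * \<theta>)) = cnj (cis \<theta> ^ s) * cis \<theta> ^ t"
      by (simp add: Complex.DeMoivre cis_cnj cis_mult algebra_simps)
    moreover have "eval_fps (fps_X ^ r * A i j) (cis \<theta>) = cis \<theta> ^ r * eval_fps (A i j) (cis \<theta>)" for r i j
      using A[of i j] by (subst eval_fps_mult) (simp_all add: one_ereal_def)
    ultimately show ?thesis by (simp add: sum_distrib_left mult_ac)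
  qed
  have "(LBINT \<theta>:{-pi..pi}. cis (- (of_int (int s - int t) * \<theta>)) * w (cis \<theta>) $ \<alpha> $ \<beta>) = (\<integral>\<theta>. (\<Sum>\<mu>\<in>UNIV. ?f \<mu> \<theta>) \<partial>circ)"
    unfolding set_integral_eq_circ by (rule Bochner_Integration.integral_cong[OF refl eq])
  also have "\<dots> = (\<Sum>\<mu>\<in>UNIV. integral\<^sup>L circ (?f \<mu>))"
    by (intro Bochner_Integration.integral_sum integrable_boundary d rad)
  finally have "toeplitz_block w s t $ \<alpha> $ \<beta> = (\<Sum>\<mu>\<in>UNIV. integral\<^sup>L circ (?f \<mu>) / (2 * pi))"
    by (simp add: toeplitz_block_def fourier_coeff_def sum_divide_distrib)
  moreover have "(\<lambda>u. \<Sum>\<mu>\<in>UNIV. cnj (fps_nth (binom_fps (- d) * ?A \<mu>) u) * fps_nth (binom_fps (- d) * ?B \<mu>) u)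
      sums (\<Sum>\<mu>\<in>UNIV. integral\<^sup>L circ (?f \<mu>) / (2 * pi))"
    by (intro sums_sum parseval_boundary d rad)
  ultimately show ?thesis
    by (simp add: sums_iff fps_nth_binom_shift lower_toeplitz_def)
qed

definition flatten :: "(nat \<Rightarrow> nat \<Rightarrow> 'q::finite cmat) \<Rightarrow> nat \<times> 'q \<Rightarrow> nat \<times> 'q \<Rightarrow> complex" where
  "flatten M = (\<lambda>(s, \<alpha>) (t, \<beta>). M s t $ \<alpha> $ \<beta>)"

text \<open>The predicate inside the choice in \<open>block_inv\<close>, named so that existence and
  uniqueness of the inverse can be treated separately from the choice.\<close>

definition is_block_inv :: "nat \<Rightarrow> (nat \<Rightarrow> nat \<Rightarrow> 'q::finite cmat) \<Rightarrow> (nat \<Rightarrow> nat \<Rightarrow> 'q cmat) \<Rightarrow> bool" where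
  "is_block_inv n A B \<longleftrightarrow> (\<forall>s\<in>{1..n}. \<forall>t\<in>{1..n}.
     block_mult n A B s t = (if s = t then mat 1 else 0) \<and>
     block_mult n B A s t = (if s = t then mat 1 else 0))"

lemma block_mult_nth: "block_mult n A B s t $ \<alpha> $ \<beta> = mm (block_index n) (flatten A) (flatten B) (s, \<alpha>) (t, \<beta>)"
  by (simp add: block_mult_def mm_def flatten_def sum_block_index matrix_matrix_mult_def)

lemma mm_flatten_eq_idm_iff:
  "mm (block_index n) (corner n (flatten A)) (corner n (flatten B)) = idm (block_index n)
   \<longleftrightarrow> (\<forall>s\<in>{1..n}. \<forall>t\<in>{1..n}. block_mult n A B s t = (if s = t then mat 1 else 0))"
  (is "?l \<longleftrightarrow> ?r")
proof -
  let ?I = "block_index n"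
  have "?l \<longleftrightarrow> (\<forall>x\<in>?I. \<forall>y\<in>?I. mm ?I (flatten A) (flatten B) x y = idm ?I x y)"
    unfolding mm_restr by (auto simp: fun_eq_iff restr_def idm_def)
  also have "\<dots> \<longleftrightarrow> (\<forall>s\<in>{1..n}. \<forall>t\<in>{1..n}. \<forall>\<alpha> \<beta>. block_mult n A B s t $ \<alpha> $ \<beta> = (if s = t then mat 1 else 0) $ \<alpha> $ \<beta>)"
    unfolding block_mult_nth by (auto simp: block_index_def idm_def mat_def)
  finally show ?thesis by (simp add: vec_eq_iff)
qed

lemma is_block_inv_iff:
  "is_block_inv n A B \<longleftrightarrow>
     mm (block_index n) (corner n (flatten A)) (corner n (flatten B)) = idm (block_index n) \<and>
     mm (block_index n) (corner n (flatten B)) (corner n (flatten A)) = idm (block_index n)"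
  unfolding mm_flatten_eq_idm_iff is_block_inv_def by blast

lemma is_block_inv_unique:
  assumes "is_block_inv n A B" "is_block_inv n A B'" "s \<in> {1..n}" "t \<in> {1..n}"
  shows "B s t = B' s t"
proof -
  let ?I = "block_index n" and ?r = "\<lambda>M. corner n (flatten M)"
  have "?r B = mm ?I (?r B) (mm ?I (?r A) (?r B'))"
    using assms(2) by (simp add: is_block_inv_iff mm_idm_right)
  also have "\<dots> = ?r B'"
    unfolding mm_assoc[symmetric] using assms(1) by (simp add: is_block_inv_iff mm_idm_left)
  finally have "?r B (s, \<alpha>) (t, \<beta>) = ?r B' (s, \<alpha>) (t, \<beta>)" for \<alpha> \<beta> by simp
  then show ?thesis using assms(3,4) by (simp add: block_index_def flatten_def vec_eq_iff)
qed

lemma is_block_inv_block_inv: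
  assumes "is_block_inv n A B" shows "is_block_inv n A (block_inv n A)"
  using assms someI[of "is_block_inv n A" B] unfolding block_inv_def is_block_inv_def by simp

section \<open>Column sums\<close>

lemma restr_restr [simp]: "restr I (restr I A) = restr I A"
  by (simp add: restr_def fun_eq_iff)

lemma (in fractional_pair) sum_norm_b_le: "(\<Sum>k<P. norm (b k)) \<le> K * (1 + 1 / d)"
proof -
  have "(\<Sum>k<P. norm (b k)) \<le> (\<Sum>k<P. K * (real k + 1) powr (- d - 1))"
    by (intro sum_mono b)
  also have "\<dots> = K * (\<Sum>k=1..P. real k powr (- d - 1))"
    unfolding sum_distrib_left
    by (rule sum.reindex_bij_witness[of _ "\<lambda>k. k - 1" Suc]) (auto simp: add.commute)
  also have "\<dots> \<le> K * (1 + 1 / d)"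
  proof (intro mult_left_mono K_nonneg)
    show "(\<Sum>k=1..P. real k powr (- d - 1)) \<le> 1 + 1 / d"
    proof (cases "P = 0")
      case False
      then have "(\<Sum>k=1..P. real k powr (- d - 1)) = 1 + (\<Sum>k=Suc 1..P. real k powr (- d - 1))"
        using sum.atLeast_Suc_atMost[of 1 P "\<lambda>k. real k powr (- d - 1)"] by simp
      then show ?thesis using sum_powr_tail_le[of d 1 P] d by simp
    qed (use d in simp)
  qed
  finally show ?thesis .
qed

text \<open>A column sum of L times its adjoint is bounded by products of l^1 norms of b, which are
  finite because d > 0. The uniform bound needs this where the two inverses are estimated
  separately.\<close>

lemma (in fractional_matrix_pair) sum_norm_Smat_le:
  "(\<Sum>s=1..n. norm (Smat (s, \<alpha>) (t, \<beta>))) \<le> real CARD('q) * (K * (1 + 1 / d))\<^sup>2"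
proof -
  let ?L = "K * (1 + 1 / d)"
  have L: "0 \<le> ?L" using K_nonneg d_pos by simp
  have bd: "(\<Sum>k<P. norm (b i j k)) \<le> ?L" for i j P
    using fractional_pair.sum_norm_b_le[OF pair] .
  have "(\<Sum>s=1..n. norm (Smat (s, \<alpha>) (t, \<beta>)))
      \<le> (\<Sum>s=1..n. \<Sum>l=1..t. \<Sum>\<mu>\<in>UNIV. (if l \<le> s then norm (b \<alpha> \<mu> (s - l)) else 0) * norm (b \<beta> \<mu> (t - l)))"
  proof (rule sum_mono)
    fix s
    have "norm (Smat (s, \<alpha>) (t, \<beta>)) \<le> (\<Sum>l=1..min s t. \<Sum>\<mu>\<in>UNIV. norm (b \<alpha> \<mu> (s - l)) * norm (b \<beta> \<mu> (t - l)))"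
      unfolding Smat_def fst_conv snd_conv
      by (intro sum_norm_le) (simp add: norm_mult)
    also have "\<dots> = (\<Sum>l=1..min s t. \<Sum>\<mu>\<in>UNIV. (if l \<le> s then norm (b \<alpha> \<mu> (s - l)) else 0) * norm (b \<beta> \<mu> (t - l)))"
      by (intro sum.cong refl) auto
    also have "\<dots> \<le> (\<Sum>l=1..t. \<Sum>\<mu>\<in>UNIV. (if l \<le> s then norm (b \<alpha> \<mu> (s - l)) else 0) * norm (b \<beta> \<mu> (t - l)))"
      by (intro sum_mono2) (auto intro!: sum_nonneg)
    finally show "norm (Smat (s, \<alpha>) (t, \<beta>)) \<le> \<dots>" .
  qed
  also have "\<dots> = (\<Sum>l=1..t. \<Sum>\<mu>\<in>UNIV. (\<Sum>s=1..n. if l \<le> s then norm (b \<alpha> \<mu> (s - l)) else 0) * norm (b \<beta> \<mu> (t - l)))"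
    by (subst sum.swap, intro sum.cong refl, subst sum.swap) (simp add: sum_distrib_right)
  also have "\<dots> \<le> (\<Sum>l=1..t. \<Sum>\<mu>\<in>UNIV. ?L * norm (b \<beta> \<mu> (t - l)))"
  proof (intro sum_mono mult_right_mono)
    fix l \<mu>
    have "(\<Sum>s=1..n. if l \<le> s then norm (b \<alpha> \<mu> (s - l)) else 0) = (\<Sum>s\<in>{1..n} \<inter> {l..}. norm (b \<alpha> \<mu> (s - l)))"
      by (subst sum.inter_restrict) (auto intro!: sum.cong)
    also have "\<dots> = (\<Sum>k\<in>(\<lambda>s. s - l) ` ({1..n} \<inter> {l..}). norm (b \<alpha> \<mu> k))"
      by (subst sum.reindex) (auto simp: inj_on_def)
    also have "\<dots> \<le> (\<Sum>k<Suc n. norm (b \<alpha> \<mu> k))"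
      by (intro sum_mono2) auto
    also have "\<dots> \<le> ?L" by (rule bd)
    finally show "(\<Sum>s=1..n. if l \<le> s then norm (b \<alpha> \<mu> (s - l)) else 0) \<le> ?L" .
  qed simp
  also have "\<dots> = (\<Sum>\<mu>\<in>UNIV. ?L * (\<Sum>l=1..t. norm (b \<beta> \<mu> (t - l))))"
    by (subst sum.swap) (simp add: sum_distrib_left)
  also have "\<dots> \<le> (\<Sum>\<mu>\<in>(UNIV :: 'q set). ?L * ?L)"
  proof (intro sum_mono mult_left_mono L)
    fix \<mu>
    have "(\<Sum>l=1..t. norm (b \<beta> \<mu> (t - l))) = (\<Sum>k<t. norm (b \<beta> \<mu> k))"
      by (rule sum.reindex_bij_witness[of _ "\<lambda>k. t - k" "\<lambda>l. t - l"]) auto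
    then show "(\<Sum>l=1..t. norm (b \<beta> \<mu> (t - l))) \<le> ?L" using bd by simp
  qed
  finally show ?thesis by (simp add: power2_eq_square)
qed

definition inverse_error_le ::
    "real \<Rightarrow> (complex \<Rightarrow> 'q::finite cmat) \<Rightarrow> (complex \<Rightarrow> 'q cmat) \<Rightarrow> real \<Rightarrow> bool" where
  "inverse_error_le d w gs Q \<longleftrightarrow> (\<forall>n. \<forall>s\<in>{1..n}. \<forall>t\<in>{1..n}. \<forall>\<alpha> \<beta>.
     norm (block_inv n (toeplitz_block w) s t $ \<alpha> $ \<beta> - toeplitz_inf_inv d gs s t $ \<alpha> $ \<beta>)
       \<le> Q * dist_bound d n s * dist_bound d n t)"

text \<open>Collects what the matrix theory gives for an actual weight, with the power series of
  \<open>gs\<close> and of its inverse as the analytic factors of c and b.\<close>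

lemma toeplitz_inverse_bounds:
  fixes g gs w :: "complex \<Rightarrow> 'q::finite cmat"
  assumes d: "0 < d" "d < 1 / 2" and w: "weight_factor d w g" and gs: "sharp_factor g gs"
  shows "\<exists>Q R. 0 \<le> Q \<and> inverse_error_le d w gs Q \<and>
    (\<forall>n. is_block_inv n (toeplitz_block w) (block_inv n (toeplitz_block w))) \<and>
    (\<forall>n t \<alpha> \<beta>. (\<Sum>s=1..n. norm (toeplitz_inf_inv d gs s t $ \<alpha> $ \<beta>)) \<le> R)"
proof -
  have rat: "rational_invertible_on_disk gs" using gs by (simp add: sharp_factor_def)
  then have det: "det (gs z) \<noteq> 0" if "z \<in> cball 0 1" for z
    using that unfolding rational_invertible_on_disk_def by blast
  obtain A B where A: "\<And>i j. 1 < fps_conv_radius (A i j)" and B: "\<And>i j. 1 < fps_conv_radius (B i j)"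
    and evA: "\<And>z i j. z \<in> cball 0 1 \<Longrightarrow> gs z $ i $ j = eval_fps (A i j) z"
    and evB: "\<And>z i j. z \<in> cball 0 1 \<Longrightarrow> matrix_inv (gs z) $ i $ j = eval_fps (B i j) z"
    using rational_invertible_on_disk_fps[OF rat] by blast
  have AB: "(\<Sum>\<mu>\<in>UNIV. A \<alpha> \<mu> * B \<mu> \<beta>) = (if \<alpha> = \<beta> then 1 else 0)" for \<alpha> \<beta>
  proof (rule fps_matrix_inverse[OF A B])
    fix z :: complex assume z: "z \<in> cball 0 1"
    have "(gs z ** matrix_inv (gs z)) $ \<alpha> $ \<beta> = mat 1 $ \<alpha> $ \<beta>"
      using matrix_inv_right_left(1)[OF det[OF z]] by simp
    then show "(\<Sum>\<mu>\<in>UNIV. eval_fps (A \<alpha> \<mu>) z * eval_fps (B \<mu> \<beta>) z) = (if \<alpha> = \<beta> then 1 else 0)"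
      by (simp add: matrix_matrix_mult_def evA[OF z] evB[OF z] mat_def)
  qed
  have BA: "(\<Sum>\<mu>\<in>UNIV. B \<alpha> \<mu> * A \<mu> \<beta>) = (if \<alpha> = \<beta> then 1 else 0)" for \<alpha> \<beta>
  proof (rule fps_matrix_inverse[OF B A])
    fix z :: complex assume z: "z \<in> cball 0 1"
    have "(matrix_inv (gs z) ** gs z) $ \<alpha> $ \<beta> = mat 1 $ \<alpha> $ \<beta>"
      using matrix_inv_right_left(2)[OF det[OF z]] by simp
    then show "(\<Sum>\<mu>\<in>UNIV. eval_fps (B \<alpha> \<mu>) z * eval_fps (A \<mu> \<beta>) z) = (if \<alpha> = \<beta> then 1 else 0)"
      by (simp add: matrix_matrix_mult_def evA[OF z] evB[OF z] mat_def)
  qed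
  obtain K where "fractional_matrix_pair d K (\<lambda>i j. fps_nth (binom_fps (- d) * A i j)) (\<lambda>i j. fps_nth (binom_fps d * B i j))"
    using fractional_matrix_pair_binom[where A = A and B = B, OF d A B AB BA] by blast
  then interpret F: fractional_matrix_pair d K "\<lambda>i j. fps_nth (binom_fps (- d) * A i j)" "\<lambda>i j. fps_nth (binom_fps d * B i j)" .
  have T: "flatten (toeplitz_block w) = F.Tmat"
  proof (intro ext)
    fix x y :: "nat \<times> 'q"
    obtain s \<alpha> t \<beta> where xy: "x = (s, \<alpha>)" "y = (t, \<beta>)" by (metis surj_pair)
    show "flatten (toeplitz_block w) x y = F.Tmat x y"
      unfolding xy flatten_def F.Tmat_def case_prod_conv
      by (rule toeplitz_block_entry[OF d w gs A]) (rule evA)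
  qed
  have at: "a_tilde d gs k = (\<chi> i j. - cnj (fps_nth (binom_fps d * B j i) k))" for k
    by (rule a_tilde_eq[OF d(1)]) (use B evB det in auto)
  \<comment> \<open>The two minus signs of \<open>a_tilde\<close> cancel.\<close>
  have S: "toeplitz_inf_inv d gs s t $ \<alpha> $ \<beta> = F.Smat (s, \<alpha>) (t, \<beta>)" for s t \<alpha> \<beta>
    by (simp add: toeplitz_inf_inv_def F.Smat_def matrix_matrix_mult_def at)
  have inv: "is_block_inv n (toeplitz_block w) (block_inv n (toeplitz_block w))" for n
  proof -
    let ?I = "block_index n :: (nat \<times> 'q) set"
    obtain B where B: "mm ?I (corner n F.Tmat) B = idm ?I" "mm ?I B (corner n F.Tmat) = idm ?I"
      using F.Tmat_inverse_exists[of n] by blast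
    let ?B = "\<lambda>s t. \<chi> \<alpha> \<beta>. B (s, \<alpha>) (t, \<beta>)"
    have fl: "flatten ?B = B" by (auto simp: flatten_def fun_eq_iff)
    have "mm ?I (corner n F.Tmat) (corner n B) = idm ?I"
      using arg_cong[OF B(1), of "corner n"] by (simp add: mm_restr[symmetric] restr_idm)
    moreover have "mm ?I (corner n B) (corner n F.Tmat) = idm ?I"
      using arg_cong[OF B(2), of "corner n"] by (simp add: mm_restr[symmetric] restr_idm)
    ultimately have "is_block_inv n (toeplitz_block w) ?B"
      unfolding is_block_inv_iff T fl by blast
    then show ?thesis by (rule is_block_inv_block_inv)
  qed
  have bound: "norm (block_inv n (toeplitz_block w) s t $ \<alpha> $ \<beta> - toeplitz_inf_inv d gs s t $ \<alpha> $ \<beta>) \<le> F.Q * dist_bound d n s * dist_bound d n t"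
    if st: "s \<in> {1..n}" "t \<in> {1..n}" for n s t \<alpha> \<beta>
  proof -
    note inv = inv[of n, unfolded is_block_inv_iff T]
    show ?thesis
      using F.inverse_entry_bound[OF conjunct1[OF inv] conjunct2[OF inv] st, of \<alpha> \<beta>]
      by (simp add: S flatten_def)
  qed
  show ?thesis
    using F.Q_nonneg inv bound F.sum_norm_Smat_le unfolding S[symmetric] inverse_error_le_def by blast
qed

section \<open>Size and sum of the diagonal bound\<close>

lemma powr_mult_le_add_powr:
  fixes x y a b :: real
  assumes "0 < x" "0 < y" "0 \<le> a" "0 \<le> b"
  shows "x powr (- a) * y powr (- b) \<le> x powr (- a - b) + y powr (- a - b)"
proof (cases "x \<le> y")
  case True
  have "x powr (- a) * y powr (- b) \<le> x powr (- a) * x powr (- b)"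
    using assms True by (intro mult_left_mono powr_mono2') auto
  also have "\<dots> = x powr (- a - b)" by (simp add: powr_add[symmetric])
  finally show ?thesis by (simp add: add_increasing2)
next
  case False
  have "x powr (- a) * y powr (- b) \<le> y powr (- a) * y powr (- b)"
    using assms False by (intro mult_right_mono powr_mono2') auto
  also have "\<dots> = y powr (- a - b)" by (simp add: powr_add[symmetric])
  finally show ?thesis by (simp add: add_increasing)
qed

text \<open>The mixed product in \<open>dist_bound\<close> is dominated by two pure powers. With the
  unmixed term this makes three sums of powers with exponent -1/2 - d > -1, whence the factor
  3.\<close>

lemma sum_dist_bound_le:
  assumes d: "0 < d" "d < 1 / 2"
  shows "(\<Sum>s=1..n. dist_bound d n s) \<le> 3 / (1 / 2 - d) * real n powr (1 / 2 - d)"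
proof -
  let ?p = "1 / 2 - d"
  have sum: "(\<Sum>s=1..n. real s powr (- (1 / 2) - d)) \<le> real n powr ?p / ?p"
  proof -
    have e: "?p - 1 = - (1 / 2) - d" by simp
    show ?thesis using sum_powr_le[of ?p n] d unfolding e by simp
  qed
  have rev: "(\<Sum>s=1..n. real (n + 1 - s) powr (- (1 / 2) - d)) = (\<Sum>s=1..n. real s powr (- (1 / 2) - d))"
    by (rule sum.reindex_bij_witness[of _ "\<lambda>s. n + 1 - s" "\<lambda>s. n + 1 - s"]) auto
  have "(\<Sum>s=1..n. dist_bound d n s) \<le> (\<Sum>s=1..n. 2 * real (n + 1 - s) powr (- (1 / 2) - d) + real s powr (- (1 / 2) - d))"
  proof (rule sum_mono)
    fix s assume s: "s \<in> {1..n}"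
    have "real (n + 1 - s) powr (- (1 / 2)) * real s powr (- d) \<le> real (n + 1 - s) powr (- (1 / 2) - d) + real s powr (- (1 / 2) - d)"
      using s d by (intro powr_mult_le_add_powr) auto
    moreover have "real (n + 1 - s) powr (- (1 / 2)) * real (n + 1 - s) powr (- d) = real (n + 1 - s) powr (- (1 / 2) - d)"
      by (simp add: powr_add[symmetric])
    ultimately show "dist_bound d n s \<le> 2 * real (n + 1 - s) powr (- (1 / 2) - d) + real s powr (- (1 / 2) - d)"
      by (simp add: dist_bound_def distrib_left)
  qed
  also have "\<dots> = 3 * (\<Sum>s=1..n. real s powr (- (1 / 2) - d))"
    unfolding sum.distrib sum_distrib_left[symmetric] rev by simp
  also have "\<dots> \<le> 3 * (real n powr ?p / ?p)" using sum by simp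
  finally show ?thesis by simp
qed

text \<open>Here both n and t are at most m / (1 - \<delta>) with m = n + 1 - t, so m may be
  replaced by n in the first factor and by t in the second.\<close>

lemma dist_bound_left:
  assumes d: "0 < d" and \<delta>: "0 < \<delta>" "\<delta> < 1" and t: "1 \<le> t" "real t \<le> \<delta> * real n"
  shows "dist_bound d n t \<le> (1 - \<delta>) powr (- 1 / 2) * (1 + (1 - \<delta>) powr (- d)) * real n powr (- 1 / 2) * real t powr (- d)"
proof -
  let ?m = "real (n + 1 - t)"
  have n: "0 < real n" using t by (cases n) auto
  have "\<delta> * real n \<le> 1 * real n" using \<delta> by (intro mult_right_mono) auto
  then have tn: "t \<le> n" using t by simp
  then have m: "(1 - \<delta>) * real n \<le> ?m" using t by (simp add: algebra_simps of_nat_diff)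
  have pos: "0 < (1 - \<delta>) * real n" using \<delta> n by simp
  have "(1 - \<delta>) * real t \<le> (1 - \<delta>) * real n" using \<delta> tn by (intro mult_left_mono) auto
  then have m2: "(1 - \<delta>) * real t \<le> ?m" using m by simp
  have 1: "?m powr (- 1 / 2) \<le> (1 - \<delta>) powr (- 1 / 2) * real n powr (- 1 / 2)"
    using powr_mono2'[OF _ pos m, of "- 1 / 2"] \<delta> n by (simp add: powr_mult)
  have "?m powr (- d) \<le> ((1 - \<delta>) * real t) powr (- d)"
    using \<delta> t d by (intro powr_mono2' m2) auto
  then have 2: "real t powr (- d) + ?m powr (- d) \<le> (1 + (1 - \<delta>) powr (- d)) * real t powr (- d)"
    using \<delta> by (simp add: powr_mult distrib_right)
  have "dist_bound d n t \<le> ((1 - \<delta>) powr (- 1 / 2) * real n powr (- 1 / 2)) * ((1 + (1 - \<delta>) powr (- d)) * real t powr (- d))"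
    unfolding dist_bound_def by (intro mult_mono 1 2) auto
  then show ?thesis by (simp add: mult_ac)
qed

text \<open>Now t is at least \<delta> m with m = n + 1 - t, so all powers reduce to powers of
  m.\<close>

lemma dist_bound_right:
  assumes d: "0 < d" and \<delta>: "0 < \<delta>" and t: "1 \<le> t" "t \<le> n" "\<delta> * real n \<le> real t"
  shows "dist_bound d n t \<le> (1 + \<delta> powr (- d)) * real (n + 1 - t) powr (- 1 / 2 - d)"
proof -
  let ?m = "real (n + 1 - t)"
  have "\<delta> * ?m \<le> \<delta> * real n" using \<delta> t by (intro mult_left_mono) auto
  then have "\<delta> * ?m \<le> real t" using t by simp
  then have "real t powr (- d) \<le> (\<delta> * ?m) powr (- d)"
    using \<delta> t d by (intro powr_mono2') auto
  then have "real t powr (- d) + ?m powr (- d) \<le> (1 + \<delta> powr (- d)) * ?m powr (- d)"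
    using \<delta> by (simp add: powr_mult distrib_right)
  then have "dist_bound d n t \<le> ?m powr (- 1 / 2) * ((1 + \<delta> powr (- d)) * ?m powr (- d))"
    unfolding dist_bound_def by (intro mult_left_mono) auto
  also have "\<dots> = (1 + \<delta> powr (- d)) * ?m powr (- 1 / 2 - d)"
    by (simp add: powr_add[symmetric] mult.left_commute)
  finally show ?thesis .
qed

text \<open>In the first half m = n + 1 - t is comparable to n, and the powers with exponent -d are
  at most 1. The constant is 2 for the comparison times 2 for the two powers.\<close>

lemma dist_bound_half:
  assumes d: "0 < d" and t: "1 \<le> t" "t \<le> n" "n \<le> 2 * (n + 1 - t)"
  shows "dist_bound d n t \<le> 4 * real n powr (- 1 / 2)"
proof -
  let ?m = "real (n + 1 - t)"
  have "real n / 2 \<le> ?m" using t(3) by linarith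
  then have "?m powr (- 1 / 2) \<le> (real n / 2) powr (- 1 / 2)"
    using t by (intro powr_mono2') auto
  also have "\<dots> = 2 powr (1 / 2) * real n powr (- 1 / 2)"
    by (simp add: powr_divide powr_minus field_simps)
  also have "\<dots> \<le> 2 * real n powr (- 1 / 2)"
    using powr_mono[of "1 / 2" 1 "2 :: real"] by (intro mult_right_mono) auto
  finally have m: "?m powr (- 1 / 2) \<le> 2 * real n powr (- 1 / 2)" .
  have one: "x powr (- d) \<le> 1" if "1 \<le> x" for x :: real
    using powr_mono2'[of "- d" 1 x] that d by simp
  have "real t powr (- d) + ?m powr (- d) \<le> 1 + 1"
    using t by (intro add_mono one) auto
  then have "dist_bound d n t \<le> (2 * real n powr (- 1 / 2)) * (1 + 1)"
    unfolding dist_bound_def by (intro mult_mono m) auto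
  then show ?thesis by simp
qed

lemma spectral_norm_le: "spectral_norm M \<le> (\<Sum>\<alpha>\<in>UNIV. \<Sum>\<beta>\<in>UNIV. norm (M $ \<alpha> $ \<beta>))"
  unfolding spectral_norm_def
proof (rule onorm_bound)
  fix x :: "complex ^ 'a"
  have "norm (M *v x) \<le> (\<Sum>\<alpha>\<in>UNIV. norm ((M *v x) $ \<alpha>))" unfolding norm_vec_def by (rule L2_set_le_sum) simp
  also have "\<dots> \<le> (\<Sum>\<alpha>\<in>UNIV. \<Sum>\<beta>\<in>UNIV. norm (M $ \<alpha> $ \<beta>) * norm x)"
    unfolding matrix_vector_mult_def
    by (auto intro!: sum_mono sum_norm_le mult_left_mono Finite_Cartesian_Product.norm_nth_le simp: norm_mult)
  finally show "norm (M *v x) \<le> (\<Sum>\<alpha>\<in>UNIV. \<Sum>\<beta>\<in>UNIV. norm (M $ \<alpha> $ \<beta>)) * norm x"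
    by (simp add: sum_distrib_right)
qed (auto intro!: sum_nonneg)

section \<open>Reversal of the finite Toeplitz matrix\<close>

lemma fourier_coeff_cnj:
  "fourier_coeff (\<lambda>z. w (cnj z)) k = fourier_coeff w (- k)"
proof -
  have "(LBINT \<theta>:{-pi..pi}. cis (- (of_int k * \<theta>)) * w (cnj (cis \<theta>)) $ i $ j)
      = (LBINT \<theta>:{-pi..pi}. cis (- (of_int (- k) * \<theta>)) * w (cis \<theta>) $ i $ j)" for i j
  proof -
    have "{x. - x \<in> {-pi..pi}} = {-pi..pi}" by auto
    then show ?thesis
      by (subst set_integral_reflect) (simp add: cis_cnj)
  qed
  then show ?thesis by (simp add: fourier_coeff_def)
qed

lemma rational_invertible_on_disk_herm_cnj:
  assumes "rational_invertible_on_disk g"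
  shows "rational_invertible_on_disk (\<lambda>z. herm (g (cnj z)))"
  unfolding rational_invertible_on_disk_def
proof (intro conjI allI ballI)
  fix i j
  obtain p r where pr: "\<forall>z\<in>cball 0 1. poly r z \<noteq> 0 \<and> g z $ j $ i = poly p z / poly r z"
    using assms unfolding rational_invertible_on_disk_def by meson
  show "\<exists>p r. \<forall>z\<in>cball 0 1. poly r z \<noteq> 0 \<and> herm (g (cnj z)) $ i $ j = poly p z / poly r z"
  proof (intro exI ballI)
    fix z :: complex assume "z \<in> cball 0 1"
    then have "cnj z \<in> cball 0 1" by simp
    \<comment> \<open>Conjugated coefficients conjugate the value at the conjugate point, so the
      function stays rational in z.\<close>
    then show "poly (map_poly cnj r) z \<noteq> 0 \<and> herm (g (cnj z)) $ i $ j = poly (map_poly cnj p) z / poly (map_poly cnj r) z"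
      using pr by simp
  qed
next
  fix z :: complex assume "z \<in> cball 0 1"
  then have "det (g (cnj z)) \<noteq> 0"
    using assms unfolding rational_invertible_on_disk_def by simp
  then have M: "g (cnj z) ** matrix_inv (g (cnj z)) = mat 1"
    by (rule matrix_inv_right_left)
  have "herm (matrix_inv (g (cnj z))) ** herm (g (cnj z)) = mat 1"
    unfolding herm_mult[symmetric] M by simp
  then have "det (herm (matrix_inv (g (cnj z)))) * det (herm (g (cnj z))) = 1"
    by (metis det_I det_mul)
  then show "det (herm (g (cnj z))) \<noteq> 0" by auto
qed

text \<open>Reflection exchanges the two factorizations: the adjoint of \<open>gs\<close> at the
  conjugate point becomes the left factor, the adjoint of \<open>g\<close> there the sharp factor.
  The reversed weight thus satisfies the same hypotheses.\<close>

lemma reversed_factors: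
  assumes w: "weight_factor d w g" and gs: "sharp_factor g gs"
  shows "weight_factor d (\<lambda>z. w (cnj z)) (\<lambda>z. herm (gs (cnj z)))"
    "sharp_factor (\<lambda>z. herm (gs (cnj z))) (\<lambda>z. herm (g (cnj z)))"
proof -
  have eq: "g (cnj z) ** herm (g (cnj z)) = herm (gs (cnj z)) ** gs (cnj z)" if "z \<in> sphere 0 1" for z
    using gs that unfolding sharp_factor_def by simp
  have "w (cnj z) = norm (1 - z) powr (- 2 * d) *\<^sub>R (g (cnj z) ** herm (g (cnj z)))" if "z \<in> sphere 0 1 - {1}" for z
  proof -
    have "cnj z \<in> sphere 0 1 - {1}" using that by auto
    moreover have "norm (1 - cnj z) = norm (1 - z)"
      using complex_mod_cnj[of "1 - z"] by simp
    ultimately show ?thesis using w unfolding weight_factor_def by metis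
  qed
  with eq w gs show "weight_factor d (\<lambda>z. w (cnj z)) (\<lambda>z. herm (gs (cnj z)))"
    unfolding weight_factor_def sharp_factor_def
    by (auto intro!: rational_invertible_on_disk_herm_cnj)
  show "sharp_factor (\<lambda>z. herm (gs (cnj z))) (\<lambda>z. herm (g (cnj z)))"
    using eq w unfolding weight_factor_def sharp_factor_def
    by (auto intro!: rational_invertible_on_disk_herm_cnj)
qed

text \<open>Reversing both block indices negates their difference, which is the effect of reflection
  on Fourier coefficients. The reversed inverse is an inverse, and inverses are unique.\<close>

lemma block_inv_reversed:
  assumes "is_block_inv n (toeplitz_block (\<lambda>z. w (cnj z))) B'" "is_block_inv n (toeplitz_block w) B"
    and st: "s \<in> {1..n}" "t \<in> {1..n}"
  shows "B s t = B' (n + 1 - s) (n + 1 - t)"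
proof -
  let ?R = "\<lambda>s t. B' (n + 1 - s) (n + 1 - t)"
  have T: "toeplitz_block w s t = toeplitz_block (\<lambda>z. w (cnj z)) (n + 1 - s) (n + 1 - t)"
    if "s \<in> {1..n}" "t \<in> {1..n}" for s t
    using that by (simp add: toeplitz_block_def fourier_coeff_cnj of_nat_diff)
  have 1: "block_mult n (toeplitz_block w) ?R s t = block_mult n (toeplitz_block (\<lambda>z. w (cnj z))) B' (n + 1 - s) (n + 1 - t)"
    if "s \<in> {1..n}" for s t
    unfolding block_mult_def
    by (rule sum.reindex_bij_witness[of _ "\<lambda>u. n + 1 - u" "\<lambda>u. n + 1 - u"]) (use that T in auto)
  have 2: "block_mult n ?R (toeplitz_block w) s t = block_mult n B' (toeplitz_block (\<lambda>z. w (cnj z))) (n + 1 - s) (n + 1 - t)"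
    if "t \<in> {1..n}" for s t
    unfolding block_mult_def
    by (rule sum.reindex_bij_witness[of _ "\<lambda>u. n + 1 - u" "\<lambda>u. n + 1 - u"]) (use that T in auto)
  have "is_block_inv n (toeplitz_block w) ?R"
    unfolding is_block_inv_def
  proof (intro ballI)
    fix s t assume st: "s \<in> {1..n}" "t \<in> {1..n}"
    then have "n + 1 - s \<in> {1..n}" "n + 1 - t \<in> {1..n}" "n + 1 - s = n + 1 - t \<longleftrightarrow> s = t" by auto
    then show "block_mult n (toeplitz_block w) ?R s t = (if s = t then mat 1 else 0) \<and>
        block_mult n ?R (toeplitz_block w) s t = (if s = t then mat 1 else 0)"
      using assms(1) unfolding 1[OF st(1)] 2[OF st(2)] is_block_inv_def by simp
  qed
  from is_block_inv_unique[OF assms(2) this st] show ?thesis .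
qed

text \<open>An entrywise substitute for the column sums of spectral norms: it dominates them, obeys
  the triangle inequality termwise, and survives a reordering of the rows.\<close>

definition column_norm :: "nat \<Rightarrow> (nat \<Rightarrow> nat \<Rightarrow> 'q::finite cmat) \<Rightarrow> nat \<Rightarrow> real" where
  "column_norm n F t = (\<Sum>s=1..n. \<Sum>\<alpha>\<in>UNIV. \<Sum>\<beta>\<in>UNIV. norm (F s t $ \<alpha> $ \<beta>))"

lemma column_norm_diff_le:
  "column_norm n (\<lambda>s t. F s t - G s t) t \<le> column_norm n F t + column_norm n G t"
  unfolding column_norm_def sum.distrib[symmetric] vector_minus_component
  by (intro sum_mono norm_triangle_ineq4)

lemma column_norm_le_diff_add:
  "column_norm n F t \<le> column_norm n (\<lambda>s t. F s t - G s t) t + column_norm n G t"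
  unfolding column_norm_def sum.distrib[symmetric] vector_minus_component
  by (intro sum_mono) (metis norm_triangle_sub add.commute)

definition entry_sum ::
    "real \<Rightarrow> (complex \<Rightarrow> 'q::finite cmat) \<Rightarrow> (complex \<Rightarrow> 'q cmat) \<Rightarrow> nat \<Rightarrow> nat \<Rightarrow> real" where
  "entry_sum d w gs t n =
     column_norm n (\<lambda>s t. block_inv n (toeplitz_block w) s t - toeplitz_inf_inv d gs s t) t"

lemma C_sum_le_entry_sum: "C_sum d w gs t n \<le> entry_sum d w gs t n"
  unfolding C_sum_def entry_sum_def column_norm_def by (intro sum_mono spectral_norm_le)

section \<open>Column estimates\<close>

lemma entry_sum_le_dist_bound:
  fixes w gs :: "complex \<Rightarrow> 'q::finite cmat"
  assumes d: "0 < d" "d < 1 / 2" and Q: "0 \<le> Q"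
    and entries: "inverse_error_le d w gs Q"
    and t: "t \<in> {1..n}"
  shows "entry_sum d w gs t n \<le> (real CARD('q))\<^sup>2 * Q * (3 / (1 / 2 - d)) * real n powr (1 / 2 - d) * dist_bound d n t"
proof -
  have "entry_sum d w gs t n \<le> (\<Sum>s=1..n. \<Sum>\<alpha>\<in>(UNIV :: 'q set). \<Sum>\<beta>\<in>(UNIV :: 'q set). Q * dist_bound d n s * dist_bound d n t)"
    unfolding entry_sum_def column_norm_def vector_minus_component using t entries by (intro sum_mono) (auto simp: inverse_error_le_def)
  also have "\<dots> = (real CARD('q))\<^sup>2 * Q * dist_bound d n t * (\<Sum>s=1..n. dist_bound d n s)"
    by (simp add: sum_distrib_left power2_eq_square mult_ac)
  also have "\<dots> \<le> (real CARD('q))\<^sup>2 * Q * dist_bound d n t * (3 / (1 / 2 - d) * real n powr (1 / 2 - d))"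
    using Q by (intro mult_left_mono sum_dist_bound_le d) (auto simp: dist_bound_nonneg)
  finally show ?thesis by (simp add: mult_ac)
qed

lemma column_bounds:
  fixes g gs w :: "complex \<Rightarrow> 'q::finite cmat"
  assumes d: "0 < d" "d < 1 / 2" and w: "weight_factor d w g" and gs: "sharp_factor g gs"
  shows "\<exists>P R. 0 \<le> P \<and> (\<forall>n. is_block_inv n (toeplitz_block w) (block_inv n (toeplitz_block w))) \<and>
    (\<forall>n t. t \<in> {1..n} \<longrightarrow> entry_sum d w gs t n \<le> P * real n powr (1 / 2 - d) * dist_bound d n t) \<and>
    (\<forall>n t. column_norm n (toeplitz_inf_inv d gs) t \<le> R)"
proof -
  obtain Q R where Q: "0 \<le> Q" and entries: "inverse_error_le d w gs Q"
    and inv: "\<And>n. is_block_inv n (toeplitz_block w) (block_inv n (toeplitz_block w))"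
    and R: "\<And>n t \<alpha> \<beta>. (\<Sum>s=1..n. norm (toeplitz_inf_inv d gs s t $ \<alpha> $ \<beta>)) \<le> R"
    using toeplitz_inverse_bounds[OF d w gs] by metis
  have "column_norm n (toeplitz_inf_inv d gs) t \<le> (real CARD('q))\<^sup>2 * R" for n t
  proof -
    have "column_norm n (toeplitz_inf_inv d gs) t
        = (\<Sum>\<alpha>\<in>UNIV. \<Sum>\<beta>\<in>UNIV. \<Sum>s=1..n. norm (toeplitz_inf_inv d gs s t $ \<alpha> $ \<beta>))"
      unfolding column_norm_def by (subst sum.swap, intro sum.cong refl, rule sum.swap)
    also have "\<dots> \<le> (\<Sum>\<alpha>\<in>(UNIV :: 'q set). \<Sum>\<beta>\<in>(UNIV :: 'q set). R)" by (intro sum_mono R)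
    finally show ?thesis by (simp add: power2_eq_square mult_ac)
  qed
  moreover have "0 \<le> (real CARD('q))\<^sup>2 * Q * (3 / (1 / 2 - d))" using Q d by simp
  ultimately show ?thesis
    using inv entry_sum_le_dist_bound[OF d Q entries] by blast
qed

text \<open>The finite inverses do not involve the factors. For fixed s and t their blocks converge
  to the explicit formula, because \<open>dist_bound\<close> tends to 0 as n grows.\<close>

lemma toeplitz_inf_inv_unique:
  fixes w gs gs' :: "complex \<Rightarrow> 'q::finite cmat"
  assumes d: "0 < d" "d < 1 / 2" and w: "weight_factor d w g" "sharp_factor g gs"
    and w': "weight_factor d w g'" "sharp_factor g' gs'" and st: "1 \<le> s" "1 \<le> t"
  shows "toeplitz_inf_inv d gs s t = toeplitz_inf_inv d gs' s t"
proof -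
  have lim: "(\<lambda>n. block_inv n (toeplitz_block w) s t $ \<alpha> $ \<beta>) \<longlonglongrightarrow> toeplitz_inf_inv d gs s t $ \<alpha> $ \<beta>"
    if w: "weight_factor d w g" "sharp_factor g gs" for g gs :: "complex \<Rightarrow> 'q cmat" and \<alpha> \<beta>
  proof -
    obtain Q where entries: "inverse_error_le d w gs Q"
      using toeplitz_inverse_bounds[OF d w] by blast
    have "(\<lambda>n. dist_bound d n r) \<longlonglongrightarrow> 0" for r
      unfolding dist_bound_def
    proof (rule LIMSEQ_offset[of _ r])
      show "(\<lambda>n. real (n + r + 1 - r) powr (- 1 / 2) * (real r powr (- d) + real (n + r + 1 - r) powr (- d))) \<longlonglongrightarrow> 0"
        using d by simp real_asymp
    qed
    then have "(\<lambda>n. Q * dist_bound d n s * dist_bound d n t) \<longlonglongrightarrow> Q * 0 * 0"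
      by (intro tendsto_intros)
    then have lim0: "(\<lambda>n. Q * dist_bound d n s * dist_bound d n t) \<longlonglongrightarrow> 0" by simp
    have ev: "eventually (\<lambda>n. norm (block_inv n (toeplitz_block w) s t $ \<alpha> $ \<beta> - toeplitz_inf_inv d gs s t $ \<alpha> $ \<beta>)
        \<le> Q * dist_bound d n s * dist_bound d n t) sequentially"
      using eventually_ge_at_top[of "max s t"] 
        by eventually_elim (use st entries in \<open>auto simp: inverse_error_le_def\<close>)
    show ?thesis
      by (rule LIM_zero_cancel[OF Lim_null_comparison[OF ev lim0]])
  qed
  show ?thesis
    unfolding vec_eq_iff by (intro allI LIMSEQ_unique[OF lim[OF w] lim[OF w']])
qed

lemma C_sum_unique:
  assumes "0 < d" "d < 1 / 2" "weight_factor d w g" "sharp_factor g gs"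
    "weight_factor d w g'" "sharp_factor g' gs'" "t \<in> {1..n}"
  shows "C_sum d w gs t n = C_sum d w gs' t n"
  unfolding C_sum_def
  using toeplitz_inf_inv_unique[OF assms(1-6)] assms(7) by (intro sum.cong refl) auto

text \<open>In the first half the powers of n combine to n^(-d), which is at most 1.\<close>

lemma entry_sum_half:
  assumes d: "0 < d" and P: "0 \<le> P"
    and bd: "\<And>n t. t \<in> {1..n} \<Longrightarrow> entry_sum d w gs t n \<le> P * real n powr (1 / 2 - d) * dist_bound d n t"
    and t: "t \<in> {1..n}" "n \<le> 2 * (n + 1 - t)"
  shows "entry_sum d w gs t n \<le> 4 * P"
proof -
  have n: "1 \<le> real n" using t by simp
  have "entry_sum d w gs t n \<le> P * real n powr (1 / 2 - d) * (4 * real n powr (- 1 / 2))"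
    using t by (intro order.trans[OF bd[OF t(1)]] mult_left_mono dist_bound_half d) (auto simp: P)
  also have "\<dots> = 4 * P * real n powr (- d)"
    by (simp add: powr_add[symmetric])
  also have "\<dots> \<le> 4 * P * 1"
    using powr_mono2'[of "- d" 1 "real n"] n d P by (intro mult_left_mono) auto
  finally show ?thesis by simp
qed

lemma C_sum_bounded:
  fixes w g gs :: "complex \<Rightarrow> 'q::finite cmat"
  assumes d: "0 < d" "d < 1 / 2" and w: "weight_factor d w g" and gs: "sharp_factor g gs"
  shows "\<exists>C. \<forall>n. \<forall>t\<in>{1..n}. C_sum d w gs t n \<le> C"
proof -
  let ?w = "\<lambda>z. w (cnj z)" and ?gs = "\<lambda>z. herm (g (cnj z))"
  obtain P R where P: "0 \<le> P" and inv: "\<And>n. is_block_inv n (toeplitz_block w) (block_inv n (toeplitz_block w))"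
    and bd: "\<And>n t. t \<in> {1..n} \<Longrightarrow> entry_sum d w gs t n \<le> P * real n powr (1 / 2 - d) * dist_bound d n t"
    and R: "\<And>n t. column_norm n (toeplitz_inf_inv d gs) t \<le> R"
    using column_bounds[OF d w gs] by metis
  obtain P' R' where P': "0 \<le> P'" and inv': "\<And>n. is_block_inv n (toeplitz_block ?w) (block_inv n (toeplitz_block ?w))"
    and bd': "\<And>n t. t \<in> {1..n} \<Longrightarrow> entry_sum d ?w ?gs t n \<le> P' * real n powr (1 / 2 - d) * dist_bound d n t"
    and R': "\<And>n t. column_norm n (toeplitz_inf_inv d ?gs) t \<le> R'"
    using column_bounds[OF d reversed_factors[OF w gs]] by metis
  have R0: "0 \<le> R" "0 \<le> R'" using R[of 0 0] R'[of 0 0] by (auto simp: column_norm_def)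
  have "entry_sum d w gs t n \<le> 4 * P + 4 * P' + R' + R" if t: "t \<in> {1..n}" for n t
  proof (cases "n \<le> 2 * (n + 1 - t)")
    case True
    then show ?thesis using entry_sum_half[OF d(1) P bd t] P' R0 by simp
  next
    \<comment> \<open>For t in the second half the column of T_n^(-1) and that of the explicit
      inverse are bounded separately. The former is, up to the order of its rows, column n + 1 - t
      of the reversed inverse, which lies in the first half.\<close>
    case False
    define t' where "t' = n + 1 - t"
    have t': "t' \<in> {1..n}" "n \<le> 2 * (n + 1 - t')" using t False by (auto simp: t'_def)
    let ?B = "block_inv n (toeplitz_block w)" and ?B' = "block_inv n (toeplitz_block ?w)"
    have rev: "?B s t = ?B' (n + 1 - s) t'" if "s \<in> {1..n}" for s
      unfolding t'_def by (rule block_inv_reversed[OF inv' inv that t])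
    have "column_norm n ?B t = column_norm n ?B' t'"
      unfolding column_norm_def
      by (rule sum.reindex_bij_witness[of _ "\<lambda>s. n + 1 - s" "\<lambda>s. n + 1 - s"]) (auto simp: rev)
    also have "\<dots> \<le> entry_sum d ?w ?gs t' n + column_norm n (toeplitz_inf_inv d ?gs) t'"
      unfolding entry_sum_def by (rule column_norm_le_diff_add)
    also have "\<dots> \<le> 4 * P' + R'"
      by (intro add_mono R' entry_sum_half[OF d(1) P' bd' t'])
    finally have B: "column_norm n ?B t \<le> 4 * P' + R'" .
    have "entry_sum d w gs t n \<le> column_norm n ?B t + column_norm n (toeplitz_inf_inv d gs) t"
      unfolding entry_sum_def by (rule column_norm_diff_le)
    also have "\<dots> \<le> (4 * P' + R') + R" by (intro add_mono B R)
    finally show ?thesis using P by simp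
  qed
  then show ?thesis using order.trans[OF C_sum_le_entry_sum] by blast
qed

lemma C_sum_decay:
  fixes w g gs :: "complex \<Rightarrow> 'q::finite cmat"
  assumes d: "0 < d" "d < 1 / 2" and w: "weight_factor d w g" and gs: "sharp_factor g gs"
    and \<delta>: "0 < \<delta>" "\<delta> < 1"
  shows "\<exists>M>0. (\<forall>n\<ge>1. \<forall>t\<in>{1..nat \<lfloor>\<delta> * real n\<rfloor>}. C_sum d w gs t n \<le> M * real n powr (- d) * real t powr (- d)) \<and>
    (\<forall>n\<ge>1. \<forall>t\<in>{nat \<lfloor>\<delta> * real n\<rfloor> + 1..n}.
       C_sum d w gs t n \<le> M * real n powr (1 / 2 - d) * (real n + 1 - real t) powr (- 1 / 2 - d))"
proof -
  obtain P where P: "0 \<le> P"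
    and bd: "\<And>n t. t \<in> {1..n} \<Longrightarrow> entry_sum d w gs t n \<le> P * real n powr (1 / 2 - d) * dist_bound d n t"
    using column_bounds[OF d w gs] by metis
  define c1 where "c1 = (1 - \<delta>) powr (- 1 / 2) * (1 + (1 - \<delta>) powr (- d))"
  define c2 where "c2 = 1 + \<delta> powr (- d)"
  \<comment> \<open>The constants of the two ranges of t, added; the final 1 makes M positive even
    if P = 0.\<close>
  define M where "M = P * (c1 + c2) + 1"
  have c: "0 \<le> c1" "0 \<le> c2" by (simp_all add: c1_def c2_def)
  then have M: "P * c1 \<le> M" "P * c2 \<le> M" "0 < M"
    using P by (simp_all add: M_def distrib_left add_nonneg_pos)
  have "C_sum d w gs t n \<le> M * real n powr (- d) * real t powr (- d)" if t: "t \<in> {1..nat \<lfloor>\<delta> * real n\<rfloor>}" for n t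
  proof -
    have t\<delta>: "real t \<le> \<delta> * real n" using t \<delta> by (auto simp: le_nat_iff le_floor_iff)
    also have "\<dots> \<le> 1 * real n" using \<delta> by (intro mult_right_mono) auto
    finally have tn: "t \<in> {1..n}" using t by simp
    have "C_sum d w gs t n \<le> P * real n powr (1 / 2 - d) * (c1 * real n powr (- 1 / 2) * real t powr (- d))"
      unfolding c1_def using t t\<delta> \<delta> d P
      by (intro order.trans[OF C_sum_le_entry_sum] order.trans[OF bd[OF tn]] mult_left_mono dist_bound_left) auto
    also have "\<dots> = (P * c1) * (real n powr (1 / 2 - d) * real n powr (- 1 / 2)) * real t powr (- d)"
      by (simp add: mult_ac)
    also have "real n powr (1 / 2 - d) * real n powr (- 1 / 2) = real n powr (- d)"
      by (simp add: powr_add[symmetric])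
    also have "(P * c1) * real n powr (- d) * real t powr (- d) \<le> M * real n powr (- d) * real t powr (- d)"
      using M by (intro mult_right_mono) auto
    finally show ?thesis .
  qed
  moreover have "C_sum d w gs t n \<le> M * real n powr (1 / 2 - d) * (real n + 1 - real t) powr (- 1 / 2 - d)"
    if t: "t \<in> {nat \<lfloor>\<delta> * real n\<rfloor> + 1..n}" for n t
  proof -
    have tn: "t \<in> {1..n}" using t by simp
    have "nat \<lfloor>\<delta> * real n\<rfloor> < t" using t by simp
    then have "\<lfloor>\<delta> * real n\<rfloor> < int t" by linarith
    then have t\<delta>: "\<delta> * real n \<le> real t" by linarith
    have "C_sum d w gs t n \<le> P * real n powr (1 / 2 - d) * (c2 * real (n + 1 - t) powr (- 1 / 2 - d))"
      unfolding c2_def using tn t\<delta> \<delta> d P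
      by (intro order.trans[OF C_sum_le_entry_sum] order.trans[OF bd[OF tn]] mult_left_mono dist_bound_right) auto
    also have "\<dots> = (P * c2) * real n powr (1 / 2 - d) * real (n + 1 - t) powr (- 1 / 2 - d)"
      by (simp add: mult_ac)
    also have "\<dots> \<le> M * real n powr (1 / 2 - d) * real (n + 1 - t) powr (- 1 / 2 - d)"
      using M by (intro mult_right_mono) auto
    also have "real (n + 1 - t) = real n + 1 - real t" using tn by (simp add: of_nat_diff)
    finally show ?thesis .
  qed
  ultimately show ?thesis using M(3) by blast
qed

theorem theorem1p1:
  fixes d \<delta> :: real
    and w :: "complex \<Rightarrow> complex ^ 'q ^ 'q"
  assumes "0 < d" "d < 1/2"
    and "\<exists>g. weight_factor d w g"
    and "0 < \<delta>" "\<delta> < 1"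
  shows "(\<exists>M>0. \<forall>g gs. weight_factor d w g \<and> sharp_factor g gs \<longrightarrow>
           (\<forall>n\<ge>1. \<forall>t\<in>{1..nat \<lfloor>\<delta> * real n\<rfloor>}.
              C_sum d w gs t n \<le> M * real n powr (- d) * real t powr (- d)) \<and>
           (\<forall>n\<ge>1. \<forall>t\<in>{nat \<lfloor>\<delta> * real n\<rfloor> + 1..n}.
              C_sum d w gs t n \<le> M * real n powr (1/2 - d) * (real n + 1 - real t) powr (- 1/2 - d))) \<and>
         (\<forall>g gs. weight_factor d w g \<and> sharp_factor g gs \<longrightarrow>
           (SUP n\<in>{1..}. MAX t\<in>{1..n}. ereal (C_sum d w gs t n)) < \<infinity>)"
proof (intro conjI allI impI, goal_cases)
  case 1
  show ?case
  \<comment> \<open>M has to be chosen before the factors. It is computed from one pair and carried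
    to every other pair by \<open>C_sum_unique\<close>; without any pair the claim is
    vacuous.\<close>
  proof (cases "\<exists>g gs. weight_factor d w g \<and> sharp_factor g gs")
    case True
    then obtain g0 gs0 where 0: "weight_factor d w g0" "sharp_factor g0 gs0" by blast
    obtain M where M: "M > 0"
      "\<And>n t. n \<ge> 1 \<Longrightarrow> t \<in> {1..nat \<lfloor>\<delta> * real n\<rfloor>} \<Longrightarrow> C_sum d w gs0 t n \<le> M * real n powr (- d) * real t powr (- d)"
      "\<And>n t. n \<ge> 1 \<Longrightarrow> t \<in> {nat \<lfloor>\<delta> * real n\<rfloor> + 1..n} \<Longrightarrow>
         C_sum d w gs0 t n \<le> M * real n powr (1 / 2 - d) * (real n + 1 - real t) powr (- 1 / 2 - d)"
      using C_sum_decay[OF assms(1,2) 0 assms(4,5)] by blast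
    \<comment> \<open>Keeps both ranges of t inside \<open>{1..n}\<close>, where
      \<open>C_sum_unique\<close> applies.\<close>
    have le: "nat \<lfloor>\<delta> * real n\<rfloor> \<le> n" for n
    proof -
      have "\<delta> * real n \<le> 1 * real n" using assms(5) by (intro mult_right_mono) auto
      then show ?thesis by (simp add: nat_le_iff floor_le_iff)
    qed
    have eq: "C_sum d w gs t n = C_sum d w gs0 t n"
      if "weight_factor d w g \<and> sharp_factor g gs" "t \<in> {1..n}" for g gs n t
      using C_sum_unique[OF assms(1,2) _ _ 0 that(2)] that(1) by blast
    have sub: "{1..nat \<lfloor>\<delta> * real n\<rfloor>} \<subseteq> {1..n}" "{nat \<lfloor>\<delta> * real n\<rfloor> + 1..n} \<subseteq> {1..n}" for n
      using le[of n] by auto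
    show ?thesis
    proof (intro exI[of _ M] conjI M(1) allI impI ballI)
      fix g gs n t assume gs: "weight_factor d w g \<and> sharp_factor g gs" and n: "(1::nat) \<le> n"
      show "C_sum d w gs t n \<le> M * real n powr (- d) * real t powr (- d)" if "t \<in> {1..nat \<lfloor>\<delta> * real n\<rfloor>}"
        unfolding eq[OF gs subsetD[OF sub(1) that]] by (rule M(2)[OF n that])
      show "C_sum d w gs t n \<le> M * real n powr (1/2 - d) * (real n + 1 - real t) powr (- 1/2 - d)"
        if "t \<in> {nat \<lfloor>\<delta> * real n\<rfloor> + 1..n}"
        unfolding eq[OF gs subsetD[OF sub(2) that]] by (rule M(3)[OF n that])
    qed
  qed (auto intro: exI[of _ 1])
next
  case gs: (2 g gs)
  obtain C where C: "\<And>n t. t \<in> {1..n} \<Longrightarrow> C_sum d w gs t n \<le> C"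
    using C_sum_bounded[OF assms(1,2)] gs by blast
  have "(SUP n\<in>{1..}. MAX t\<in>{1..n}. ereal (C_sum d w gs t n)) \<le> ereal C"
    using C by (intro SUP_least) (subst Max_le_iff, auto)
  then show ?case by (rule le_less_trans) simp
qed

end
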